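(* Let $\mathcal{A}=\{H_i=z_i^\perp : i=1,\dots,n\}$ be an arrangement of $n$ distinct linear hyperplanes in $\mathbb{R}^d$, where $z_1,\dots,z_n$ are contained in an open halfspace (bounded by a linear hyperplane). Let $\mathcal{L}_{d-2}(\mathcal{A})$ be the set of $(d-2)$-dimensional flats of $\mathcal{A}$. Then, via $\lambda\mapsto Z_\lambda$, $$\mathcal{Z}(\mathcal{A})\cong\{\lambda\in\mathbb{R}^n : R_L\lambda_L=0 \text{ for all } L\in\mathcal{L}_{d-2}(\mathcal{A})\}$$ as vector spaces, and $$\mathcal{Z}_+(\mathcal{A})\cong\{\lambda\in\mathbb{R}_{>0}^n : R_L\lambda_L=0 \text{ for all } L\in\mathcal{L}_{d-2}(\mathcal{A})\}$$ as cones.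
   Context: A flat is an intersection of hyperplanes of $\mathcal{A}$. For $L\in\mathcal{L}_{d-2}(\mathcal{A})$ let $i_1,\dots,i_k$ be the indices $s$ with $L\subset H_s$, ordered such that $z_{i_1},\dots,z_{i_k},-z_{i_1},\dots,-z_{i_k}$ is cyclically ordered in the $2$-dimensional space $L^\perp$. $R_L\in\mathbb{R}^{k\times k}$ is the skew-Gram matrix of $(z_{i_1},\dots,z_{i_k})$: the skew-symmetric matrix with $(R_L)_{ab}=-(R_L)_{ba}=\langle z_{i_a},z_{i_b}\rangle$ for $a<b$ and zero diagonal. $\lambda_L=(\lambda_{i_1},\dots,\lambda_{i_k})$. For $\lambda\in\mathbb{R}^n_{>0}$, $Z_\lambda=\sum_i\lambda_i[-z_i,z_i]$ (Minkowski sum), a zonotope with normal fan the fan of $\mathcal{A}$; up to translation these are all such zonotopes. $\mathcal{Z}_+(\mathcal{A})$ is the cone (under Minkowski addition) of translation classes of zonotopes with normal fan $\mathcal{A}$ that are inscribed (all vertices on a common sphere). Virtual polytopes of $\mathcal{A}$ are the continuous functions $\ell:\mathbb{R}^d\to\mathbb{R}$ that are linear on every region of $\mathcal{A}$ (region = closure of a connected component of $\mathbb{R}^d\setminus\bigcup\mathcal{A}$); a polytope with normal fan $\mathcal{A}$ is identified with its support function, and translation corresponds to adding a linear function. For each region $R$ let $v_R$ be the vector with $\ell(x)=\langle v_R,x\rangle$ on $R$, and $V(\ell)=\{v_R\}$ the vertex set. $\ell$ is inscribed if $V(\ell)$ lies on a sphere; $c(\ell)$ is then its center, taken in the affine hull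 of $V(\ell)$. The inscribed space $\mathcal{I}(\mathcal{A})$ consists of the $\ell$ (modulo translation) that are inscribed and satisfy $\langle\alpha_{RS},\tfrac12(v_R+v_S)-c(\ell)\rangle=0$ for all regions $R,S$ with $R\cap S$ of codimension 1, where $\alpha_{RS}$ is a normal vector of $\operatorname{lin}(R\cap S)$. For $\lambda\in\mathbb{R}^n$ the virtual zonotope $Z_\lambda$ is the function $c\mapsto\sum_i\lambda_i|\langle z_i,c\rangle|$. $\mathcal{Z}(\mathcal{A})$ is the subspace of $\mathcal{I}(\mathcal{A})$ of classes of virtual zonotopes $Z_\lambda$, $\lambda\in\mathbb{R}^n$. *)

theory Defs
  imports "HOL-Analysis.Analysis" "HOL-Library.Set_Algebras"
begin

subsection \<open>Linear hyperplane arrangements\<close>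

definition hyperplane :: "'a::euclidean_space \<Rightarrow> 'a set" where
  "hyperplane v = {x. v \<bullet> x = 0}"

definition arrangement :: "('n \<Rightarrow> 'a::euclidean_space) \<Rightarrow> 'a set set" where
  "arrangement z = range (\<lambda>i. hyperplane (z i))"

definition regions :: "'a::euclidean_space set set \<Rightarrow> 'a set set" where
  "regions A = closure ` components (- \<Union>A)"

definition arrangement_fan :: "'a::euclidean_space set set \<Rightarrow> 'a set set" where
  "arrangement_fan A = {C. C \<noteq> {} \<and> (\<exists>R\<in>regions A. C face_of R)}"

definition flats :: "'a::euclidean_space set set \<Rightarrow> 'a set set" where
  "flats A = {\<Inter>B | B. B \<subseteq> A}"

text \<open>Dimension \<open>d - 2\<close> is written without subtraction, so that there are no such flats for
  \<open>d = 1\<close>.\<close>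

definition codim2_flats :: "'a::euclidean_space set set \<Rightarrow> 'a set set" where
  "codim2_flats A = {L \<in> flats A. dim L + 2 = DIM('a)}"


subsection \<open>The matrices \<open>R\<^sub>L\<close>\<close>

text \<open>The nonzero vectors \<open>ps\<close> are met in this order, in pairwise different directions, within a
  single turn around the origin of the plane \<open>W\<close>. Either orientation of \<open>W\<close> is allowed, since
  the orthonormal basis may be chosen freely.\<close>

definition cyclically_ordered :: "'a::euclidean_space set \<Rightarrow> 'a list \<Rightarrow> bool" where
  "cyclically_ordered W ps \<longleftrightarrow>
    (\<exists>e1 e2 \<theta>.
       norm e1 = 1 \<and> norm e2 = 1 \<and> e1 \<bullet> e2 = 0 \<and> span {e1, e2} = W \<and>
       (\<forall>i<length ps. ps ! i \<noteq> 0 \<and>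
          ps ! i = norm (ps ! i) *\<^sub>R (cos (\<theta> i) *\<^sub>R e1 + sin (\<theta> i) *\<^sub>R e2)) \<and>
       (\<forall>i j. i < j \<longrightarrow> j < length ps \<longrightarrow> \<theta> i < (\<theta> j :: real)) \<and>
       (\<forall>i<length ps. \<theta> i < \<theta> 0 + 2 * pi))"

definition flat_ordering ::
  "('n \<Rightarrow> 'a::euclidean_space) \<Rightarrow> 'a set \<Rightarrow> 'n list \<Rightarrow> bool" where
  "flat_ordering z L is \<longleftrightarrow>
    distinct is \<and> set is = {s. L \<subseteq> hyperplane (z s)} \<and>
    cyclically_ordered (orthogonal_comp L) (map z is @ map (\<lambda>s. - z s) is)"

text \<open>The size \<open>k = length vs\<close> varies, so \<open>k \<times> k\<close> matrices are functions on \<open>{..<k} \<times> {..<k}\<close>,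
  with indices starting at 0.\<close>

definition skew_gram :: "'a::euclidean_space list \<Rightarrow> nat \<Rightarrow> nat \<Rightarrow> real" where
  "skew_gram vs a b =
    (if a < b then vs ! a \<bullet> vs ! b else if b < a then - (vs ! b \<bullet> vs ! a) else 0)"

text \<open>The ordering of the indices belonging to \<open>L\<close> is determined only up to reversal; the equation
  \<open>R\<^sub>L \<lambda>\<^sub>L = 0\<close> is demanded for every admissible ordering. An ordering exists when the hyperplanes
  are distinct and all \<open>z i\<close> lie in a common open halfspace.\<close>

definition flat_equation ::
  "('n \<Rightarrow> 'a::euclidean_space) \<Rightarrow> 'a set \<Rightarrow> real^'n \<Rightarrow> bool" where
  "flat_equation z L l \<longleftrightarrow>
    (\<forall>is. flat_ordering z L is \<longrightarrow>
       (\<forall>a<length is. (\<Sum>b<length is. skew_gram (map z is) a b * l $ (is ! b)) = 0))"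


subsection \<open>Functions modulo translation\<close>

text \<open>Real functions up to addition of linear functions. On support functions, adding
  \<open>x \<mapsto> a \<bullet> x\<close> is translation of the polytope by \<open>a\<close>.\<close>

definition translation_equiv :: "('a::real_inner \<Rightarrow> real) \<Rightarrow> ('a \<Rightarrow> real) \<Rightarrow> bool" where
  "translation_equiv f g \<longleftrightarrow> (\<exists>a. \<forall>x. g x = f x + a \<bullet> x)"

lemma equivp_translation_equiv: "equivp translation_equiv"
proof (rule equivpI)
  show "reflp translation_equiv"
    unfolding reflp_def translation_equiv_def by (metis add.right_neutral inner_zero_left)
  show "symp translation_equiv"
    unfolding symp_def translation_equiv_def
    by (metis add_diff_cancel_right' diff_conv_add_uminus inner_minus_left)
  show "transp translation_equiv"
    unfolding transp_def translation_equiv_def by (metis add.assoc inner_add_left)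
qed

quotient_type (overloaded) 'a mod_translation =
  "'a::real_inner \<Rightarrow> real" / translation_equiv
  by (rule equivp_translation_equiv)

lift_definition fun_class :: "('a::real_inner \<Rightarrow> real) \<Rightarrow> 'a mod_translation" is "\<lambda>f. f" .

instantiation mod_translation :: (real_inner) real_vector
begin

lift_definition zero_mod_translation :: "'a mod_translation" is "\<lambda>x. 0" .

lift_definition plus_mod_translation ::
    "'a mod_translation \<Rightarrow> 'a mod_translation \<Rightarrow> 'a mod_translation"
  is "\<lambda>f g x. f x + g x"
proof -
  fix f f' g g' :: "'a \<Rightarrow> real"
  assume "translation_equiv f f'" "translation_equiv g g'"
  then obtain a b where "\<forall>x. f' x = f x + a \<bullet> x" "\<forall>x. g' x = g x + b \<bullet> x"
    unfolding translation_equiv_def by blast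
  then show "translation_equiv (\<lambda>x. f x + g x) (\<lambda>x. f' x + g' x)"
    unfolding translation_equiv_def by (intro exI[of _ "a + b"]) (simp add: inner_add_left)
qed

lift_definition uminus_mod_translation :: "'a mod_translation \<Rightarrow> 'a mod_translation"
  is "\<lambda>f x. - f x"
proof -
  fix f g :: "'a \<Rightarrow> real"
  assume "translation_equiv f g"
  then obtain a where "\<forall>x. g x = f x + a \<bullet> x"
    unfolding translation_equiv_def by blast
  then show "translation_equiv (\<lambda>x. - f x) (\<lambda>x. - g x)"
    unfolding translation_equiv_def by (intro exI[of _ "- a"]) simp
qed

definition minus_mod_translation ::
    "'a mod_translation \<Rightarrow> 'a mod_translation \<Rightarrow> 'a mod_translation" where
  "minus_mod_translation p q = p + - q"

lift_definition scaleR_mod_translation :: "real \<Rightarrow> 'a mod_translation \<Rightarrow> 'a mod_translation"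
  is "\<lambda>c f x. c * f x"
proof -
  fix c and f g :: "'a \<Rightarrow> real"
  assume "translation_equiv f g"
  then obtain a where "\<forall>x. g x = f x + a \<bullet> x"
    unfolding translation_equiv_def by blast
  then show "translation_equiv (\<lambda>x. c * f x) (\<lambda>x. c * g x)"
    unfolding translation_equiv_def by (intro exI[of _ "c *\<^sub>R a"]) (simp add: distrib_left)
qed

instance
proof -
  have eq: "translation_equiv f g" if "f = g" for f g :: "'a \<Rightarrow> real"
    using that equivp_reflp[OF equivp_translation_equiv] by blast
  show "OFCLASS('a mod_translation, real_vector_class)"
  proof
    fix a b c :: "'a mod_translation" and r s :: real
    show "a + b + c = a + (b + c)" by transfer (rule eq, simp add: add.assoc)
    show "a + b = b + a" by transfer (rule eq, simp add: add.commute)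
    show "0 + a = a" by transfer (rule eq, simp)
    show "- a + a = 0" by transfer (rule eq, simp)
    show "a - b = a + - b" by (rule minus_mod_translation_def)
    show "r *\<^sub>R (a + b) = r *\<^sub>R a + r *\<^sub>R b" by transfer (rule eq, simp add: distrib_left)
    show "(r + s) *\<^sub>R a = r *\<^sub>R a + s *\<^sub>R a" by transfer (rule eq, simp add: distrib_right)
    show "r *\<^sub>R s *\<^sub>R a = (r * s) *\<^sub>R a" by transfer (rule eq, simp add: mult.assoc)
    show "1 *\<^sub>R a = a" by transfer (rule eq, simp)
  qed
qed

end


subsection \<open>Virtual polytopes and the inscribed space\<close>

definition virtual_polytope :: "'a::euclidean_space set set \<Rightarrow> ('a \<Rightarrow> real) \<Rightarrow> bool" where
  "virtual_polytope A f \<longleftrightarrow>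
    continuous_on UNIV f \<and> (\<forall>R\<in>regions A. \<exists>v. \<forall>x\<in>R. f x = v \<bullet> x)"

definition region_vertex :: "('a::euclidean_space \<Rightarrow> real) \<Rightarrow> 'a set \<Rightarrow> 'a" where
  "region_vertex f R = (THE v. \<forall>x\<in>R. f x = v \<bullet> x)"

definition virtual_vertices :: "'a::euclidean_space set set \<Rightarrow> ('a \<Rightarrow> real) \<Rightarrow> 'a set" where
  "virtual_vertices A f = region_vertex f ` regions A"

definition on_common_sphere :: "'a::euclidean_space set \<Rightarrow> bool" where
  "on_common_sphere V \<longleftrightarrow> (\<exists>c r. V \<subseteq> sphere c r)"

definition circumcenter :: "'a::euclidean_space set \<Rightarrow> 'a" where
  "circumcenter V = (THE c. c \<in> affine hull V \<and> (\<exists>r. V \<subseteq> sphere c r))"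

definition inscribed_virtual :: "'a::euclidean_space set set \<Rightarrow> ('a \<Rightarrow> real) \<Rightarrow> bool" where
  "inscribed_virtual A f \<longleftrightarrow>
    virtual_polytope A f \<and>
    on_common_sphere (virtual_vertices A f) \<and>
    (\<forall>R\<in>regions A. \<forall>S\<in>regions A. dim (R \<inter> S) + 1 = DIM('a) \<longrightarrow>
      (\<forall>\<alpha>. \<alpha> \<noteq> 0 \<and> \<alpha> \<in> orthogonal_comp (span (R \<inter> S)) \<longrightarrow>
        \<alpha> \<bullet> ((1/2) *\<^sub>R (region_vertex f R + region_vertex f S)
             - circumcenter (virtual_vertices A f)) = 0))"

definition inscribed_space :: "'a::euclidean_space set set \<Rightarrow> 'a mod_translation set" where
  "inscribed_space A = fun_class ` {f. inscribed_virtual A f}"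

definition virtual_zonotope ::
  "('n::finite \<Rightarrow> 'a::euclidean_space) \<Rightarrow> real^'n \<Rightarrow> 'a \<Rightarrow> real" where
  "virtual_zonotope z l x = (\<Sum>i\<in>UNIV. l $ i * \<bar>z i \<bullet> x\<bar>)"

definition virtual_zonotope_space ::
  "('n::finite \<Rightarrow> 'a::euclidean_space) \<Rightarrow> 'a mod_translation set" where
  "virtual_zonotope_space z =
    inscribed_space (arrangement z) \<inter> range (\<lambda>l. fun_class (virtual_zonotope z l))"


subsection \<open>Inscribed zonotopes\<close>

text \<open>Sums of sets are Minkowski sums, from \<^theory>\<open>HOL-Library.Set_Algebras\<close>.\<close>

definition is_zonotope :: "'a::euclidean_space set \<Rightarrow> bool" where
  "is_zonotope P \<longleftrightarrow> (\<exists>(m::nat) a b. P = (\<Sum>j<m. closed_segment (a j) (b j)))"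

definition zonotope :: "('n::finite \<Rightarrow> 'a::euclidean_space) \<Rightarrow> real^'n \<Rightarrow> 'a set" where
  "zonotope z l = (\<Sum>i\<in>UNIV. (*\<^sub>R) (l $ i) ` closed_segment (- z i) (z i))"

definition normal_cone :: "'a::euclidean_space set \<Rightarrow> 'a set \<Rightarrow> 'a set" where
  "normal_cone P F = {c. \<forall>x\<in>F. \<forall>y\<in>P. c \<bullet> y \<le> c \<bullet> x}"

definition normal_fan :: "'a::euclidean_space set \<Rightarrow> 'a set set" where
  "normal_fan P = {normal_cone P F | F. F face_of P \<and> F \<noteq> {}}"

definition inscribed_polytope :: "'a::euclidean_space set \<Rightarrow> bool" where
  "inscribed_polytope P \<longleftrightarrow> on_common_sphere {v. v extreme_point_of P}"

definition translation_class :: "'a::euclidean_space set \<Rightarrow> 'a set set" where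
  "translation_class P = range (\<lambda>t. (+) t ` P)"

definition inscribed_zonotope_cone :: "'a::euclidean_space set set \<Rightarrow> 'a set set set" where
  "inscribed_zonotope_cone A =
    translation_class ` {P. is_zonotope P \<and> normal_fan P = arrangement_fan A \<and> inscribed_polytope P}"

text \<open>The Minkowski sum of two translation classes is their sum as sets of sets.\<close>

definition class_scale :: "real \<Rightarrow> 'a::euclidean_space set set \<Rightarrow> 'a set set" where
  "class_scale c X = (\<lambda>P. (*\<^sub>R) c ` P) ` X"


subsection \<open>Isomorphisms\<close>

definition vector_space_iso ::
  "('a::real_vector \<Rightarrow> 'b::real_vector) \<Rightarrow> 'a set \<Rightarrow> 'b set \<Rightarrow> bool" where
  "vector_space_iso \<phi> U W \<longleftrightarrow> subspace U \<and> subspace W \<and> linear \<phi> \<and> bij_betw \<phi> U W"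

text \<open>Cones need not contain 0: they are closed under addition and multiplication by positive
  scalars. The target carries Minkowski addition and dilation of translation classes.\<close>

definition cone_iso ::
  "('a::real_vector \<Rightarrow> 'b::euclidean_space set set) \<Rightarrow> 'a set \<Rightarrow> 'b set set set \<Rightarrow> bool" where
  "cone_iso \<phi> K M \<longleftrightarrow>
    (\<forall>x\<in>K. \<forall>y\<in>K. x + y \<in> K) \<and> (\<forall>c>0. \<forall>x\<in>K. c *\<^sub>R x \<in> K) \<and>
    (\<forall>X\<in>M. \<forall>Y\<in>M. X + Y \<in> M) \<and> (\<forall>c>0. \<forall>X\<in>M. class_scale c X \<in> M) \<and>
    bij_betw \<phi> K M \<and>
    (\<forall>x\<in>K. \<forall>y\<in>K. \<phi> (x + y) = \<phi> x + \<phi> y) \<and>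
    (\<forall>c>0. \<forall>x\<in>K. \<phi> (c *\<^sub>R x) = class_scale c (\<phi> x))"

end

theory Submission
  imports Defs
begin

text \<open>
  The vertex of \<open>Z\<^sub>\<lambda>\<close> belonging to the region of a generic point \<open>p\<close> is the signed sum
  \<open>v p = (\<Sum>i. \<lambda>\<^sub>i sgn (z\<^sub>i \<bullet> p) z\<^sub>i)\<close>. The vertex set is symmetric, so a circumscribed sphere can be
  centred at 0, and for two regions separated only by the wall of \<open>z\<^sub>i\<close> the vertices differ by a multiple
  of \<open>z\<^sub>i\<close> and have midpoint \<open>v x\<close>, for \<open>x\<close> in the relative interior of the wall. Hence \<open>Z\<^sub>\<lambda>\<close> is
  inscribed in the virtual sense iff \<open>z\<^sub>i \<bullet> v x = 0\<close> for every such \<open>i\<close> and \<open>x\<close>; if all \<open>\<lambda>\<^sub>i\<close> are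
  positive this is equality of the norms of all vertices. Grouping the terms of \<open>z\<^sub>i \<bullet> v x\<close> by the flats
  \<open>L = H\<^sub>i \<inter> H\<^sub>j\<close> turns each group into an entry of \<open>R\<^sub>L \<lambda>\<^sub>L\<close> up to sign. So the flat equations imply the
  balance condition, and comparing it at two points of \<open>H\<^sub>i\<close> on opposite sides of \<open>L\<close> gives the
  converse.
\<close>

section \<open>Generic points and sign cones\<close>

text \<open>The balance condition has no factor \<open>l i\<close>, whereas the difference of
  squared norms across the wall of \<open>z i\<close> has one. For positive coefficients it cancels.
  For a virtual zonotope with \<open>l i = 0\<close> the two vertices coincide and the sphere says
  nothing at this wall; there the midpoint condition of the inscribed space supplies the equation.
  The way back, from local balance to one sphere for all vertices, is global: any two regions have
  to be linked by crossing one wall at a time. The open halfspace serves the cyclic orders. It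
  confines the vectors orthogonal to a flat to an open half turn, so that they and their negatives
  can be listed within one turn. As \<open>flat_equation\<close> quantifies over all admissible
  orderings, it would be vacuous at a flat that has none, so their existence must be proved. In the
  cone statement the zonotopes are sums of arbitrary segments, and the generators have to be
  recovered from the normal fan alone. Injectivity of both maps rests on one contrast:
  \<open>virtual_zonotope z l\<close> is even, while translations add odd functions.\<close>

lemma eventually_sgn_inner_add:
  fixes a x y :: "'a::real_inner"
  assumes "a \<bullet> x \<noteq> 0"
  shows "eventually (\<lambda>t. sgn (a \<bullet> (x + t *\<^sub>R y)) = sgn (a \<bullet> x)) (nhds 0)"
proof -
  have lim: "((\<lambda>t::real. a \<bullet> (x + t *\<^sub>R y)) \<longlongrightarrow> a \<bullet> x) (nhds 0)"
    by (auto intro!: tendsto_eq_intros filterlim_ident)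
  show ?thesis
  proof (cases "a \<bullet> x > 0")
    case True
    then show ?thesis
      using order_tendstoD(1)[OF lim, of 0] by (auto elim!: eventually_mono)
  next
    case False
    with assms have "a \<bullet> x < 0" by simp
    then show ?thesis
      using order_tendstoD(2)[OF lim, of 0] by (auto elim!: eventually_mono)
  qed
qed

text \<open>One \<open>e\<close> serves all finitely many vectors; later perturbation arguments take
  their step length from here. Vectors orthogonal to \<open>x\<close> are exempt, since any step may
  change their sign.\<close>

lemma sgn_inner_perturb:
  fixes u :: "'i \<Rightarrow> 'a::real_inner"
  assumes "finite I"
  obtains e :: real where "e > 0"
    "\<And>i t. i \<in> I \<Longrightarrow> u i \<bullet> x \<noteq> 0 \<Longrightarrow> \<bar>t\<bar> \<le> e \<Longrightarrow> sgn (u i \<bullet> (x + t *\<^sub>R y)) = sgn (u i \<bullet> x)"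
proof -
  have "eventually (\<lambda>t::real. \<forall>i\<in>{i\<in>I. u i \<bullet> x \<noteq> 0}.
      sgn (u i \<bullet> (x + t *\<^sub>R y)) = sgn (u i \<bullet> x)) (nhds 0)"
    using assms by (intro eventually_ball_finite) (auto intro: eventually_sgn_inner_add)
  then obtain d where "d > 0" and
    d: "\<And>t. dist t 0 < d \<Longrightarrow> \<forall>i\<in>{i\<in>I. u i \<bullet> x \<noteq> 0}. sgn (u i \<bullet> (x + t *\<^sub>R y)) = sgn (u i \<bullet> x)"
    unfolding eventually_nhds_metric by blast
  show thesis
    using \<open>d > 0\<close> d by (intro that[of "d/2"]) (auto simp: dist_real_def)
qed

lemma sgn_inner_perturb_UNIV:
  fixes u :: "'i::finite \<Rightarrow> 'a::real_inner"
  obtains e :: real where "e > 0"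
    "\<And>i t. u i \<bullet> x \<noteq> 0 \<Longrightarrow> \<bar>t\<bar> \<le> e \<Longrightarrow> sgn (u i \<bullet> (x + t *\<^sub>R y)) = sgn (u i \<bullet> x)"
  using sgn_inner_perturb[where I=UNIV and u=u and x=x and y=y] by auto

text \<open>A real subspace is not covered by finitely many proper subspaces. In the induction step
  a move along \<open>y\<close> leaves the hyperplane of \<open>u k\<close>, and if it is short no
  sign already achieved is lost.\<close>

lemma exists_generic_in_subspace:
  fixes u :: "'i \<Rightarrow> 'a::real_inner"
  assumes "finite I" "subspace S" "\<And>i. i \<in> I \<Longrightarrow> \<exists>y\<in>S. u i \<bullet> y \<noteq> 0"
  shows "\<exists>x\<in>S. \<forall>i\<in>I. u i \<bullet> x \<noteq> 0"
  using assms(1,3)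
proof (induction I)
  case empty
  then show ?case using subspace_0[OF assms(2)] by auto
next
  case (insert k I)
  then obtain x where x: "x \<in> S" "\<forall>i\<in>I. u i \<bullet> x \<noteq> 0" by auto
  from insert obtain y where y: "y \<in> S" "u k \<bullet> y \<noteq> 0" by auto
  show ?case
  proof (cases "u k \<bullet> x = 0")
    case True
    obtain e where e: "e > 0" "\<And>i t. i \<in> I \<Longrightarrow> u i \<bullet> x \<noteq> 0 \<Longrightarrow> \<bar>t\<bar> \<le> e \<Longrightarrow>
        sgn (u i \<bullet> (x + t *\<^sub>R y)) = sgn (u i \<bullet> x)"
      using sgn_inner_perturb[OF insert.hyps(1)] by blast
    have "u i \<bullet> (x + e *\<^sub>R y) \<noteq> 0" if "i \<in> I" for i
    proof -
      have "sgn (u i \<bullet> (x + e *\<^sub>R y)) = sgn (u i \<bullet> x)" using e that x by auto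
      then show ?thesis using x that by (metis sgn_zero_iff)
    qed
    moreover have "u k \<bullet> (x + e *\<^sub>R y) \<noteq> 0"
      using True y e by (simp add: inner_add_right)
    moreover have "x + e *\<^sub>R y \<in> S"
      using x y assms(2) by (simp add: subspace_add subspace_scale)
    ultimately show ?thesis by blast
  qed (use x in auto)
qed

text \<open>Zero vectors are exempt because the notion is also applied to the generators of an
  arbitrary zonotope, some of which may vanish.\<close>

definition generic :: "('i \<Rightarrow> 'a::real_inner) \<Rightarrow> 'i set \<Rightarrow> 'a \<Rightarrow> bool" where
  "generic u I p \<longleftrightarrow> (\<forall>i\<in>I. u i \<noteq> 0 \<longrightarrow> u i \<bullet> p \<noteq> 0)"

text \<open>This selects a region whose closure contains \<open>a\<close>: a small generic
  displacement resolves the signs that vanish at \<open>a\<close>.\<close>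

lemma exists_generic_refining:
  fixes u :: "'i \<Rightarrow> 'a::real_inner"
  assumes "finite I"
  obtains p where "generic u I p" "\<And>i. i \<in> I \<Longrightarrow> u i \<bullet> a \<noteq> 0 \<Longrightarrow> sgn (u i \<bullet> p) = sgn (u i \<bullet> a)"
proof -
  have "\<exists>x\<in>UNIV. \<forall>i\<in>{i\<in>I. u i \<noteq> 0}. u i \<bullet> x \<noteq> 0"
  proof (rule exists_generic_in_subspace)
    fix i assume "i \<in> {i\<in>I. u i \<noteq> 0}"
    then show "\<exists>y\<in>UNIV. u i \<bullet> y \<noteq> 0" by (intro bexI[of _ "u i"]) auto
  qed (use assms in auto)
  then obtain x where x: "\<And>i. i \<in> I \<Longrightarrow> u i \<noteq> 0 \<Longrightarrow> u i \<bullet> x \<noteq> 0" by auto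
  obtain e where e: "e > 0" "\<And>i t. i \<in> I \<Longrightarrow> u i \<bullet> a \<noteq> 0 \<Longrightarrow> \<bar>t\<bar> \<le> e \<Longrightarrow>
      sgn (u i \<bullet> (a + t *\<^sub>R x)) = sgn (u i \<bullet> a)"
    using sgn_inner_perturb[OF assms] by blast
  have s: "sgn (u i \<bullet> (a + e *\<^sub>R x)) = sgn (u i \<bullet> a)" if "i \<in> I" "u i \<bullet> a \<noteq> 0" for i
    using e that by auto
  show thesis
  proof (rule that)
    show "generic u I (a + e *\<^sub>R x)"
      unfolding generic_def
    proof (intro ballI impI)
      fix i assume i: "i \<in> I" "u i \<noteq> 0"
      show "u i \<bullet> (a + e *\<^sub>R x) \<noteq> 0"
      proof (cases "u i \<bullet> a = 0")
        case True
        then show ?thesis using e(1) x[OF i] by (simp add: inner_add_right)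
      next
        case False
        then show ?thesis using s[OF i(1)] by (metis sgn_zero_iff)
      qed
    qed
  qed (use s in auto)
qed

text \<open>The face of the central arrangement with \<open>a\<close> in its relative interior, as a
  closed cone. The index set is explicit because fans of differently indexed families are compared
  later.\<close>

definition sign_cone :: "('i \<Rightarrow> 'a::real_inner) \<Rightarrow> 'i set \<Rightarrow> 'a \<Rightarrow> 'a set" where
  "sign_cone u I a = {c. \<forall>i\<in>I. (u i \<bullet> a = 0 \<longrightarrow> u i \<bullet> c = 0) \<and>
     (u i \<bullet> a > 0 \<longrightarrow> u i \<bullet> c \<ge> 0) \<and> (u i \<bullet> a < 0 \<longrightarrow> u i \<bullet> c \<le> 0)}"

lemma sign_coneD:
  assumes "c \<in> sign_cone u I a" "i \<in> I"
  shows "u i \<bullet> a = 0 \<Longrightarrow> u i \<bullet> c = 0" "u i \<bullet> a > 0 \<Longrightarrow> u i \<bullet> c \<ge> 0" "u i \<bullet> a < 0 \<Longrightarrow> u i \<bullet> c \<le> 0"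
  using assms by (auto simp: sign_cone_def)

lemma sign_coneI:
  assumes "\<And>i. i \<in> I \<Longrightarrow> u i \<bullet> a = 0 \<Longrightarrow> u i \<bullet> c = 0"
    "\<And>i. i \<in> I \<Longrightarrow> u i \<bullet> a > 0 \<Longrightarrow> u i \<bullet> c \<ge> 0" "\<And>i. i \<in> I \<Longrightarrow> u i \<bullet> a < 0 \<Longrightarrow> u i \<bullet> c \<le> 0"
  shows "c \<in> sign_cone u I a"
  using assms by (auto simp: sign_cone_def)

text \<open>The form suited to support functions: each signed term reaches the corresponding
  absolute value, so on the cone a sum of absolute values becomes linear.\<close>

lemma in_sign_cone_iff_abs:
  "c \<in> sign_cone u I a \<longleftrightarrow> (\<forall>i\<in>I. sgn (u i \<bullet> a) * (u i \<bullet> c) = \<bar>u i \<bullet> c\<bar>)"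
proof -
  have "sgn r * s = \<bar>s\<bar> \<longleftrightarrow> (r = 0 \<longrightarrow> s = 0) \<and> (r > 0 \<longrightarrow> s \<ge> 0) \<and> (r < 0 \<longrightarrow> s \<le> 0)" for r s :: real
    by (cases "r > 0"; cases "r = 0") auto
  then show ?thesis by (simp add: sign_cone_def)
qed

lemma self_in_sign_cone: "a \<in> sign_cone u I a"
  by (simp add: sign_cone_def)

lemma sign_cone_mono:
  assumes "a \<in> sign_cone u I b"
  shows "sign_cone u I a \<subseteq> sign_cone u I b"
proof
  fix c assume c: "c \<in> sign_cone u I a"
  show "c \<in> sign_cone u I b"
  proof (rule sign_coneI)
    fix i assume i: "i \<in> I"
    note h = sign_coneD[OF c i] sign_coneD[OF assms i]
    show "u i \<bullet> b = 0 \<Longrightarrow> u i \<bullet> c = 0" "u i \<bullet> b > 0 \<Longrightarrow> u i \<bullet> c \<ge> 0" "u i \<bullet> b < 0 \<Longrightarrow> u i \<bullet> c \<le> 0"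
      using h by linarith+
  qed
qed

lemma sign_cone_cong:
  assumes "\<And>i. i \<in> I \<Longrightarrow> sgn (u i \<bullet> a) = sgn (u i \<bullet> b)"
  shows "sign_cone u I a = sign_cone u I b"
  using assms by (simp add: in_sign_cone_iff_abs set_eq_iff)

lemma convex_sign_cone: "convex (sign_cone u I a)"
proof (rule convexI)
  fix x y and s t :: real
  assume xy: "x \<in> sign_cone u I a" "y \<in> sign_cone u I a" and st: "s \<ge> 0" "t \<ge> 0" "s + t = 1"
  show "s *\<^sub>R x + t *\<^sub>R y \<in> sign_cone u I a"
  proof (rule sign_coneI)
    fix i assume i: "i \<in> I"
    note h = sign_coneD[OF xy(1) i] sign_coneD[OF xy(2) i]
    show "u i \<bullet> (s *\<^sub>R x + t *\<^sub>R y) = 0" if "u i \<bullet> a = 0"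
      using h that by (simp add: inner_add_right)
    show "u i \<bullet> (s *\<^sub>R x + t *\<^sub>R y) \<ge> 0" if "u i \<bullet> a > 0"
      using h that st by (simp add: inner_add_right)
    show "u i \<bullet> (s *\<^sub>R x + t *\<^sub>R y) \<le> 0" if "u i \<bullet> a < 0"
      using h that st by (simp add: inner_add_right add_nonpos_nonpos mult_nonneg_nonpos)
  qed
qed

text \<open>Each functional has a constant sign on the cone of \<open>p\<close>, so if it vanishes
  inside a segment of this cone, it vanishes at both ends.\<close>

lemma sign_cone_face:
  assumes "a \<in> sign_cone u I p"
  shows "sign_cone u I a face_of sign_cone u I p"
  unfolding face_of_def
proof (intro conjI ballI impI)
  show "sign_cone u I a \<subseteq> sign_cone u I p" using assms by (rule sign_cone_mono)
  show "convex (sign_cone u I a)" by (rule convex_sign_cone)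
  fix x y w
  assume x: "x \<in> sign_cone u I p" and y: "y \<in> sign_cone u I p"
    and w: "w \<in> sign_cone u I a" and seg: "w \<in> open_segment x y"
  obtain s where s: "0 < s" "s < 1" "w = (1 - s) *\<^sub>R x + s *\<^sub>R y"
    using seg by (auto simp: in_segment)
  have pos: "r = 0 \<and> t = 0" if "0 = (1 - s) * r + s * t" "r \<ge> 0" "t \<ge> 0" for r t :: real
  proof -
    have "(1 - s) * r \<ge> 0" "s * t \<ge> 0" using that s by auto
    then have "(1 - s) * r = 0" "s * t = 0" using that(1) by linarith+
    then show ?thesis using s by auto
  qed
  have zero: "u i \<bullet> x = 0 \<and> u i \<bullet> y = 0" if i: "i \<in> I" and a: "u i \<bullet> a = 0" for i
  proof -
    note h = sign_coneD[OF x i] sign_coneD[OF y i]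
    have w0: "0 = (1 - s) * (u i \<bullet> x) + s * (u i \<bullet> y)"
      using sign_coneD(1)[OF w i a] unfolding s(3) by (simp add: inner_add_right)
    have w1: "0 = (1 - s) * (- (u i \<bullet> x)) + s * (- (u i \<bullet> y))" using w0 by simp
    consider "u i \<bullet> p = 0" | "u i \<bullet> p > 0" | "u i \<bullet> p < 0" by linarith
    then show ?thesis
    proof cases
      case 1 then show ?thesis using h by simp
    next
      case 2 then show ?thesis using h pos[OF w0] by simp
    next
      case 3 then show ?thesis using h pos[OF w1] by simp
    qed
  qed
  have step: "v \<in> sign_cone u I a" if v: "v \<in> sign_cone u I p" "\<And>i. i \<in> I \<Longrightarrow> u i \<bullet> a = 0 \<Longrightarrow> u i \<bullet> v = 0" for v
  proof (rule sign_coneI)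
    fix i assume i: "i \<in> I"
    note h = sign_coneD[OF v(1) i] sign_coneD[OF assms i] v(2)[OF i]
    show "u i \<bullet> a = 0 \<Longrightarrow> u i \<bullet> v = 0" "u i \<bullet> a > 0 \<Longrightarrow> u i \<bullet> v \<ge> 0" "u i \<bullet> a < 0 \<Longrightarrow> u i \<bullet> v \<le> 0"
      using h by linarith+
  qed
  show "x \<in> sign_cone u I a" "y \<in> sign_cone u I a"
    using step x y zero by blast+
qed

text \<open>\<open>a\<close> is relatively interior: functionals vanishing at \<open>a\<close> also
  vanish at \<open>c\<close>, and the others keep their sign for a short step beyond
  \<open>a\<close>.\<close>

lemma sign_cone_prolong:
  assumes I: "finite I" and c: "c \<in> sign_cone u I a"
  obtains e :: real where "e > 0" "a + e *\<^sub>R (a - c) \<in> sign_cone u I a"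
proof -
  obtain e where e: "e > 0" "\<And>i t. i \<in> I \<Longrightarrow> u i \<bullet> a \<noteq> 0 \<Longrightarrow> \<bar>t\<bar> \<le> e \<Longrightarrow>
      sgn (u i \<bullet> (a + t *\<^sub>R (a - c))) = sgn (u i \<bullet> a)"
    using sgn_inner_perturb[OF I] by blast
  define b where "b = a + e *\<^sub>R (a - c)"
  have "b \<in> sign_cone u I a"
  proof (rule sign_coneI)
    fix i assume i: "i \<in> I"
    have s: "sgn (u i \<bullet> b) = sgn (u i \<bullet> a)" if "u i \<bullet> a \<noteq> 0"
      using e(2)[OF i that, of e] e(1) by (simp add: b_def)
    show "u i \<bullet> b = 0" if "u i \<bullet> a = 0"
      using sign_coneD(1)[OF c i that] that by (simp add: b_def inner_add_right inner_diff_right)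
    show "u i \<bullet> a > 0 \<Longrightarrow> u i \<bullet> b \<ge> 0" "u i \<bullet> a < 0 \<Longrightarrow> u i \<bullet> b \<le> 0"
      using s by (auto simp: sgn_real_def split: if_splits)
  qed
  then show thesis using that e(1) by (simp add: b_def)
qed

text \<open>\<open>a\<close> is any relative interior point of \<open>C\<close>. One inclusion
  prolongs a segment of \<open>C\<close> beyond \<open>a\<close>; the other prolongs a segment of
  the sign cone beyond \<open>a\<close> and applies the face property there.\<close>

lemma face_of_sign_cone:
  fixes u :: "'i \<Rightarrow> 'a::euclidean_space"
  assumes I: "finite I" and C: "C face_of sign_cone u I p" "C \<noteq> {}"
  obtains a where "a \<in> sign_cone u I p" "C = sign_cone u I a"
proof -
  have "convex C" using C(1) by (rule face_of_imp_convex)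
  then obtain a where a: "a \<in> rel_interior C" using C(2) rel_interior_eq_empty by blast
  then have aC: "a \<in> C" using rel_interior_subset by blast
  have sub: "C \<subseteq> sign_cone u I p" using C(1) by (rule face_of_imp_subset)
  have "C = sign_cone u I a"
  proof (intro equalityI subsetI)
    fix c assume c: "c \<in> C"
    obtain e where e: "e > 1" "(1 - e) *\<^sub>R c + e *\<^sub>R a \<in> C"
      using bspec[OF convex_rel_interior_if2[OF \<open>convex C\<close> a] hull_inc[OF c]] by blast
    show "c \<in> sign_cone u I a"
    proof (rule sign_coneI)
      fix i assume i: "i \<in> I"
      have cp: "c \<in> sign_cone u I p" "a \<in> sign_cone u I p" "(1 - e) *\<^sub>R c + e *\<^sub>R a \<in> sign_cone u I p"
        using c aC e sub by auto
      note h = sign_coneD[OF cp(1) i] sign_coneD[OF cp(2) i]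
      show "u i \<bullet> c = 0" if a0: "u i \<bullet> a = 0"
      proof -
        have "(1 - e) * (u i \<bullet> c) = u i \<bullet> ((1 - e) *\<^sub>R c + e *\<^sub>R a)"
          using a0 by (simp add: inner_add_right)
        moreover have "1 - e < 0" using e(1) by simp
        \<comment> \<open>Since \<open>1 - e\<close> is negative, nonzero values at \<open>c\<close>
          and at the prolonged point have opposite signs, but both points lie in the cone of
          \<open>p\<close>, where only one sign occurs.\<close>
        ultimately have "u i \<bullet> c = 0 \<or> (u i \<bullet> c) * (u i \<bullet> ((1 - e) *\<^sub>R c + e *\<^sub>R a)) < 0"
          by (metis mult_eq_0_iff mult.left_commute mult_neg_pos not_square_less_zero linorder_neqE_linordered_idom)
        then show ?thesis
          using h sign_coneD[OF cp(3) i]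
          by (cases "u i \<bullet> p" "0::real" rule: linorder_cases) (auto simp: mult_less_0_iff)
      qed
      show "u i \<bullet> a > 0 \<Longrightarrow> u i \<bullet> c \<ge> 0" "u i \<bullet> a < 0 \<Longrightarrow> u i \<bullet> c \<le> 0"
        using h by linarith+
    qed
  next
    fix c assume c: "c \<in> sign_cone u I a"
    show "c \<in> C"
    proof (cases "c = a")
      case False
      obtain e where e: "e > 0" "a + e *\<^sub>R (a - c) \<in> sign_cone u I a"
        using sign_cone_prolong[OF I c] .
      define b where "b = a + e *\<^sub>R (a - c)"
      have "b \<in> sign_cone u I a" using e(2) by (simp add: b_def)
      then have "b \<in> sign_cone u I p" "c \<in> sign_cone u I p"
        using c sign_cone_mono[of a u I p] aC sub by auto
      moreover have "a \<in> open_segment b c"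
        unfolding in_segment
      \<comment> \<open>Solving \<open>b = a + e *\<^sub>R (a - c)\<close> for \<open>a\<close>
        gives the weights \<open>1 / (1 + e)\<close> and \<open>e / (1 + e)\<close>.\<close>
      proof (intro conjI exI[of _ "e / (1 + e)"])
        show "b \<noteq> c"
        proof
          assume "b = c"
          then have "(1 + e) *\<^sub>R (a - c) = 0" by (simp add: b_def algebra_simps)
          then show False using False e(1) by auto
        qed
        have "(1 + e) *\<^sub>R a = b + e *\<^sub>R c" by (simp add: b_def algebra_simps)
        then have "(1 / (1 + e)) *\<^sub>R ((1 + e) *\<^sub>R a) = (1 / (1 + e)) *\<^sub>R (b + e *\<^sub>R c)" by simp
        then have "a = (1 / (1 + e)) *\<^sub>R (b + e *\<^sub>R c)" using e(1) by simp
        moreover have "1 - e / (1 + e) = 1 / (1 + e)" using e(1) by (simp add: field_simps)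
        ultimately show "a = (1 - e / (1 + e)) *\<^sub>R b + (e / (1 + e)) *\<^sub>R c"
          by (simp add: scaleR_add_right)
      qed (use e in auto)
      ultimately show ?thesis using face_ofD[OF C(1) _ _ _ aC] by blast
    qed (use aC in simp)
  qed
  then show thesis using that aC sub by blast
qed

section \<open>Regions and fan of an arrangement\<close>

lemma not_in_Union_arrangement: "- \<Union>(arrangement z) = {x. \<forall>i. z i \<bullet> x \<noteq> 0}"
  by (auto simp: arrangement_def hyperplane_def)

lemma closed_sign_cone: "closed (sign_cone u I a)"
proof -
  have "sign_cone u I a = (\<Inter>i\<in>I. {c. sgn (u i \<bullet> a) * (u i \<bullet> c) = \<bar>u i \<bullet> c\<bar>})"
    by (auto simp: in_sign_cone_iff_abs)
  also have "closed \<dots>"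
    by (intro closed_INT ballI closed_Collect_eq continuous_intros)
  finally show ?thesis .
qed

text \<open>A strict sign class is convex, hence connected; a connected set that avoids a hyperplane
  stays on one side of it, so the component is no larger.\<close>

lemma connected_component_arrangement:
  fixes z :: "'n::finite \<Rightarrow> 'a::euclidean_space"
  assumes p: "\<forall>i. z i \<bullet> p \<noteq> 0"
  shows "connected_component_set {x. \<forall>i. z i \<bullet> x \<noteq> 0} p = {x. \<forall>i. sgn (z i \<bullet> x) = sgn (z i \<bullet> p)}"
    (is "connected_component_set ?S p = ?O")
proof
  have "convex ?O"
  proof (rule convexI)
    fix x y and s t :: real
    assume xy: "x \<in> ?O" "y \<in> ?O" and st: "s \<ge> 0" "t \<ge> 0" "s + t = 1"
    show "s *\<^sub>R x + t *\<^sub>R y \<in> ?O"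
    proof (intro CollectI allI)
      fix i
      have h: "sgn (z i \<bullet> x) = sgn (z i \<bullet> p)" "sgn (z i \<bullet> y) = sgn (z i \<bullet> p)" using xy by auto
      have pos: "s * r + t * r' > 0" if "r > 0" "r' > 0" for r r' :: real
      proof (cases "s = 0")
        case False
        then have "s * r > 0" "t * r' \<ge> 0" using st that by auto
        then show ?thesis by linarith
      qed (use st that in auto)
      show "sgn (z i \<bullet> (s *\<^sub>R x + t *\<^sub>R y)) = sgn (z i \<bullet> p)"
      proof (cases "z i \<bullet> p > 0")
        case True
        then have "z i \<bullet> x > 0" "z i \<bullet> y > 0" using h by (metis sgn_greater)+
        then have "s * (z i \<bullet> x) + t * (z i \<bullet> y) > 0" using pos by blast
        then show ?thesis using True by (simp add: inner_add_right)
      next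
        case False
        then have n: "z i \<bullet> p < 0" using p by (simp add: less_le)
        then have "z i \<bullet> x < 0" "z i \<bullet> y < 0" using h by (metis sgn_less)+
        then have "s * (- (z i \<bullet> x)) + t * (- (z i \<bullet> y)) > 0" by (intro pos) auto
        then show ?thesis using n by (simp add: inner_add_right)
      qed
    qed
  qed
  then have "connected ?O" by (rule convex_connected)
  moreover have "?O \<subseteq> ?S" 
  proof (intro subsetI CollectI allI)
    fix x i assume "x \<in> ?O"
    then have "sgn (z i \<bullet> x) = sgn (z i \<bullet> p)" by simp
    then show "z i \<bullet> x \<noteq> 0" using p by (metis sgn_zero_iff)
  qed
  ultimately show "?O \<subseteq> connected_component_set ?S p"
    by (intro connected_component_maximal) auto
  show "connected_component_set ?S p \<subseteq> ?O"
  proof (intro subsetI CollectI allI)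
    fix x i assume x: "x \<in> connected_component_set ?S p"
    have pc: "p \<in> connected_component_set ?S p" using p by (simp add: connected_component_refl_eq)
    have sub: "connected_component_set ?S p \<subseteq> ?S" by (rule connected_component_subset)
    have no: "\<not> (\<exists>y\<in>connected_component_set ?S p. z i \<bullet> y = 0)" using sub by auto
    have ivt: "\<not> (z i \<bullet> a \<le> 0 \<and> 0 \<le> z i \<bullet> b)"
      if "a \<in> connected_component_set ?S p" "b \<in> connected_component_set ?S p" for a b
      using connected_ivt_hyperplane[OF connected_connected_component that, of "z i" 0] no by blast
    show "sgn (z i \<bullet> x) = sgn (z i \<bullet> p)"
      using ivt[OF x pc] ivt[OF pc x] by (auto simp: sgn_real_def)
  qed
qed

text \<open>For \<open>t > 0\<close> the point \<open>c + t *\<^sub>R p\<close> has the strict signs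
  of \<open>p\<close>, and it tends to \<open>c\<close>.\<close>

lemma closure_sign_class:
  fixes z :: "'n::finite \<Rightarrow> 'a::euclidean_space"
  assumes p: "\<forall>i. z i \<bullet> p \<noteq> 0"
  shows "closure {x. \<forall>i. sgn (z i \<bullet> x) = sgn (z i \<bullet> p)} = sign_cone z UNIV p" (is "closure ?O = _")
proof
  have "?O \<subseteq> sign_cone z UNIV p"
  proof
    fix x assume "x \<in> ?O"
    then have "sign_cone z UNIV x = sign_cone z UNIV p" by (intro sign_cone_cong) auto
    then show "x \<in> sign_cone z UNIV p" using self_in_sign_cone by blast
  qed
  then show "closure ?O \<subseteq> sign_cone z UNIV p"
    by (intro closure_minimal closed_sign_cone)
  show "sign_cone z UNIV p \<subseteq> closure ?O"
  proof
    fix c assume c: "c \<in> sign_cone z UNIV p"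
    have "c + t *\<^sub>R p \<in> ?O" if "t > 0" for t :: real
    proof (intro CollectI allI)
      fix i
      show "sgn (z i \<bullet> (c + t *\<^sub>R p)) = sgn (z i \<bullet> p)"
      proof (cases "z i \<bullet> p > 0")
        case True
        then have "z i \<bullet> c + t * (z i \<bullet> p) > 0"
          using sign_coneD(2)[OF c UNIV_I] that by (simp add: add_nonneg_pos)
        then show ?thesis using True by (simp add: inner_add_right)
      next
        case False
        then have n: "z i \<bullet> p < 0" using p by (simp add: less_le)
        then have "z i \<bullet> c + t * (z i \<bullet> p) < 0"
          using sign_coneD(3)[OF c UNIV_I] that by (simp add: add_nonpos_neg mult_pos_neg)
        then show ?thesis using n by (simp add: inner_add_right)
      qed
    qed
    then have "eventually (\<lambda>t::real. c + t *\<^sub>R p \<in> closure ?O) (at_right 0)"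
      by (intro eventually_at_right_less[THEN eventually_mono]) (use closure_subset in blast)
    moreover have "((\<lambda>t::real. c + t *\<^sub>R p) \<longlongrightarrow> c) (at_right 0)"
      by (auto intro!: tendsto_eq_intros)
    ultimately show "c \<in> closure ?O"
      by (intro Lim_in_closed_set[OF closed_closure]) auto
  qed
qed

lemma regions_arrangement:
  fixes z :: "'n::finite \<Rightarrow> 'a::euclidean_space"
  assumes nz: "\<And>i. z i \<noteq> 0"
  shows "regions (arrangement z) = sign_cone z UNIV ` {p. generic z UNIV p}"
proof -
  have g: "generic z UNIV p \<longleftrightarrow> (\<forall>i. z i \<bullet> p \<noteq> 0)" for p
    using nz by (simp add: generic_def)
  have "regions (arrangement z) =
      (\<lambda>p. closure (connected_component_set {x. \<forall>i. z i \<bullet> x \<noteq> 0} p)) ` {p. \<forall>i. z i \<bullet> p \<noteq> 0}"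
    by (simp add: regions_def components_def not_in_Union_arrangement image_image)
  also have "\<dots> = sign_cone z UNIV ` {p. \<forall>i. z i \<bullet> p \<noteq> 0}"
    by (intro image_cong refl) (simp add: connected_component_arrangement closure_sign_class)
  finally show ?thesis by (simp add: g)
qed

lemma arrangement_fan_eq:
  fixes z :: "'n::finite \<Rightarrow> 'a::euclidean_space"
  assumes nz: "\<And>i. z i \<noteq> 0"
  shows "arrangement_fan (arrangement z) = range (sign_cone z UNIV)"
proof (intro equalityI subsetI)
  fix C assume "C \<in> arrangement_fan (arrangement z)"
  then obtain p where "C \<noteq> {}" "C face_of sign_cone z UNIV p"
    by (auto simp: arrangement_fan_def regions_arrangement[OF nz])
  then show "C \<in> range (sign_cone z UNIV)"
    using face_of_sign_cone[of UNIV C z p] by auto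
next
  fix C assume "C \<in> range (sign_cone z UNIV)"
  then obtain a where C: "C = sign_cone z UNIV a" by auto
  obtain p where p: "generic z UNIV p" "\<And>i. z i \<bullet> a \<noteq> 0 \<Longrightarrow> sgn (z i \<bullet> p) = sgn (z i \<bullet> a)"
    using exists_generic_refining[of UNIV z a] by auto
  have "a \<in> sign_cone z UNIV p"
    unfolding in_sign_cone_iff_abs proof
    fix i show "sgn (z i \<bullet> p) * (z i \<bullet> a) = \<bar>z i \<bullet> a\<bar>"
      using p(2)[of i] by (cases "z i \<bullet> a = 0") (simp_all add: abs_sgn mult.commute)
  qed
  then have "C face_of sign_cone z UNIV p" unfolding C by (rule sign_cone_face)
  moreover have "C \<noteq> {}" using self_in_sign_cone C by blast
  ultimately show "C \<in> arrangement_fan (arrangement z)"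
    using p(1) by (auto simp: arrangement_fan_def regions_arrangement[OF nz])
qed

section \<open>Faces of zonotopes\<close>

text \<open>Since \<open>sgn 0 = 0\<close>, for nonnegative coefficients and arbitrary
  \<open>x\<close> this is the centre of the face on which \<open>x\<close> is maximal, and a vertex
  when \<open>x\<close> is generic.\<close>

definition signed_sum :: "('i \<Rightarrow> 'a::real_inner) \<Rightarrow> 'i set \<Rightarrow> ('i \<Rightarrow> real) \<Rightarrow> 'a \<Rightarrow> 'a" where
  "signed_sum z I l x = (\<Sum>i\<in>I. (l i * sgn (z i \<bullet> x)) *\<^sub>R z i)"

lemma inner_signed_sum: "a \<bullet> signed_sum z I l x = (\<Sum>i\<in>I. l i * (sgn (z i \<bullet> x) * (z i \<bullet> a)))"
  by (simp add: signed_sum_def inner_sum_right inner_commute mult.assoc)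

lemma inner_signed_sum_self: "x \<bullet> signed_sum z I l x = (\<Sum>i\<in>I. l i * \<bar>z i \<bullet> x\<bar>)"
  by (simp add: inner_signed_sum sgn_mult_self_eq abs_sgn mult.commute)

lemma signed_sum_uminus: "signed_sum z I l (- x) = - signed_sum z I l x"
  by (simp add: signed_sum_def sgn_minus sum_negf)

lemma signed_sum_cong:
  assumes "\<And>i. i \<in> I \<Longrightarrow> sgn (z i \<bullet> x) = sgn (z i \<bullet> y)"
  shows "signed_sum z I l x = signed_sum z I l y"
  using assms by (simp add: signed_sum_def)

lemma inner_signed_sum_sign_cone:
  assumes "c \<in> sign_cone z I a"
  shows "c \<bullet> signed_sum z I l a = (\<Sum>i\<in>I. l i * \<bar>z i \<bullet> c\<bar>)"
  using assms by (simp add: inner_signed_sum in_sign_cone_iff_abs)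

lemma inner_signed_sum_eq_iff:
  assumes "finite I" "\<And>i. i \<in> I \<Longrightarrow> l i > 0"
  shows "c \<bullet> signed_sum z I l a = (\<Sum>i\<in>I. l i * \<bar>z i \<bullet> c\<bar>) \<longleftrightarrow> c \<in> sign_cone z I a"
proof
  assume "c \<bullet> signed_sum z I l a = (\<Sum>i\<in>I. l i * \<bar>z i \<bullet> c\<bar>)"
  then have "(\<Sum>i\<in>I. l i * (\<bar>z i \<bullet> c\<bar> - sgn (z i \<bullet> a) * (z i \<bullet> c))) = 0"
    by (simp add: inner_signed_sum right_diff_distrib sum_subtractf)
  moreover have "l i * (\<bar>z i \<bullet> c\<bar> - sgn (z i \<bullet> a) * (z i \<bullet> c)) \<ge> 0" if "i \<in> I" for i
  proof -
    have "sgn r * s \<le> \<bar>s\<bar>" for r s :: real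
      by (cases "r > 0"; cases "r = 0") auto
    then show ?thesis using assms(2)[OF that] by simp
  qed
  ultimately have "\<forall>i\<in>I. l i * (\<bar>z i \<bullet> c\<bar> - sgn (z i \<bullet> a) * (z i \<bullet> c)) = 0"
    by (subst (asm) sum_nonneg_eq_0_iff[OF assms(1)])
  then show "c \<in> sign_cone z I a"
    unfolding in_sign_cone_iff_abs
  proof (intro ballI)
    fix i assume "\<forall>i\<in>I. l i * (\<bar>z i \<bullet> c\<bar> - sgn (z i \<bullet> a) * (z i \<bullet> c)) = 0" and i: "i \<in> I"
    then have "l i * (\<bar>z i \<bullet> c\<bar> - sgn (z i \<bullet> a) * (z i \<bullet> c)) = 0" by blast
    then show "sgn (z i \<bullet> a) * (z i \<bullet> c) = \<bar>z i \<bullet> c\<bar>" using assms(2)[OF i] by simp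
  qed
qed (rule inner_signed_sum_sign_cone)

text \<open>The general index type lets one theory cover \<open>zonotope z l\<close> and, after a
  translation, every sum of segments.\<close>

definition segment_sum :: "('i \<Rightarrow> 'a::real_inner) \<Rightarrow> 'i set \<Rightarrow> ('i \<Rightarrow> real) \<Rightarrow> 'a set" where
  "segment_sum z I l = (\<Sum>i\<in>I. closed_segment (- (l i *\<^sub>R z i)) (l i *\<^sub>R z i))"

lemma polytope_segment_sum:
  fixes z :: "'i \<Rightarrow> 'a::euclidean_space"
  assumes "finite I"
  shows "polytope (segment_sum z I l)"
proof -
  have "segment_sum z I l = convex hull (\<Sum>i\<in>I. {- (l i *\<^sub>R z i), l i *\<^sub>R z i})"
    by (simp add: segment_sum_def convex_hull_set_sum segment_convex_hull)
  moreover have "finite (\<Sum>i\<in>I. {- (l i *\<^sub>R z i), l i *\<^sub>R z i})"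
    using assms by (induction I) (auto simp: finite_set_plus)
  ultimately show ?thesis unfolding polytope_def by blast
qed

lemma signed_sum_in_segment_sum:
  assumes "finite I"
  shows "signed_sum z I l x \<in> segment_sum z I l"
proof -
  have "(l i * sgn (z i \<bullet> x)) *\<^sub>R z i \<in> closed_segment (- (l i *\<^sub>R z i)) (l i *\<^sub>R z i)" for i
  proof -
    \<comment> \<open>\<open>(1 + r) / 2\<close> is the segment parameter of the point at relative
      position \<open>r\<close> between -1 and 1.\<close>
    have "(l i * r) *\<^sub>R z i = (1 - (1 + r) / 2) *\<^sub>R (- (l i *\<^sub>R z i)) + ((1 + r) / 2) *\<^sub>R (l i *\<^sub>R z i)" for r
    proof -
      have "(1 - (1 + r) / 2) *\<^sub>R (- (l i *\<^sub>R z i)) + ((1 + r) / 2) *\<^sub>R (l i *\<^sub>R z i) =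
          (- ((1 - (1 + r) / 2) * l i) + ((1 + r) / 2) * l i) *\<^sub>R z i"
        by (simp only: scaleR_minus_right scaleR_minus_left scaleR_add_left scaleR_scaleR)
      also have "- ((1 - (1 + r) / 2) * l i) + ((1 + r) / 2) * l i = l i * r"
        by (simp add: field_simps)
      finally show ?thesis by simp
    qed
    moreover have "0 \<le> (1 + sgn (z i \<bullet> x)) / 2" "(1 + sgn (z i \<bullet> x)) / 2 \<le> 1"
      by (auto simp: sgn_real_def)
    ultimately show ?thesis unfolding in_segment by blast
  qed
  then show ?thesis
    unfolding segment_sum_def signed_sum_def set_sum_alt[OF assms] by blast
qed

lemma inner_le_segment_sum:
  fixes z :: "'i \<Rightarrow> 'a::euclidean_space"
  assumes "finite I" "\<And>i. i \<in> I \<Longrightarrow> l i \<ge> 0" "y \<in> segment_sum z I l"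
  shows "x \<bullet> y \<le> (\<Sum>i\<in>I. l i * \<bar>z i \<bullet> x\<bar>)"
proof -
  obtain s where s: "y = sum s I" "\<And>i. i \<in> I \<Longrightarrow> s i \<in> closed_segment (- (l i *\<^sub>R z i)) (l i *\<^sub>R z i)"
    using assms(3) unfolding segment_sum_def set_sum_alt[OF assms(1)] by auto
  have "x \<bullet> s i \<le> l i * \<bar>z i \<bullet> x\<bar>" if i: "i \<in> I" for i
  proof -
    have "s i \<in> {v. x \<bullet> v \<le> l i * \<bar>z i \<bullet> x\<bar>}"
    proof (rule subsetD[OF closed_segment_subset s(2)[OF i]])
      show "convex {v. x \<bullet> v \<le> l i * \<bar>z i \<bullet> x\<bar>}" by (rule convex_halfspace_le)
      have "l i * (z i \<bullet> x) \<le> l i * \<bar>z i \<bullet> x\<bar>" "l i * (- (z i \<bullet> x)) \<le> l i * \<bar>z i \<bullet> x\<bar>"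
        using assms(2)[OF i] by (intro mult_left_mono; simp)+
      then show "- (l i *\<^sub>R z i) \<in> {v. x \<bullet> v \<le> l i * \<bar>z i \<bullet> x\<bar>}" "l i *\<^sub>R z i \<in> {v. x \<bullet> v \<le> l i * \<bar>z i \<bullet> x\<bar>}"
        by (auto simp: inner_commute)
    qed
    then show ?thesis by simp
  qed
  then show ?thesis unfolding s(1) inner_sum_right by (rule sum_mono)
qed

text \<open>If \<open>y\<close> were outside, a strictly separating functional would exceed at
  \<open>y\<close> all its values on \<open>S\<close>.\<close>

lemma convex_closed_memI:
  fixes S :: "'a::euclidean_space set"
  assumes "convex S" "closed S" "\<And>x. \<exists>v\<in>S. x \<bullet> y \<le> x \<bullet> v"
  shows "y \<in> S"
proof (rule ccontr)
  assume "y \<notin> S"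
  then obtain a b where ab: "a \<bullet> y < b" "\<forall>x\<in>S. a \<bullet> x > b"
    using separating_hyperplane_closed_point[OF assms(1,2)] by blast
  obtain v where "v \<in> S" "(- a) \<bullet> y \<le> (- a) \<bullet> v" using assms(3) by blast
  then show False using ab by fastforce
qed

lemma in_segment_sum_iff:
  fixes z :: "'i \<Rightarrow> 'a::euclidean_space"
  assumes "finite I" "\<And>i. i \<in> I \<Longrightarrow> l i \<ge> 0"
  shows "y \<in> segment_sum z I l \<longleftrightarrow> (\<forall>x. x \<bullet> y \<le> (\<Sum>i\<in>I. l i * \<bar>z i \<bullet> x\<bar>))"
proof
  assume h: "\<forall>x. x \<bullet> y \<le> (\<Sum>i\<in>I. l i * \<bar>z i \<bullet> x\<bar>)"
  show "y \<in> segment_sum z I l"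
  proof (rule convex_closed_memI)
    show "convex (segment_sum z I l)" "closed (segment_sum z I l)"
      using polytope_segment_sum[OF assms(1)] polytope_imp_convex polytope_imp_closed by blast+
    show "\<exists>v\<in>segment_sum z I l. x \<bullet> y \<le> x \<bullet> v" for x
      using h signed_sum_in_segment_sum[OF assms(1)] inner_signed_sum_self by metis
  qed
next
  assume "y \<in> segment_sum z I l"
  then show "\<forall>x. x \<bullet> y \<le> (\<Sum>i\<in>I. l i * \<bar>z i \<bullet> x\<bar>)"
    using inner_le_segment_sum[of I l y z] assms by blast
qed

text \<open>In every direction \<open>x\<close> the maximum is attained at the vertex of a generic
  \<open>p\<close>, namely of one that refines the signs of \<open>x\<close>.\<close>

lemma segment_sum_subset_convex_hull:
  fixes z :: "'i \<Rightarrow> 'a::euclidean_space"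
  assumes "finite I" "\<And>i. i \<in> I \<Longrightarrow> l i \<ge> 0"
  shows "segment_sum z I l \<subseteq> convex hull (signed_sum z I l ` {p. generic z I p})"
proof
  fix y assume y: "y \<in> segment_sum z I l"
  let ?V = "signed_sum z I l ` {p. generic z I p}"
  \<comment> \<open>The vertices depend only on sign patterns. Finiteness makes their hull closed,
    as the separation argument requires.\<close>
  have "finite ?V"
  proof (rule finite_subset)
    show "?V \<subseteq> (\<lambda>s. \<Sum>i\<in>I. (l i * s i) *\<^sub>R z i) ` (I \<rightarrow>\<^sub>E {-1, 0, 1})"
    proof
      fix v assume "v \<in> ?V"
      then obtain p where "v = signed_sum z I l p" by auto
      then have "v = (\<Sum>i\<in>I. (l i * restrict (\<lambda>i. sgn (z i \<bullet> p)) I i) *\<^sub>R z i)"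
        by (simp add: signed_sum_def)
      moreover have "restrict (\<lambda>i. sgn (z i \<bullet> p)) I \<in> I \<rightarrow>\<^sub>E {-1, 0, 1}"
        by (auto simp: sgn_real_def)
      ultimately show "v \<in> (\<lambda>s. \<Sum>i\<in>I. (l i * s i) *\<^sub>R z i) ` (I \<rightarrow>\<^sub>E {-1, 0, 1})" by blast
    qed
    show "finite ((\<lambda>s. \<Sum>i\<in>I. (l i * s i) *\<^sub>R z i) ` (I \<rightarrow>\<^sub>E {-1, 0, 1::real}))"
      using assms(1) by (intro finite_imageI finite_PiE) auto
  qed
  show "y \<in> convex hull ?V"
  proof (rule convex_closed_memI)
    show "closed (convex hull ?V)"
      using \<open>finite ?V\<close> by (simp add: compact_imp_closed finite_imp_compact_convex_hull)
    fix x
    obtain p where p: "generic z I p" "\<And>i. i \<in> I \<Longrightarrow> z i \<bullet> x \<noteq> 0 \<Longrightarrow> sgn (z i \<bullet> p) = sgn (z i \<bullet> x)"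
      using exists_generic_refining[OF assms(1)] by blast
    have "x \<in> sign_cone z I p"
      unfolding in_sign_cone_iff_abs 
    proof
      fix i assume "i \<in> I"
      then show "sgn (z i \<bullet> p) * (z i \<bullet> x) = \<bar>z i \<bullet> x\<bar>"
        using p(2)[of i] by (cases "z i \<bullet> x = 0") (simp_all add: abs_sgn mult.commute)
    qed
    then have "x \<bullet> signed_sum z I l p = (\<Sum>i\<in>I. l i * \<bar>z i \<bullet> x\<bar>)"
      by (rule inner_signed_sum_sign_cone)
    then show "\<exists>v\<in>convex hull ?V. x \<bullet> y \<le> x \<bullet> v"
      using p(1) inner_le_segment_sum[OF assms y] by (metis (mono_tags) hull_inc imageI mem_Collect_eq)
  qed simp
qed

text \<open>The face contains \<open>signed_sum z I l a\<close>, so every \<open>c\<close> in the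
  normal cone is maximal there, and with positive coefficients this forces the signs of
  \<open>c\<close> term by term.\<close>

lemma normal_cone_exposed_face:
  fixes z :: "'i \<Rightarrow> 'a::euclidean_space"
  assumes I: "finite I" and l: "\<And>i. i \<in> I \<Longrightarrow> l i > 0"
  shows "normal_cone (segment_sum z I l)
      (segment_sum z I l \<inter> {y. a \<bullet> y = (\<Sum>i\<in>I. l i * \<bar>z i \<bullet> a\<bar>)}) = sign_cone z I a"
proof (intro equalityI subsetI)
  have le: "x \<bullet> y \<le> (\<Sum>i\<in>I. l i * \<bar>z i \<bullet> x\<bar>)" if "y \<in> segment_sum z I l" for x y
    using inner_le_segment_sum[OF I less_imp_le[OF l] that] .
  note mem = signed_sum_in_segment_sum[OF I, of z l]
  {
    fix c assume c: "c \<in> normal_cone (segment_sum z I l)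
      (segment_sum z I l \<inter> {y. a \<bullet> y = (\<Sum>i\<in>I. l i * \<bar>z i \<bullet> a\<bar>)})"
    then have "c \<bullet> signed_sum z I l c \<le> c \<bullet> signed_sum z I l a"
      using mem inner_signed_sum_self by (fastforce simp: normal_cone_def)
    then have "c \<bullet> signed_sum z I l a = (\<Sum>i\<in>I. l i * \<bar>z i \<bullet> c\<bar>)"
      using le[OF mem, of c a] by (simp add: inner_signed_sum_self)
    then show "c \<in> sign_cone z I a" using inner_signed_sum_eq_iff[of I l c z a] I l by blast
  next
    fix c assume c: "c \<in> sign_cone z I a"
    obtain e where e: "e > 0" "a + e *\<^sub>R (a - c) \<in> sign_cone z I a"
      using sign_cone_prolong[OF I c] .
    define b where "b = a + e *\<^sub>R (a - c)"
    have b: "(1 + e) *\<^sub>R a = b + e *\<^sub>R c" by (simp add: b_def algebra_simps)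
    let ?h = "\<lambda>x. \<Sum>i\<in>I. l i * \<bar>z i \<bullet> x\<bar>"
    \<comment> \<open>The support function is linear on the sign cone of \<open>a\<close>, which
      contains \<open>b\<close> and \<open>c\<close>. Hence a point maximal for
      \<open>(1 + e) *\<^sub>R a = b + e *\<^sub>R c\<close> is maximal for \<open>c\<close>
      too.\<close>
    have hb: "?h b + e * ?h c = (1 + e) * ?h a"
    proof -
      have "(1 + e) * ?h a = ((1 + e) *\<^sub>R a) \<bullet> signed_sum z I l a"
        by (simp add: inner_signed_sum_self)
      also have "\<dots> = b \<bullet> signed_sum z I l a + e * (c \<bullet> signed_sum z I l a)"
        unfolding b by (simp add: inner_add_left)
      also have "\<dots> = ?h b + e * ?h c"
        using inner_signed_sum_sign_cone[OF c] inner_signed_sum_sign_cone[OF e(2)] by (simp add: b_def)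
      finally show ?thesis by simp
    qed
    have "c \<bullet> y \<le> c \<bullet> x" if x: "x \<in> segment_sum z I l" "a \<bullet> x = ?h a" and y: "y \<in> segment_sum z I l" for x y
    proof -
      have "b \<bullet> x + e * (c \<bullet> x) = ((1 + e) *\<^sub>R a) \<bullet> x" unfolding b by (simp add: inner_add_left)
      also have "\<dots> = ?h b + e * ?h c" using x(2) hb by simp
      finally have "e * (c \<bullet> x) \<ge> e * ?h c" using le[OF x(1), of b] by linarith
      then have "c \<bullet> x \<ge> ?h c" using e(1) by simp
      then show ?thesis using le[OF y, of c] by linarith
    qed
    then show "c \<in> normal_cone (segment_sum z I l) (segment_sum z I l \<inter> {y. a \<bullet> y = ?h a})"
      by (auto simp: normal_cone_def)
  }
qed

text \<open>All faces of a polytope are exposed, so each nonempty one is the set where some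
  \<open>a\<close> is maximal; \<open>a = 0\<close> accounts for the polytope itself.\<close>

lemma normal_fan_segment_sum:
  fixes z :: "'i \<Rightarrow> 'a::euclidean_space"
  assumes I: "finite I" and l: "\<And>i. i \<in> I \<Longrightarrow> l i > 0"
  shows "normal_fan (segment_sum z I l) = range (sign_cone z I)"
proof (intro equalityI subsetI)
  let ?h = "\<lambda>x. \<Sum>i\<in>I. l i * \<bar>z i \<bullet> x\<bar>"
  have le: "x \<bullet> y \<le> ?h x" if "y \<in> segment_sum z I l" for x y
    using inner_le_segment_sum[OF I less_imp_le[OF l] that] .
  note mem = signed_sum_in_segment_sum[OF I, of z l]
  {
    fix N assume "N \<in> normal_fan (segment_sum z I l)"
    then obtain F where F: "N = normal_cone (segment_sum z I l) F" "F face_of segment_sum z I l" "F \<noteq> {}"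
      by (auto simp: normal_fan_def)
    then have "F exposed_face_of segment_sum z I l"
      using exposed_face_of_polyhedron polytope_imp_polyhedron polytope_segment_sum[OF I] by blast
    then obtain a b where ab: "segment_sum z I l \<subseteq> {x. a \<bullet> x \<le> b}" "F = segment_sum z I l \<inter> {x. a \<bullet> x = b}"
      unfolding exposed_face_of_def by blast
    obtain y where "y \<in> segment_sum z I l" "a \<bullet> y = b" using F(3) ab(2) by auto
    then have "b \<le> ?h a" using le by blast
    moreover have "?h a \<le> b" using ab(1) mem[of a] by (auto simp: inner_signed_sum_self)
    ultimately have "F = segment_sum z I l \<inter> {y. a \<bullet> y = ?h a}" using ab(2) by simp
    then have "N = sign_cone z I a" using F(1) normal_cone_exposed_face[of I l z a, OF I l] by simp
    then show "N \<in> range (sign_cone z I)" by blast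
  next
    fix N assume "N \<in> range (sign_cone z I)"
    then obtain a where N: "N = sign_cone z I a" by auto
    let ?F = "segment_sum z I l \<inter> {y. a \<bullet> y = ?h a}"
    have "?F face_of segment_sum z I l"
      using le polytope_imp_convex[OF polytope_segment_sum[OF I]]
      by (intro face_of_Int_supporting_hyperplane_le)
    moreover have "?F \<noteq> {}" using mem[of a] inner_signed_sum_self by blast
    moreover have "N = normal_cone (segment_sum z I l) ?F"
      using N normal_cone_exposed_face[of I l z a, OF I l] by simp
    ultimately show "N \<in> normal_fan (segment_sum z I l)" unfolding normal_fan_def by blast
  }
qed

lemma signed_sum_extreme_point:
  fixes z :: "'i \<Rightarrow> 'a::euclidean_space"
  assumes I: "finite I" and l: "\<And>i. i \<in> I \<Longrightarrow> l i > 0" and p: "generic z I p"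
  shows "signed_sum z I l p extreme_point_of segment_sum z I l"
proof -
  let ?h = "\<lambda>x. \<Sum>i\<in>I. l i * \<bar>z i \<bullet> x\<bar>" and ?s = "signed_sum z I l p"
  have le: "x \<bullet> y \<le> ?h x" if "y \<in> segment_sum z I l" for x y
    using inner_le_segment_sum[OF I less_imp_le[OF l] that] .
  let ?F = "segment_sum z I l \<inter> {y. p \<bullet> y = ?h p}"
  have F: "?F face_of segment_sum z I l"
    using le polytope_imp_convex[OF polytope_segment_sum[OF I]]
    by (intro face_of_Int_supporting_hyperplane_le)
  have "?F = {?s}"
  proof (intro equalityI subsetI)
    fix y assume y: "y \<in> ?F"
    \<comment> \<open>Tilting \<open>p\<close> slightly towards \<open>d\<close> keeps its signs and
      hence the maximiser \<open>?s\<close>, yet favours \<open>y\<close> by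
      \<open>e * (d \<bullet> d)\<close>.\<close>
    define d where "d = y - ?s"
    obtain e where e: "e > 0" "\<And>i t. i \<in> I \<Longrightarrow> z i \<bullet> p \<noteq> 0 \<Longrightarrow> \<bar>t\<bar> \<le> e \<Longrightarrow>
        sgn (z i \<bullet> (p + t *\<^sub>R d)) = sgn (z i \<bullet> p)"
      using sgn_inner_perturb[OF I] by blast
    have "signed_sum z I l (p + e *\<^sub>R d) = ?s"
    proof (rule signed_sum_cong)
      fix i assume i: "i \<in> I"
      show "sgn (z i \<bullet> (p + e *\<^sub>R d)) = sgn (z i \<bullet> p)"
        using e(1) e(2)[OF i, of e] p i by (cases "z i = 0") (auto simp: generic_def)
    qed
    then have "(p + e *\<^sub>R d) \<bullet> y \<le> (p + e *\<^sub>R d) \<bullet> ?s"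
      using le[of y "p + e *\<^sub>R d"] y inner_signed_sum_self[of "p + e *\<^sub>R d" z I l] by simp
    moreover have "p \<bullet> y = p \<bullet> ?s" using y by (simp add: inner_signed_sum_self)
    ultimately have "e * (d \<bullet> d) \<le> 0"
      by (simp add: d_def inner_add_left inner_diff_right algebra_simps)
    then have "d = 0" using e(1) by (simp add: mult_le_0_iff) (metis inner_ge_zero inner_eq_zero_iff antisym)
    then show "y \<in> {?s}" by (simp add: d_def)
  qed (use signed_sum_in_segment_sum[OF I] in \<open>auto simp: inner_signed_sum_self\<close>)
  then show ?thesis using F by (simp add: face_of_singleton)
qed

lemma inscribed_segment_sum_iff:
  fixes z :: "'i \<Rightarrow> 'a::euclidean_space"
  assumes I: "finite I" and l: "\<And>i. i \<in> I \<Longrightarrow> l i > 0"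
  shows "inscribed_polytope (segment_sum z I l) \<longleftrightarrow>
    (\<forall>p q. generic z I p \<longrightarrow> generic z I q \<longrightarrow> norm (signed_sum z I l p) = norm (signed_sum z I l q))"
proof
  assume "inscribed_polytope (segment_sum z I l)"
  then obtain c r where cr: "\<And>p. generic z I p \<Longrightarrow> dist c (signed_sum z I l p) = r"
    using signed_sum_extreme_point[of I l z, OF I l]
    unfolding inscribed_polytope_def on_common_sphere_def by force
  \<comment> \<open>Adding the distance equations of the antipodal vertices for \<open>p\<close> and
    \<open>- p\<close> cancels the term linear in \<open>c\<close>, so the norms agree wherever the
    centre is.\<close>
  have "(norm (signed_sum z I l p))\<^sup>2 = r\<^sup>2 - (norm c)\<^sup>2" if p: "generic z I p" for p
  proof -
    have "generic z I (- p)" using p by (simp add: generic_def)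
    then have "(norm (c - signed_sum z I l p))\<^sup>2 = r\<^sup>2" "(norm (c + signed_sum z I l p))\<^sup>2 = r\<^sup>2"
      using cr[OF p] cr[of "- p"] by (simp_all add: dist_norm signed_sum_uminus)
    then show ?thesis by (simp add: power2_norm_eq_inner inner_diff_left inner_diff_right inner_add_left inner_add_right inner_commute)
  qed
  then show "\<forall>p q. generic z I p \<longrightarrow> generic z I q \<longrightarrow> norm (signed_sum z I l p) = norm (signed_sum z I l q)"
    by (metis norm_ge_zero power2_eq_imp_eq)
next
  assume eq: "\<forall>p q. generic z I p \<longrightarrow> generic z I q \<longrightarrow> norm (signed_sum z I l p) = norm (signed_sum z I l q)"
  obtain p0 where p0: "generic z I p0" using exists_generic_refining[OF I] by blast
  have vertex: "v \<in> signed_sum z I l ` {p. generic z I p}" if "v extreme_point_of segment_sum z I l" for v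
  proof (rule extreme_point_of_convex_hull)
    have "convex hull (signed_sum z I l ` {p. generic z I p}) \<subseteq> segment_sum z I l"
      using signed_sum_in_segment_sum[OF I] polytope_imp_convex[OF polytope_segment_sum[OF I]]
      by (intro hull_minimal) auto
    then have "convex hull (signed_sum z I l ` {p. generic z I p}) = segment_sum z I l"
      using segment_sum_subset_convex_hull[of I l z, OF I less_imp_le[OF l]] by (rule subset_antisym)
    then show "v extreme_point_of convex hull (signed_sum z I l ` {p. generic z I p})"
      using that by (rule ssubst)
  qed
  then show "inscribed_polytope (segment_sum z I l)"
    unfolding inscribed_polytope_def on_common_sphere_def
  proof (intro exI subsetI)
    fix v assume "v \<in> {v. v extreme_point_of segment_sum z I l}"
    then obtain p where "generic z I p" "v = signed_sum z I l p"
      using vertex by blast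
    then have "norm v = norm (signed_sum z I l p0)" using eq p0 by blast
    then show "v \<in> sphere 0 (norm (signed_sum z I l p0))" by simp
  qed
qed

section \<open>The balance condition on walls\<close>

definition balanced :: "('n::finite \<Rightarrow> 'a::real_inner) \<Rightarrow> ('n \<Rightarrow> real) \<Rightarrow> bool" where
  "balanced z l \<longleftrightarrow> (\<forall>i x. z i \<bullet> x = 0 \<longrightarrow> (\<forall>j. j \<noteq> i \<longrightarrow> z j \<bullet> x \<noteq> 0) \<longrightarrow>
     z i \<bullet> signed_sum z UNIV l x = 0)"

lemma sgn_convex_combination:
  fixes r s t :: real
  assumes "sgn r = sgn s" "0 \<le> t" "t \<le> 1"
  shows "sgn ((1 - t) * r + t * s) = sgn r"
proof -
  consider "r > 0" "s > 0" | "r = 0" "s = 0" | "r < 0" "s < 0"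
    using assms(1) by (cases r "0::real" rule: linorder_cases; cases s "0::real" rule: linorder_cases) auto
  then show ?thesis
  proof cases
    case 1
    then have "(1 - t) * r \<ge> 0" "t * s \<ge> 0" "t < 1 \<Longrightarrow> (1 - t) * r > 0" "t = 1 \<Longrightarrow> t * s > 0"
      using assms by auto
    then have "(1 - t) * r + t * s > 0" using assms(3) by (cases "t = 1") auto
    then show ?thesis using 1 by simp
  next
    case 3
    then have "(1 - t) * r \<le> 0" "t * s \<le> 0" "t < 1 \<Longrightarrow> (1 - t) * r < 0" "t = 1 \<Longrightarrow> t * s < 0"
      using assms by (auto simp: mult_nonneg_nonpos mult_pos_neg)
    then have "(1 - t) * r + t * s < 0" using assms(3) by (cases "t = 1") auto
    then show ?thesis using 3 by simp
  qed simp
qed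

text \<open>\<open>r / (r - s)\<close> is the zero of the affine function
  \<open>(1 - t) * r + t * s\<close> of \<open>t\<close>, whose values at 0 and 1 are
  \<open>r\<close> and \<open>s\<close>.\<close>

lemma sgn_crossing:
  fixes r s t :: real
  assumes "r \<noteq> 0" "s \<noteq> 0" "sgn r \<noteq> sgn s"
  shows "t < r / (r - s) \<Longrightarrow> sgn ((1 - t) * r + t * s) = sgn r"
    "t > r / (r - s) \<Longrightarrow> sgn ((1 - t) * r + t * s) = sgn s"
    "0 < r / (r - s)" "r / (r - s) < 1"
proof -
  have e: "(1 - t) * r + t * s = r - t * (r - s)" by (simp add: algebra_simps)
  consider "r > 0" "s < 0" | "r < 0" "s > 0"
    using assms by (cases r "0::real" rule: linorder_cases; cases s "0::real" rule: linorder_cases) auto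
  note c = this
  show "t < r / (r - s) \<Longrightarrow> sgn ((1 - t) * r + t * s) = sgn r"
    unfolding e using c by cases (auto simp: pos_less_divide_eq neg_less_divide_eq)
  show "t > r / (r - s) \<Longrightarrow> sgn ((1 - t) * r + t * s) = sgn s"
    unfolding e using c by cases (auto simp: pos_divide_less_eq neg_divide_less_eq)
  show "0 < r / (r - s)" "r / (r - s) < 1"
    using c by (cases; auto simp: pos_divide_less_eq neg_divide_less_eq zero_less_divide_iff)+
qed

lemma hyperplane_scale: "c \<noteq> 0 \<Longrightarrow> hyperplane (c *\<^sub>R v) = hyperplane v"
  by (simp add: hyperplane_def)

text \<open>Only the term of \<open>z i\<close> distinguishes the three sums, and it vanishes at
  \<open>x\<close>. So the sums at \<open>p\<close> and \<open>q\<close> are the one at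
  \<open>x\<close> plus and minus the same vector; the last identity is the polarisation
  formula.\<close>

lemma signed_sums_across_wall:
  fixes z :: "'n::finite \<Rightarrow> 'a::real_inner"
  assumes x: "z i \<bullet> x = 0"
    and p: "\<And>j. j \<noteq> i \<Longrightarrow> sgn (z j \<bullet> p) = sgn (z j \<bullet> x)"
    and q: "\<And>j. j \<noteq> i \<Longrightarrow> sgn (z j \<bullet> q) = sgn (z j \<bullet> x)"
    and pq: "sgn (z i \<bullet> q) = - sgn (z i \<bullet> p)"
  shows "signed_sum z UNIV l p + signed_sum z UNIV l q = 2 *\<^sub>R signed_sum z UNIV l x"
    "signed_sum z UNIV l p - signed_sum z UNIV l q = (2 * (l i * sgn (z i \<bullet> p))) *\<^sub>R z i"
    "(norm (signed_sum z UNIV l p))\<^sup>2 - (norm (signed_sum z UNIV l q))\<^sup>2 =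
       4 * (l i * sgn (z i \<bullet> p)) * (z i \<bullet> signed_sum z UNIV l x)"
proof -
  have split: "signed_sum z UNIV l y = (l i * sgn (z i \<bullet> y)) *\<^sub>R z i + signed_sum z (- {i}) l y" for y
    unfolding signed_sum_def by (subst sum.remove[of _ i]) (auto simp: Compl_eq_Diff_UNIV)
  have "signed_sum z (- {i}) l p = signed_sum z (- {i}) l x" "signed_sum z (- {i}) l q = signed_sum z (- {i}) l x"
    using p q by (auto intro: signed_sum_cong)
  then have P: "signed_sum z UNIV l p = (l i * sgn (z i \<bullet> p)) *\<^sub>R z i + signed_sum z UNIV l x"
    and Q: "signed_sum z UNIV l q = - ((l i * sgn (z i \<bullet> p)) *\<^sub>R z i) + signed_sum z UNIV l x"
    using split[of p] split[of q] split[of x] x pq by simp_all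
  show "signed_sum z UNIV l p + signed_sum z UNIV l q = 2 *\<^sub>R signed_sum z UNIV l x"
    unfolding P Q by (simp add: scaleR_2)
  show "signed_sum z UNIV l p - signed_sum z UNIV l q = (2 * (l i * sgn (z i \<bullet> p))) *\<^sub>R z i"
    unfolding P Q by (simp add: scaleR_2 flip: scaleR_scaleR)
  show "(norm (signed_sum z UNIV l p))\<^sup>2 - (norm (signed_sum z UNIV l q))\<^sup>2 =
       4 * (l i * sgn (z i \<bullet> p)) * (z i \<bullet> signed_sum z UNIV l x)"
    unfolding P Q power2_norm_eq_inner
    by (simp add: inner_add_left inner_add_right inner_diff_left inner_diff_right inner_commute algebra_simps)
qed

lemma wall_point_between:
  fixes z :: "'n::finite \<Rightarrow> 'a::real_inner"
  assumes p: "\<And>j. z j \<bullet> p \<noteq> 0" and q: "\<And>j. z j \<bullet> q \<noteq> 0"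
    and i: "sgn (z i \<bullet> p) \<noteq> sgn (z i \<bullet> q)" and eq: "\<And>j. j \<noteq> i \<Longrightarrow> sgn (z j \<bullet> p) = sgn (z j \<bullet> q)"
  obtains t where "0 < t" "t < 1" "z i \<bullet> ((1 - t) *\<^sub>R p + t *\<^sub>R q) = 0"
    "\<And>j. j \<noteq> i \<Longrightarrow> sgn (z j \<bullet> ((1 - t) *\<^sub>R p + t *\<^sub>R q)) = sgn (z j \<bullet> p)"
    "sgn (z i \<bullet> q) = - sgn (z i \<bullet> p)"
proof
  let ?r = "z i \<bullet> p" and ?s = "z i \<bullet> q"
  let ?t = "?r / (?r - ?s)"
  show t: "0 < ?t" "?t < 1" using sgn_crossing(3,4)[OF p q i] .
  have "?r - ?s \<noteq> 0" using i by auto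
  then have "(1 - ?t) * ?r + ?t * ?s = 0" by (simp add: field_simps)
  then show "z i \<bullet> ((1 - ?t) *\<^sub>R p + ?t *\<^sub>R q) = 0" by (simp add: inner_add_right)
  show "sgn (z j \<bullet> ((1 - ?t) *\<^sub>R p + ?t *\<^sub>R q)) = sgn (z j \<bullet> p)" if "j \<noteq> i" for j
    using sgn_convex_combination[OF eq[OF that], of ?t] t by (simp add: inner_add_right)
  show "sgn ?s = - sgn ?r"
    using i p[of i] q[of i] by (auto simp: sgn_real_def split: if_splits)
qed

text \<open>Induction on the number of walls separating \<open>p\<close> from \<open>q\<close>. If two of them are distinct, \<open>q\<close> is
  moved slightly so that the segment to \<open>p\<close> crosses them at different times, and a generic point of
  the segment between these crossings is separated from either end by fewer walls.\<close>

lemma balanced_norm_signed_sum_eq: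
  fixes z :: "'n::finite \<Rightarrow> 'a::euclidean_space"
  assumes dist: "inj (\<lambda>i. hyperplane (z i))" and bal: "balanced z l"
    and "\<And>j. z j \<bullet> p \<noteq> 0" "\<And>j. z j \<bullet> q \<noteq> 0"
  shows "norm (signed_sum z UNIV l p) = norm (signed_sum z UNIV l q)"
  using assms(3,4)
proof (induction "card {i. sgn (z i \<bullet> p) \<noteq> sgn (z i \<bullet> q)}" arbitrary: p q rule: less_induct)
  case (less p q)
  note p = less.prems(1) and q = less.prems(2)
  define D where "D = {i. sgn (z i \<bullet> p) \<noteq> sgn (z i \<bullet> q)}"
  consider "D = {}" | i where "D = {i}" | i j where "i \<in> D" "j \<in> D" "i \<noteq> j" by blast
  then show ?case
  proof cases
    case 1
    then have "signed_sum z UNIV l p = signed_sum z UNIV l q"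
      by (intro signed_sum_cong) (auto simp: D_def)
    then show ?thesis by simp
  next
    case (2 i)
    then have i: "sgn (z i \<bullet> p) \<noteq> sgn (z i \<bullet> q)" "\<And>j. j \<noteq> i \<Longrightarrow> sgn (z j \<bullet> p) = sgn (z j \<bullet> q)"
      by (auto simp: D_def)
    obtain t where t: "z i \<bullet> ((1 - t) *\<^sub>R p + t *\<^sub>R q) = 0"
      "\<And>j. j \<noteq> i \<Longrightarrow> sgn (z j \<bullet> ((1 - t) *\<^sub>R p + t *\<^sub>R q)) = sgn (z j \<bullet> p)"
      "sgn (z i \<bullet> q) = - sgn (z i \<bullet> p)"
      using wall_point_between[of z p q i, OF p q i] by metis
    let ?x = "(1 - t) *\<^sub>R p + t *\<^sub>R q"
    have "z j \<bullet> ?x \<noteq> 0" if "j \<noteq> i" for j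
      using t(2)[OF that] p[of j] by (metis sgn_zero_iff)
    then have "z i \<bullet> signed_sum z UNIV l ?x = 0" using bal t(1) unfolding balanced_def by blast
    moreover have "sgn (z j \<bullet> q) = sgn (z j \<bullet> ?x)" if "j \<noteq> i" for j
      using t(2)[OF that] i(2)[OF that] by simp
    ultimately have "(norm (signed_sum z UNIV l p))\<^sup>2 - (norm (signed_sum z UNIV l q))\<^sup>2 = 0"
      using signed_sums_across_wall(3)[of z i ?x p q l] t by simp
    then show ?thesis by (simp add: power2_eq_iff_nonneg)
  next
    case (3 i j)
    \<comment> \<open>\<open>w \<bullet> q'\<close> vanishes exactly when the segment from
      \<open>p\<close> to \<open>q'\<close> crosses the hyperplanes of \<open>z i\<close> and
      \<open>z j\<close> at the same time. As these are distinct, \<open>w\<close> is nonzero, so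
      moving along \<open>w\<close> separates the crossings.\<close>
    define w where "w = (z j \<bullet> p) *\<^sub>R z i - (z i \<bullet> p) *\<^sub>R z j"
    have "w \<noteq> 0"
    proof
      assume "w = 0"
      then have "hyperplane ((z j \<bullet> p) *\<^sub>R z i) = hyperplane ((z i \<bullet> p) *\<^sub>R z j)" by (simp add: w_def)
      then have "hyperplane (z i) = hyperplane (z j)" using p by (simp add: hyperplane_scale)
      then show False using 3(3) dist by (auto dest: injD)
    qed
    obtain q' where q': "\<And>k. sgn (z k \<bullet> q') = sgn (z k \<bullet> q)" "w \<bullet> q' \<noteq> 0"
    proof (cases "w \<bullet> q = 0")
      case True
      obtain e where e: "e > 0" "\<And>k t. z k \<bullet> q \<noteq> 0 \<Longrightarrow> \<bar>t\<bar> \<le> e \<Longrightarrow>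
          sgn (z k \<bullet> (q + t *\<^sub>R w)) = sgn (z k \<bullet> q)"
        using sgn_inner_perturb_UNIV[where u=z and x=q and y=w] by metis
      have "w \<bullet> (q + e *\<^sub>R w) \<noteq> 0" using True \<open>w \<noteq> 0\<close> e(1) by (simp add: inner_add_right)
      moreover have "sgn (z k \<bullet> (q + e *\<^sub>R w)) = sgn (z k \<bullet> q)" for k
        using e q by simp
      ultimately show ?thesis using that by blast
    qed (use that in blast)
    have q'0: "z k \<bullet> q' \<noteq> 0" for k using q'(1)[of k] q[of k] by (metis sgn_zero_iff)
    have D': "D = {i. sgn (z i \<bullet> p) \<noteq> sgn (z i \<bullet> q')}" by (simp add: D_def q'(1))
    have seq: "signed_sum z UNIV l q' = signed_sum z UNIV l q" by (rule signed_sum_cong) (rule q'(1))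
    \<comment> \<open>The time at which the segment from \<open>p\<close> to \<open>q'\<close>
      crosses the hyperplane of \<open>z k\<close>. For \<open>k\<close> outside \<open>D\<close>
      the value has no meaning; a time outside the finite range of \<open>\<tau>\<close> is chosen
      anyway.\<close>
    define \<tau> where "\<tau> k = (z k \<bullet> p) / (z k \<bullet> p - z k \<bullet> q')" for k
    have step: "norm (signed_sum z UNIV l p) = norm (signed_sum z UNIV l q)"
      if ab: "a \<in> D" "b \<in> D" "\<tau> a < \<tau> b" for a b
    proof -
      have "infinite ({\<tau> a<..<\<tau> b} - range \<tau>)" using ab(3) by (simp add: infinite_Ioo)
      then obtain t where t: "\<tau> a < t" "t < \<tau> b" "t \<notin> range \<tau>"
        by (metis Diff_iff finite.emptyI greaterThanLessThan_iff subsetI subset_empty equals0I)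
      define m where "m = (1 - t) *\<^sub>R p + t *\<^sub>R q'"
      have zm: "z k \<bullet> m = (1 - t) * (z k \<bullet> p) + t * (z k \<bullet> q')" for k
        by (simp add: m_def inner_add_right)
      have ab': "sgn (z a \<bullet> p) \<noteq> sgn (z a \<bullet> q')" "sgn (z b \<bullet> p) \<noteq> sgn (z b \<bullet> q')"
        using ab D' by auto
      have t01: "0 \<le> t" "t \<le> 1"
        using t sgn_crossing(3,4)[OF p q'0 ab'(1)] sgn_crossing(3,4)[OF p q'0 ab'(2)]
        unfolding \<tau>_def by linarith+
      have same: "sgn (z k \<bullet> m) = sgn (z k \<bullet> p)" if "k \<notin> D" for k
        unfolding zm using that t01 D' by (intro sgn_convex_combination) auto
      have am: "sgn (z a \<bullet> m) = sgn (z a \<bullet> q')" and bm: "sgn (z b \<bullet> m) = sgn (z b \<bullet> p)"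
        unfolding zm using t sgn_crossing(1,2)[OF p q'0] ab' by (auto simp: \<tau>_def)
      have m0: "z k \<bullet> m \<noteq> 0" for k
      proof (cases "k \<in> D")
        case False
        then show ?thesis using same[of k] p[of k] by (metis sgn_zero_iff)
      next
        case True
        then have k: "sgn (z k \<bullet> p) \<noteq> sgn (z k \<bullet> q')" using D' by auto
        have "t < \<tau> k \<or> t > \<tau> k" using t(3) by (metis linorder_neqE rangeI)
        then have "sgn (z k \<bullet> m) = sgn (z k \<bullet> p) \<or> sgn (z k \<bullet> m) = sgn (z k \<bullet> q')"
          unfolding zm using sgn_crossing(1,2)[OF p q'0 k] by (auto simp: \<tau>_def)
        then show ?thesis using p[of k] q'0[of k] by (metis sgn_zero_iff)
      qed
      \<comment> \<open>At \<open>m\<close> the hyperplane of \<open>b\<close> is not yet crossed,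
        so \<open>b\<close> is missing here; that of \<open>a\<close> is already crossed, so
        \<open>a\<close> is missing from the set for \<open>m\<close> and \<open>q'\<close>.\<close>
      have "{k. sgn (z k \<bullet> p) \<noteq> sgn (z k \<bullet> m)} \<subset> D"
        using same bm ab(2) by force
      then have "card {k. sgn (z k \<bullet> p) \<noteq> sgn (z k \<bullet> m)} < card D"
        by (simp add: psubset_card_mono)
      then have 1: "norm (signed_sum z UNIV l p) = norm (signed_sum z UNIV l m)"
        unfolding D_def by (intro less.hyps p m0)
      have "sgn (z k \<bullet> m) = sgn (z k \<bullet> q')" if "k \<notin> D" for k
        using same[OF that] that D' by auto
      then have "{k. sgn (z k \<bullet> m) \<noteq> sgn (z k \<bullet> q')} \<subset> D"
        using am ab(1) by force
      then have "card {k. sgn (z k \<bullet> m) \<noteq> sgn (z k \<bullet> q')} < card D"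
        by (simp add: psubset_card_mono)
      then have "norm (signed_sum z UNIV l m) = norm (signed_sum z UNIV l q')"
        unfolding D_def by (intro less.hyps m0 q'0)
      then show ?thesis using 1 seq by simp
    qed
    have "\<tau> i \<noteq> \<tau> j"
    proof
      assume "\<tau> i = \<tau> j"
      moreover have "z i \<bullet> p - z i \<bullet> q' \<noteq> 0" "z j \<bullet> p - z j \<bullet> q' \<noteq> 0" using 3 D' by auto
      ultimately have "(z i \<bullet> p) * (z j \<bullet> p - z j \<bullet> q') = (z j \<bullet> p) * (z i \<bullet> p - z i \<bullet> q')"
        by (simp add: \<tau>_def frac_eq_eq)
      then have "w \<bullet> q' = 0" by (simp add: w_def inner_diff_left algebra_simps)
      then show False using q'(2) by simp
    qed
    then show ?thesis using step 3 by (metis linorder_neqE)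
  qed
qed

lemma exists_wall_neighbours:
  fixes z :: "'n::finite \<Rightarrow> 'a::euclidean_space"
  assumes nz: "z i \<noteq> 0" and x: "z i \<bullet> x = 0" "\<And>j. j \<noteq> i \<Longrightarrow> z j \<bullet> x \<noteq> 0"
  obtains p q where "\<And>j. z j \<bullet> p \<noteq> 0" "\<And>j. z j \<bullet> q \<noteq> 0"
    "\<And>j. j \<noteq> i \<Longrightarrow> sgn (z j \<bullet> p) = sgn (z j \<bullet> x)" "\<And>j. j \<noteq> i \<Longrightarrow> sgn (z j \<bullet> q) = sgn (z j \<bullet> x)"
    "sgn (z i \<bullet> p) = 1" "sgn (z i \<bullet> q) = -1"
proof -
  obtain e where e: "e > 0" "\<And>k t. z k \<bullet> x \<noteq> 0 \<Longrightarrow> \<bar>t\<bar> \<le> e \<Longrightarrow>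
      sgn (z k \<bullet> (x + t *\<^sub>R z i)) = sgn (z k \<bullet> x)"
    using sgn_inner_perturb_UNIV[where u=z and x=x and y="z i"] by metis
  define p q where "p = x + e *\<^sub>R z i" "q = x + (- e) *\<^sub>R z i"
  have s: "sgn (z j \<bullet> p) = sgn (z j \<bullet> x)" "sgn (z j \<bullet> q) = sgn (z j \<bullet> x)" if "j \<noteq> i" for j
    using e(2)[OF x(2)[OF that], of e] e(2)[OF x(2)[OF that], of "- e"] e(1)
    by (simp_all add: p_q_def)
  have i: "sgn (z i \<bullet> p) = 1" "sgn (z i \<bullet> q) = -1"
    using nz x(1) e(1) by (simp_all add: p_q_def inner_add_right inner_diff_right sgn_mult)
  have "z j \<bullet> p \<noteq> 0" "z j \<bullet> q \<noteq> 0" for j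
    using s[of j] i x(2)[of j] by (metis sgn_zero_iff sgn_0 zero_neq_neg_one zero_neq_one)+
  then show thesis using that s i by blast
qed

text \<open>Equal norms on both sides of a wall make \<open>l i\<close> times the balance expression
  vanish; nonzero coefficients allow the division.\<close>

lemma norm_signed_sum_eq_imp_balanced:
  fixes z :: "'n::finite \<Rightarrow> 'a::euclidean_space"
  assumes nz: "\<And>i. z i \<noteq> 0" and l: "\<And>i. l i \<noteq> 0"
    and eq: "\<And>p q. generic z UNIV p \<Longrightarrow> generic z UNIV q \<Longrightarrow>
      norm (signed_sum z UNIV l p) = norm (signed_sum z UNIV l q)"
  shows "balanced z l"
  unfolding balanced_def
proof (intro allI impI)
  fix i x assume x: "z i \<bullet> x = 0" "\<forall>j. j \<noteq> i \<longrightarrow> z j \<bullet> x \<noteq> 0"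
  obtain p q where pq: "\<And>j. z j \<bullet> p \<noteq> 0" "\<And>j. z j \<bullet> q \<noteq> 0"
    "\<And>j. j \<noteq> i \<Longrightarrow> sgn (z j \<bullet> p) = sgn (z j \<bullet> x)" "\<And>j. j \<noteq> i \<Longrightarrow> sgn (z j \<bullet> q) = sgn (z j \<bullet> x)"
    "sgn (z i \<bullet> p) = 1" "sgn (z i \<bullet> q) = -1"
    using exists_wall_neighbours[of z i x] nz x by blast
  have "norm (signed_sum z UNIV l p) = norm (signed_sum z UNIV l q)"
    using pq by (intro eq) (auto simp: generic_def)
  then have "4 * (l i * sgn (z i \<bullet> p)) * (z i \<bullet> signed_sum z UNIV l x) = 0"
    using signed_sums_across_wall(3)[of z i x p q l] pq x by simp
  then show "z i \<bullet> signed_sum z UNIV l x = 0" using l pq by simp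
qed

section \<open>Orthogonal complements and dimensions of hyperplanes\<close>

lemma hyperplane_eq_orthogonal_comp: "hyperplane v = orthogonal_comp {v}"
  by (auto simp: hyperplane_def orthogonal_comp_def orthogonal_def)

lemma orthogonal_comp_span: "orthogonal_comp (span S) = orthogonal_comp S"
proof
  show "orthogonal_comp (span S) \<subseteq> orthogonal_comp S"
    by (rule orthogonal_comp_anti_mono[OF span_superset])
  show "orthogonal_comp S \<subseteq> orthogonal_comp (span S)"
  proof
    fix x assume "x \<in> orthogonal_comp S"
    then have "orthogonal x y" if "y \<in> span S" for y
      using orthogonal_to_span[OF that] by (auto simp: orthogonal_comp_def orthogonal_commute)
    then show "x \<in> orthogonal_comp (span S)" by (auto simp: orthogonal_comp_def orthogonal_commute)
  qed
qed

lemma orthogonal_comp_hyperplane: "orthogonal_comp (hyperplane v) = span {v}"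
  by (metis hyperplane_eq_orthogonal_comp orthogonal_comp_self orthogonal_comp_span subspace_span)

lemma subspace_central_hyperplane: "subspace (hyperplane v)"
  by (simp add: hyperplane_eq_orthogonal_comp subspace_orthogonal_comp)

lemma dim_orthogonal_comp:
  fixes S :: "'a::euclidean_space set"
  assumes "subspace S"
  shows "dim (orthogonal_comp S) + dim S = DIM('a)"
proof -
  have "dim {y \<in> UNIV. \<forall>x\<in>S. orthogonal x y} + dim S = dim (UNIV :: 'a set)"
    using assms by (intro dim_subspace_orthogonal_to_vectors) auto
  then show ?thesis by (simp add: orthogonal_comp_def)
qed

lemma hyperplane_eq_scaleR:
  assumes "z \<noteq> 0" "hyperplane z \<subseteq> hyperplane w"
  obtains c where "w = c *\<^sub>R z"
proof -
  have "w \<in> orthogonal_comp (hyperplane z)"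
    using assms(2) by (auto simp: hyperplane_def orthogonal_comp_def orthogonal_def inner_commute)
  then show thesis using that by (auto simp: orthogonal_comp_hyperplane span_singleton)
qed

lemma dim_hyperplane_Int:
  fixes v w :: "'a::euclidean_space"
  assumes "v \<noteq> 0" "w \<noteq> 0" "hyperplane v \<noteq> hyperplane w"
  shows "dim (hyperplane v \<inter> hyperplane w) + 2 = DIM('a)"
proof -
  have "v \<notin> span {w}"
  proof
    assume "v \<in> span {w}"
    then obtain c where "v = c *\<^sub>R w" by (auto simp: span_singleton)
    with assms show False by (auto simp: hyperplane_scale)
  qed
  then have "independent {v, w}" "v \<noteq> w"
    using assms by (auto simp: independent_insert span_base)
  then have "dim (span {v, w}) = 2" by (simp add: dim_eq_card_independent)
  moreover have "orthogonal_comp (span {v, w}) = hyperplane v \<inter> hyperplane w"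
    unfolding orthogonal_comp_span by (auto simp: hyperplane_def orthogonal_comp_def orthogonal_def)
  ultimately show ?thesis
    using dim_orthogonal_comp[of "span {v, w}"] by simp
qed

section \<open>Vertices and circumcentres of virtual zonotopes\<close>

text \<open>The cone of a generic point contains a short step from \<open>p\<close> along
  \<open>v - w\<close>, where the two functionals would differ. This is the uniqueness behind the
  definite description in \<open>region_vertex\<close>.\<close>

lemma sign_cone_inner_eqD:
  fixes z :: "'n::finite \<Rightarrow> 'a::euclidean_space"
  assumes p: "\<And>j. z j \<bullet> p \<noteq> 0" and eq: "\<forall>x\<in>sign_cone z UNIV p. v \<bullet> x = w \<bullet> x"
  shows "v = w"
proof -
  obtain e where e: "e > 0" "\<And>k t. z k \<bullet> p \<noteq> 0 \<Longrightarrow> \<bar>t\<bar> \<le> e \<Longrightarrow>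
      sgn (z k \<bullet> (p + t *\<^sub>R (v - w))) = sgn (z k \<bullet> p)"
    using sgn_inner_perturb_UNIV[where u=z and x=p and y="v - w"] by metis
  have "sign_cone z UNIV (p + e *\<^sub>R (v - w)) = sign_cone z UNIV p"
    by (rule sign_cone_cong) (use e p in auto)
  then have "p + e *\<^sub>R (v - w) \<in> sign_cone z UNIV p" using self_in_sign_cone by blast
  then have "v \<bullet> (p + e *\<^sub>R (v - w)) = w \<bullet> (p + e *\<^sub>R (v - w))" "v \<bullet> p = w \<bullet> p"
    using eq self_in_sign_cone by blast+
  then have "e * ((v - w) \<bullet> (v - w)) = 0"
    by (simp add: inner_add_right inner_diff_left inner_diff_right algebra_simps)
  then show "v = w" using e(1) by simp
qed

lemma virtual_zonotope_sign_cone: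
  "x \<in> sign_cone z UNIV p \<Longrightarrow> virtual_zonotope z l x = signed_sum z UNIV (($) l) p \<bullet> x"
  by (simp add: virtual_zonotope_def inner_commute[of "signed_sum _ _ _ _"] inner_signed_sum_sign_cone)

lemma region_vertex_virtual_zonotope:
  fixes z :: "'n::finite \<Rightarrow> 'a::euclidean_space"
  assumes "\<And>j. z j \<bullet> p \<noteq> 0"
  shows "region_vertex (\<lambda>x. virtual_zonotope z l x + a \<bullet> x) (sign_cone z UNIV p) =
    signed_sum z UNIV (($) l) p + a"
  unfolding region_vertex_def
proof (rule the_equality)
  fix v assume "\<forall>x\<in>sign_cone z UNIV p. virtual_zonotope z l x + a \<bullet> x = v \<bullet> x"
  then have "\<forall>x\<in>sign_cone z UNIV p. v \<bullet> x = (signed_sum z UNIV (($) l) p + a) \<bullet> x"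
    by (simp add: virtual_zonotope_sign_cone inner_add_left)
  then show "v = signed_sum z UNIV (($) l) p + a" using sign_cone_inner_eqD[of z p] assms by blast
qed (simp add: virtual_zonotope_sign_cone inner_add_left)

text \<open>Compare the distances from \<open>c\<close> to \<open>v\<close> and to its reflection in
  \<open>a\<close>: the difference of the squares gives the orthogonality, and their sum gives the
  norm.\<close>

lemma inner_center_of_symmetric:
  assumes "V \<subseteq> sphere c r" "\<And>v. v \<in> V \<Longrightarrow> 2 *\<^sub>R a - v \<in> V" "v \<in> V"
  shows "(c - a) \<bullet> (v - a) = 0" "(norm (v - a))\<^sup>2 = r\<^sup>2 - (norm (c - a))\<^sup>2"
proof -
  have "dist c v = r" "dist c (2 *\<^sub>R a - v) = r"
    using assms(1) assms(2)[OF assms(3)] assms(3) by auto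
  moreover have "dist c v = norm ((c - a) - (v - a))" by (simp add: dist_norm)
  moreover have "dist c (2 *\<^sub>R a - v) = norm ((c - a) + (v - a))"
    by (simp add: dist_norm scaleR_2 algebra_simps)
  ultimately have "(norm ((c - a) - (v - a)))\<^sup>2 = r\<^sup>2" "(norm ((c - a) + (v - a)))\<^sup>2 = r\<^sup>2"
    by metis+
  moreover have exp: "(norm (x - y))\<^sup>2 = (norm x)\<^sup>2 - 2 * (x \<bullet> y) + (norm y)\<^sup>2"
    "(norm (x + y))\<^sup>2 = (norm x)\<^sup>2 + 2 * (x \<bullet> y) + (norm y)\<^sup>2" for x y :: 'a
    by (simp_all add: power2_norm_eq_inner inner_diff_left inner_diff_right inner_add_left inner_add_right inner_commute)
  ultimately show "(c - a) \<bullet> (v - a) = 0" "(norm (v - a))\<^sup>2 = r\<^sup>2 - (norm (c - a))\<^sup>2"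
    unfolding exp by linarith+
qed

text \<open>Any centre is displaced from \<open>a\<close> orthogonally to the affine hull of
  \<open>V\<close>, so \<open>a\<close> is the only centre inside that hull.\<close>

lemma circumcenter_symmetric:
  fixes V :: "'a::euclidean_space set"
  assumes sph: "on_common_sphere V" and sym: "\<And>v. v \<in> V \<Longrightarrow> 2 *\<^sub>R a - v \<in> V" and ne: "V \<noteq> {}"
  shows "circumcenter V = a"
  unfolding circumcenter_def
proof (rule the_equality)
  obtain c r where cr: "V \<subseteq> sphere c r" using sph by (auto simp: on_common_sphere_def)
  obtain v where v: "v \<in> V" using ne by auto
  have "(1/2) *\<^sub>R v + (1/2) *\<^sub>R (2 *\<^sub>R a - v) \<in> affine hull V"
    by (rule mem_affine[OF affine_affine_hull]) (auto simp: v sym hull_inc)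
  then have "a \<in> affine hull V" by (simp add: scaleR_diff_right)
  moreover have "V \<subseteq> sphere a (norm (v - a))"
  proof
    fix u assume "u \<in> V"
    then have "(norm (u - a))\<^sup>2 = (norm (v - a))\<^sup>2" using inner_center_of_symmetric(2)[OF cr sym] v by simp
    then show "u \<in> sphere a (norm (v - a))" by (simp add: dist_norm norm_minus_commute)
  qed
  ultimately show "a \<in> affine hull V \<and> (\<exists>r. V \<subseteq> sphere a r)" by blast
  fix d assume d: "d \<in> affine hull V \<and> (\<exists>r. V \<subseteq> sphere d r)"
  then obtain s where s: "V \<subseteq> sphere d s" by blast
  have "V \<subseteq> {x. (d - a) \<bullet> x = (d - a) \<bullet> a}"
    using inner_center_of_symmetric(1)[OF s sym] by (auto simp: inner_diff_right)
  then have "affine hull V \<subseteq> {x. (d - a) \<bullet> x = (d - a) \<bullet> a}" by (intro hull_minimal affine_hyperplane)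
  then have "(d - a) \<bullet> d = (d - a) \<bullet> a" using d by blast
  then have "(d - a) \<bullet> (d - a) = 0" by (simp add: inner_diff_right)
  then show "d = a" by simp
qed

text \<open>\<open>x\<close> is relatively interior to the common wall:
  \<open>x + t *\<^sub>R y\<close> stays in both cones for \<open>y\<close> in the hyperplane and
  small \<open>t\<close>, so \<open>y\<close> is a multiple of a difference of wall points.\<close>

lemma span_wall:
  fixes z :: "'n::finite \<Rightarrow> 'a::euclidean_space"
  assumes x: "z i \<bullet> x = 0" "\<And>j. j \<noteq> i \<Longrightarrow> z j \<bullet> x \<noteq> 0"
    and p: "\<And>j. j \<noteq> i \<Longrightarrow> sgn (z j \<bullet> p) = sgn (z j \<bullet> x)"
    and q: "\<And>j. j \<noteq> i \<Longrightarrow> sgn (z j \<bullet> q) = sgn (z j \<bullet> x)"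
    and pq: "sgn (z i \<bullet> q) = - sgn (z i \<bullet> p)"
  shows "span (sign_cone z UNIV p \<inter> sign_cone z UNIV q) = hyperplane (z i)"
proof
  have "sign_cone z UNIV p \<inter> sign_cone z UNIV q \<subseteq> hyperplane (z i)"
  proof
    fix y assume "y \<in> sign_cone z UNIV p \<inter> sign_cone z UNIV q"
    then have "sgn (z i \<bullet> p) * (z i \<bullet> y) = \<bar>z i \<bullet> y\<bar>" "sgn (z i \<bullet> q) * (z i \<bullet> y) = \<bar>z i \<bullet> y\<bar>"
      by (auto simp: in_sign_cone_iff_abs)
    then have "z i \<bullet> y = 0" by (simp add: pq)
    then show "y \<in> hyperplane (z i)" by (simp add: hyperplane_def)
  qed
  then show "span (sign_cone z UNIV p \<inter> sign_cone z UNIV q) \<subseteq> hyperplane (z i)"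
    by (rule span_minimal[OF _ subspace_central_hyperplane])
  show "hyperplane (z i) \<subseteq> span (sign_cone z UNIV p \<inter> sign_cone z UNIV q)"
  proof
    fix y assume "y \<in> hyperplane (z i)"
    then have y: "z i \<bullet> y = 0" by (simp add: hyperplane_def)
    obtain e where e: "e > 0" "\<And>k t. z k \<bullet> x \<noteq> 0 \<Longrightarrow> \<bar>t\<bar> \<le> e \<Longrightarrow>
        sgn (z k \<bullet> (x + t *\<^sub>R y)) = sgn (z k \<bullet> x)"
      using sgn_inner_perturb_UNIV[where u=z and x=x and y=y] by metis
    have mem: "x + t *\<^sub>R y \<in> sign_cone z UNIV p \<inter> sign_cone z UNIV q" if "\<bar>t\<bar> \<le> e" for t
    proof -
      have "sgn (z j \<bullet> p) * (z j \<bullet> (x + t *\<^sub>R y)) = \<bar>z j \<bullet> (x + t *\<^sub>R y)\<bar> \<and>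
            sgn (z j \<bullet> q) * (z j \<bullet> (x + t *\<^sub>R y)) = \<bar>z j \<bullet> (x + t *\<^sub>R y)\<bar>" for j
      proof (cases "j = i")
        case True
        then show ?thesis using x(1) y by (simp add: inner_add_right)
      next
        case False
        then have "sgn (z j \<bullet> p) = sgn (z j \<bullet> (x + t *\<^sub>R y))" "sgn (z j \<bullet> q) = sgn (z j \<bullet> (x + t *\<^sub>R y))"
          using e(2)[OF x(2) that] p q by simp_all
        then show ?thesis by (simp only: abs_sgn mult.commute)
      qed
      then show ?thesis by (simp add: in_sign_cone_iff_abs)
    qed
    have "(1 / e) *\<^sub>R ((x + e *\<^sub>R y) - (x + 0 *\<^sub>R y)) \<in> span (sign_cone z UNIV p \<inter> sign_cone z UNIV q)"
      using e(1) by (intro span_scale span_diff span_base mem) auto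
    then show "y \<in> span (sign_cone z UNIV p \<inter> sign_cone z UNIV q)" using e(1) by simp
  qed
qed

text \<open>The summand \<open>a \<bullet> x\<close> is carried because membership of a class in the
  inscribed space provides only some inscribed representative. It shifts the vertices and the
  circumcentre alike by \<open>a\<close> and so cancels in the midpoint condition.\<close>

lemma inscribed_virtual_iff_balanced:
  fixes z :: "'n::finite \<Rightarrow> 'a::euclidean_space"
  assumes nz: "\<And>i. z i \<noteq> 0" and dist: "inj (\<lambda>i. hyperplane (z i))"
  shows "inscribed_virtual (arrangement z) (\<lambda>x. virtual_zonotope z l x + a \<bullet> x) \<longleftrightarrow> balanced z (($) l)"
proof -
  let ?f = "\<lambda>x. virtual_zonotope z l x + a \<bullet> x" and ?s = "signed_sum z UNIV (($) l)" and ?C = "sign_cone z UNIV"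
  let ?V = "virtual_vertices (arrangement z) ?f"
  have g: "generic z UNIV p \<longleftrightarrow> (\<forall>j. z j \<bullet> p \<noteq> 0)" for p using nz by (simp add: generic_def)
  have reg: "regions (arrangement z) = ?C ` {p. \<forall>j. z j \<bullet> p \<noteq> 0}"
    using regions_arrangement[of z] nz by (simp add: g)
  have rv: "region_vertex ?f (?C p) = ?s p + a" if "\<forall>j. z j \<bullet> p \<noteq> 0" for p
    using region_vertex_virtual_zonotope[of z p l a] that by blast
  have V: "?V = (\<lambda>p. ?s p + a) ` {p. \<forall>j. z j \<bullet> p \<noteq> 0}"
    unfolding virtual_vertices_def reg image_image using rv by (intro image_cong) auto
  have mid: "(1/2) *\<^sub>R ((u + a) + (v + a)) - a = (1/2) *\<^sub>R (u + v)" for u v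
  proof -
    have "(u + a) + (v + a) = (u + v) + 2 *\<^sub>R a" by (simp add: scaleR_2)
    moreover have "(1/2) *\<^sub>R ((u + v) + 2 *\<^sub>R a) = (1/2) *\<^sub>R (u + v) + a"
      by (subst scaleR_add_right) simp
    ultimately show ?thesis by (metis add_diff_cancel_right')
  qed
  have sym: "2 *\<^sub>R a - v \<in> ?V" if v: "v \<in> ?V" for v
  proof -
    obtain p where "v = ?s p + a" "\<forall>j. z j \<bullet> p \<noteq> 0" using v V by auto
    then have "2 *\<^sub>R a - v = ?s (- p) + a" "\<forall>j. z j \<bullet> - p \<noteq> 0"
      by (simp_all add: signed_sum_uminus scaleR_2)
    then show ?thesis unfolding V by blast
  qed
  obtain p0 where "generic z UNIV p0" using exists_generic_refining[of UNIV z 0] by auto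
  then have p0: "\<forall>j. z j \<bullet> p0 \<noteq> 0" by (simp add: g)
  then have ne: "?V \<noteq> {}" unfolding V by auto
  have vp: "virtual_polytope (arrangement z) ?f"
    unfolding virtual_polytope_def
  proof
    show "continuous_on UNIV ?f"
      unfolding virtual_zonotope_def by (intro continuous_intros)
    show "\<forall>R\<in>regions (arrangement z). \<exists>v. \<forall>x\<in>R. ?f x = v \<bullet> x"
    proof
      fix R assume "R \<in> regions (arrangement z)"
      then obtain p where "R = ?C p" unfolding reg by blast
      then have "\<forall>x\<in>R. ?f x = (?s p + a) \<bullet> x"
        by (simp add: virtual_zonotope_sign_cone inner_add_left)
      then show "\<exists>v. \<forall>x\<in>R. ?f x = v \<bullet> x" ..
    qed
  qed
  show ?thesis
  proof
    assume ins: "inscribed_virtual (arrangement z) ?f"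
    have cc: "circumcenter ?V = a"
      using ins sym ne by (intro circumcenter_symmetric) (auto simp: inscribed_virtual_def)
    show "balanced z (($) l)"
      unfolding balanced_def
    proof (intro allI impI)
      fix i x assume x: "z i \<bullet> x = 0" "\<forall>j. j \<noteq> i \<longrightarrow> z j \<bullet> x \<noteq> 0"
      obtain p q where pq: "\<And>j. z j \<bullet> p \<noteq> 0" "\<And>j. z j \<bullet> q \<noteq> 0"
        "\<And>j. j \<noteq> i \<Longrightarrow> sgn (z j \<bullet> p) = sgn (z j \<bullet> x)" "\<And>j. j \<noteq> i \<Longrightarrow> sgn (z j \<bullet> q) = sgn (z j \<bullet> x)"
        "sgn (z i \<bullet> p) = 1" "sgn (z i \<bullet> q) = -1"
        using exists_wall_neighbours[of z i x] nz x by blast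
      have sp: "span (?C p \<inter> ?C q) = hyperplane (z i)"
        using span_wall[of z i x p q] x pq by simp
      have "dim (hyperplane (z i)) + dim (span {z i}) = DIM('a)"
        using dim_orthogonal_comp[of "span {z i}"]
        by (simp only: orthogonal_comp_span hyperplane_eq_orthogonal_comp subspace_span)
      then have "dim (hyperplane (z i)) + 1 = DIM('a)" using nz by simp
      then have dim: "dim (?C p \<inter> ?C q) + 1 = DIM('a)" using sp by (metis dim_span)
      have "?C p \<in> regions (arrangement z)" "?C q \<in> regions (arrangement z)"
        using pq unfolding reg by blast+
      moreover have "z i \<in> orthogonal_comp (span (?C p \<inter> ?C q))"
        unfolding sp orthogonal_comp_hyperplane by (simp add: span_base)
      ultimately have "z i \<bullet> ((1/2) *\<^sub>R (region_vertex ?f (?C p) + region_vertex ?f (?C q)) - circumcenter ?V) = 0"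
        using ins dim nz unfolding inscribed_virtual_def by blast
      then have "z i \<bullet> ((1/2) *\<^sub>R (?s p + ?s q)) = 0"
        using cc rv pq mid[of "?s p" "?s q"] by simp
      then show "z i \<bullet> ?s x = 0"
        using signed_sums_across_wall(1)[of z i x p q "($) l"] pq x by simp
    qed
  next
    assume bal: "balanced z (($) l)"
    have sph: "on_common_sphere ?V"
      unfolding on_common_sphere_def
    proof (intro exI subsetI)
      fix v assume "v \<in> ?V"
      then obtain p where p: "v = ?s p + a" "\<forall>j. z j \<bullet> p \<noteq> 0" unfolding V by blast
      then have "norm (v - a) = norm (?s p0)"
        using balanced_norm_signed_sum_eq[OF dist bal, of p p0] p0 by simp
      then show "v \<in> sphere a (norm (?s p0))" by (simp add: dist_norm norm_minus_commute)
    qed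
    have cc: "circumcenter ?V = a" by (rule circumcenter_symmetric[OF sph sym ne])
    have adj: "\<alpha> \<bullet> ((1/2) *\<^sub>R (?s p + ?s q)) = 0"
      if p: "\<And>j. z j \<bullet> p \<noteq> 0" and q: "\<And>j. z j \<bullet> q \<noteq> 0" and dim: "dim (?C p \<inter> ?C q) + 1 = DIM('a)"
        and \<alpha>: "\<alpha> \<noteq> 0" "\<alpha> \<in> orthogonal_comp (span (?C p \<inter> ?C q))" for p q \<alpha>
    proof -
      define D where "D = {i. sgn (z i \<bullet> p) \<noteq> sgn (z i \<bullet> q)}"
      have sub: "?C p \<inter> ?C q \<subseteq> hyperplane (z i)" if "i \<in> D" for i
      proof
        fix y assume "y \<in> ?C p \<inter> ?C q"
        then have "sgn (z i \<bullet> p) * (z i \<bullet> y) = \<bar>z i \<bullet> y\<bar>" "sgn (z i \<bullet> q) * (z i \<bullet> y) = \<bar>z i \<bullet> y\<bar>"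
          by (auto simp: in_sign_cone_iff_abs)
        then have "(sgn (z i \<bullet> p) - sgn (z i \<bullet> q)) * (z i \<bullet> y) = 0" by (simp add: left_diff_distrib)
        then show "y \<in> hyperplane (z i)" using that by (simp add: hyperplane_def D_def)
      qed
      \<comment> \<open>Only a single separating index is possible: with none, the two cones
        coincide and nothing but 0 is orthogonal to them; with two, the intersection has codimension
        at least 2.\<close>
      consider "D = {}" | i where "D = {i}" | i j where "i \<in> D" "j \<in> D" "i \<noteq> j" by blast
      then show ?thesis
      proof cases
        case 1
        then have "?C q = ?C p" by (intro sign_cone_cong) (auto simp: D_def)
        then have "\<forall>x\<in>?C p. \<alpha> \<bullet> x = 0 \<bullet> x"
          using \<alpha>(2) by (auto simp: orthogonal_comp_span) (auto simp: orthogonal_comp_def orthogonal_def inner_commute)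
        then have "\<alpha> = 0" by (rule sign_cone_inner_eqD[OF p])
        then show ?thesis by simp
      next
        case (2 i)
        then have i: "sgn (z i \<bullet> p) \<noteq> sgn (z i \<bullet> q)" "\<And>j. j \<noteq> i \<Longrightarrow> sgn (z j \<bullet> p) = sgn (z j \<bullet> q)"
          by (auto simp: D_def)
        obtain t where t: "z i \<bullet> ((1 - t) *\<^sub>R p + t *\<^sub>R q) = 0"
          "\<And>j. j \<noteq> i \<Longrightarrow> sgn (z j \<bullet> ((1 - t) *\<^sub>R p + t *\<^sub>R q)) = sgn (z j \<bullet> p)"
          "sgn (z i \<bullet> q) = - sgn (z i \<bullet> p)"
          using wall_point_between[of z p q i, OF p q i] by metis
        define x where "x = (1 - t) *\<^sub>R p + t *\<^sub>R q"
        have x: "z i \<bullet> x = 0" "\<And>j. j \<noteq> i \<Longrightarrow> sgn (z j \<bullet> p) = sgn (z j \<bullet> x)"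
          "\<And>j. j \<noteq> i \<Longrightarrow> sgn (z j \<bullet> q) = sgn (z j \<bullet> x)"
          using t i(2) by (simp_all add: x_def)
        have x0: "z j \<bullet> x \<noteq> 0" if "j \<noteq> i" for j
          using x(2)[OF that] p[of j] by (metis sgn_zero_iff)
        have "z i \<bullet> ?s x = 0" using bal x(1) x0 unfolding balanced_def by blast
        moreover have "\<alpha> \<in> span {z i}"
          using \<alpha>(2) span_wall[of z i x p q] x x0 t(3) by (simp add: orthogonal_comp_hyperplane)
        moreover have "?s p + ?s q = 2 *\<^sub>R ?s x"
          using signed_sums_across_wall(1)[of z i x p q] x t(3) by blast
        ultimately show ?thesis by (auto simp: span_singleton)
      next
        case (3 i j)
        have "dim (?C p \<inter> ?C q) \<le> dim (hyperplane (z i) \<inter> hyperplane (z j))"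
          using sub 3 by (intro dim_subset) blast
        moreover have "dim (hyperplane (z i) \<inter> hyperplane (z j)) + 2 = DIM('a)"
          using dist nz 3 by (intro dim_hyperplane_Int) (auto dest: injD)
        ultimately show ?thesis using dim by linarith
      qed
    qed
    show "inscribed_virtual (arrangement z) ?f"
      unfolding inscribed_virtual_def
    proof (intro conjI ballI allI impI vp sph)
      fix R S \<alpha> assume RS: "R \<in> regions (arrangement z)" "S \<in> regions (arrangement z)"
        "dim (R \<inter> S) + 1 = DIM('a)" "\<alpha> \<noteq> 0 \<and> \<alpha> \<in> orthogonal_comp (span (R \<inter> S))"
      obtain p q where pq: "R = ?C p" "S = ?C q" "\<forall>j. z j \<bullet> p \<noteq> 0" "\<forall>j. z j \<bullet> q \<noteq> 0"
        using RS(1,2) unfolding reg by blast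
      then show "\<alpha> \<bullet> ((1/2) *\<^sub>R (region_vertex ?f R + region_vertex ?f S) - circumcenter ?V) = 0"
        using adj[of p q \<alpha>] RS rv cc mid[of "?s p" "?s q"] by simp
    qed
  qed
qed

section \<open>Localisation at flats of codimension two\<close>

text \<open>By dimension. Consequently each index other than \<open>i\<close> belongs to exactly one
  of the codimension-two flats inside \<open>hyperplane (z i)\<close>, which makes the grouping of
  terms by flats consistent.\<close>

lemma subspace_Int_eq_of_codim2:
  fixes z :: "'n \<Rightarrow> 'a::euclidean_space"
  assumes nz: "\<And>i. z i \<noteq> 0" and dist: "inj (\<lambda>i. hyperplane (z i))" and ij: "i \<noteq> j"
    and L: "subspace L" "dim L + 2 = DIM('a)" "L \<subseteq> hyperplane (z i)" "L \<subseteq> hyperplane (z j)"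
  shows "hyperplane (z i) \<inter> hyperplane (z j) = L"
proof -
  have "dim (hyperplane (z i) \<inter> hyperplane (z j)) + 2 = DIM('a)"
    using dist nz ij by (intro dim_hyperplane_Int) (auto dest: injD)
  moreover have "subspace (hyperplane (z i) \<inter> hyperplane (z j))"
    by (intro subspace_inter subspace_central_hyperplane)
  ultimately have "L = hyperplane (z i) \<inter> hyperplane (z j)"
    using L by (intro subspace_dim_equal) auto
  then show ?thesis by simp
qed

section \<open>Angles and orderings in the plane orthogonal to a flat\<close>

text \<open>The list contains the negative of \<open>vs ! a\<close> at position
  \<open>length vs + a\<close>. Its angle differs from \<open>\<theta> a\<close> by a multiple of
  \<open>pi\<close>, and within a single turn this must be \<open>pi\<close> itself;
  \<open>vs ! b\<close> comes before that position.\<close>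

lemma cyclically_ordered_angle_less_pi:
  assumes n: "a < length vs" "b < length vs" "a < b"
    and cart: "\<And>i. i < length (vs @ map uminus vs) \<Longrightarrow> (vs @ map uminus vs) ! i \<noteq> 0 \<and>
      (vs @ map uminus vs) ! i = norm ((vs @ map uminus vs) ! i) *\<^sub>R (cos (\<theta> i) *\<^sub>R e1 + sin (\<theta> i) *\<^sub>R e2)"
    and mono: "\<And>i j. i < j \<Longrightarrow> j < length (vs @ map uminus vs) \<Longrightarrow> \<theta> i < (\<theta> j :: real)"
    and turn: "\<And>i. i < length (vs @ map uminus vs) \<Longrightarrow> \<theta> i < \<theta> 0 + 2 * pi"
    and e: "norm e1 = 1" "norm e2 = 1" "e1 \<bullet> e2 = 0"
  shows "0 < \<theta> b - \<theta> a" "\<theta> b - \<theta> a < pi"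
proof -
  let ?k = "length vs"
  show "0 < \<theta> b - \<theta> a" using mono[of a b] n by simp
  have e': "e1 \<bullet> e1 = 1" "e2 \<bullet> e2 = 1" "e2 \<bullet> e1 = 0"
    using e by (simp_all add: norm_eq_1 inner_commute)
  have A: "vs ! a \<noteq> 0" "vs ! a = norm (vs ! a) *\<^sub>R (cos (\<theta> a) *\<^sub>R e1 + sin (\<theta> a) *\<^sub>R e2)"
    using cart[of a] n by (auto simp: nth_append)
  have B: "- (vs ! a) = norm (vs ! a) *\<^sub>R (cos (\<theta> (?k + a)) *\<^sub>R e1 + sin (\<theta> (?k + a)) *\<^sub>R e2)"
    using cart[of "?k + a"] n by (auto simp: nth_append)
  have "vs ! a \<bullet> e1 = norm (vs ! a) * cos (\<theta> a)" "vs ! a \<bullet> e2 = norm (vs ! a) * sin (\<theta> a)"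
    using e e' by (subst A(2), simp add: inner_add_left)+
  moreover have "- (vs ! a) \<bullet> e1 = norm (vs ! a) * cos (\<theta> (?k + a))"
    "- (vs ! a) \<bullet> e2 = norm (vs ! a) * sin (\<theta> (?k + a))"
    using e e' by (subst B, simp add: inner_add_left)+
  ultimately have "norm (vs ! a) * (cos (\<theta> (?k + a)) + cos (\<theta> a)) = 0"
    "norm (vs ! a) * (sin (\<theta> (?k + a)) + sin (\<theta> a)) = 0"
    by (simp_all add: distrib_left)
  then have "cos (\<theta> (?k + a)) = - cos (\<theta> a)" "sin (\<theta> (?k + a)) = - sin (\<theta> a)"
    using A(1) by (auto simp: eq_neg_iff_add_eq_0)
  then have "sin (\<theta> (?k + a) - \<theta> a) = 0" by (simp add: sin_diff)
  then obtain m :: int where m: "\<theta> (?k + a) - \<theta> a = of_int m * pi"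
    using sin_zero_iff_int2 by blast
  have "\<theta> 0 \<le> \<theta> a" using mono[of 0 a] n by (cases "a = 0") (auto simp: less_imp_le)
  moreover have "\<theta> a < \<theta> (?k + a)" using mono[of a "?k + a"] n by (cases vs) auto
  moreover have "\<theta> (?k + a) < \<theta> 0 + 2 * pi" using turn[of "?k + a"] n by simp
  ultimately have "0 * pi < of_int m * pi" "of_int m * pi < 2 * pi" using m by linarith+
  then have "(0::real) < of_int m" "of_int m < (2::real)"
    using mult_less_cancel_right_pos[OF pi_gt_zero] by blast+
  then have "0 < m" "m < 2" by simp_all
  then have "m = 1" by simp
  then have "\<theta> (?k + a) = \<theta> a + pi" using m by simp
  then show "\<theta> b - \<theta> a < pi" using mono[of b "?k + a"] n by simp
qed

text \<open>The projection of \<open>x\<close> to the plane orthogonal to \<open>L\<close> is a rotation of \<open>z (is ! a)\<close> by a right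
  angle, up to scale, so the sign of \<open>z (is ! b) \<bullet> x\<close> tells whether \<open>b\<close> comes before or after \<open>a\<close>.\<close>

lemma flat_row:
  fixes z :: "'n::finite \<Rightarrow> 'a::euclidean_space"
  assumes ord: "flat_ordering z L is" and a: "a < length is" and L: "subspace L"
    and x: "z (is ! a) \<bullet> x = 0" "x \<notin> L"
  obtains \<rho> where "\<rho> \<noteq> 0"
    "(\<Sum>j\<in>{s. L \<subseteq> hyperplane (z s)}. l j * (sgn (z j \<bullet> x) * (z j \<bullet> z (is ! a)))) =
      \<rho> * (\<Sum>b<length is. skew_gram (map z is) a b * l (is ! b))"
proof -
  let ?vs = "map z is"
  let ?ps = "?vs @ map uminus ?vs"
  have ps: "map z is @ map (\<lambda>s. - z s) is = ?ps" by simp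
  obtain e1 e2 \<theta> where e: "norm e1 = 1" "norm e2 = 1" "e1 \<bullet> e2 = 0" "span {e1, e2} = orthogonal_comp L"
    and cart: "\<And>i. i < length ?ps \<Longrightarrow> ?ps ! i \<noteq> 0 \<and>
      ?ps ! i = norm (?ps ! i) *\<^sub>R (cos (\<theta> i) *\<^sub>R e1 + sin (\<theta> i) *\<^sub>R e2)"
    and mono: "\<And>i j. i < j \<Longrightarrow> j < length ?ps \<Longrightarrow> \<theta> i < \<theta> j"
    and turn: "\<And>i. i < length ?ps \<Longrightarrow> \<theta> i < \<theta> 0 + 2 * pi"
    using ord unfolding flat_ordering_def cyclically_ordered_def ps by blast
  have set: "set is = {s. L \<subseteq> hyperplane (z s)}" and "distinct is"
    using ord by (auto simp: flat_ordering_def)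
  have v: "z (is ! b) \<noteq> 0" "z (is ! b) = norm (z (is ! b)) *\<^sub>R (cos (\<theta> b) *\<^sub>R e1 + sin (\<theta> b) *\<^sub>R e2)"
    if "b < length is" for b
    using cart[of b] that by (auto simp: nth_append)
  \<comment> \<open>The projection of \<open>x\<close> to the plane is perpendicular to
    \<open>z (is ! a)\<close>; \<open>\<rho>\<close> is its coordinate along the unit vector at
    angle \<open>\<theta> a + pi / 2\<close>.\<close>
  define \<rho> where "\<rho> = cos (\<theta> a) * (e2 \<bullet> x) - sin (\<theta> a) * (e1 \<bullet> x)"
  have inner: "z (is ! b) \<bullet> x = norm (z (is ! b)) * (cos (\<theta> b) * (e1 \<bullet> x) + sin (\<theta> b) * (e2 \<bullet> x))"
    if "b < length is" for b
    by (subst v(2)[OF that]) (simp add: inner_add_left)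
  have "cos (\<theta> a) * (e1 \<bullet> x) + sin (\<theta> a) * (e2 \<bullet> x) = 0"
    using inner[OF a] x(1) v(1)[OF a] by simp
  then have eq: "cos (\<theta> a) * (e1 \<bullet> x) = - (sin (\<theta> a) * (e2 \<bullet> x))" by linarith
  have one: "r = (cos (\<theta> a))\<^sup>2 * r + (sin (\<theta> a))\<^sup>2 * r" for r
    by (metis cos_squared_eq distrib_right diff_add_cancel mult_1)
  have X1: "e1 \<bullet> x = - (\<rho> * sin (\<theta> a))"
  proof -
    have "e1 \<bullet> x = cos (\<theta> a) * (cos (\<theta> a) * (e1 \<bullet> x)) + (sin (\<theta> a))\<^sup>2 * (e1 \<bullet> x)"
      using one[of "e1 \<bullet> x"] by (simp add: power2_eq_square mult.assoc)
    also have "\<dots> = - (\<rho> * sin (\<theta> a))"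
      unfolding eq \<rho>_def by (simp add: power2_eq_square algebra_simps)
    finally show ?thesis .
  qed
  have X2: "e2 \<bullet> x = \<rho> * cos (\<theta> a)"
  proof -
    have "e2 \<bullet> x = (cos (\<theta> a))\<^sup>2 * (e2 \<bullet> x) - sin (\<theta> a) * (- (sin (\<theta> a) * (e2 \<bullet> x)))"
      using one[of "e2 \<bullet> x"] by (simp add: power2_eq_square mult.assoc)
    also have "\<dots> = \<rho> * cos (\<theta> a)"
      unfolding eq[symmetric] \<rho>_def by (simp add: power2_eq_square algebra_simps)
    finally show ?thesis .
  qed
  have "\<rho> \<noteq> 0"
  proof
    assume "\<rho> = 0"
    then have "x \<in> orthogonal_comp {e1, e2}"
      using X1 X2 by (auto simp: orthogonal_comp_def orthogonal_def)
    then have "x \<in> orthogonal_comp (orthogonal_comp L)"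
      using e(4) orthogonal_comp_span by metis
    then show False using x(2) orthogonal_comp_self[OF L] by simp
  qed
  define \<sigma> :: "nat \<Rightarrow> real" where "\<sigma> b = (if a < b then 1 else if b < a then -1 else 0)" for b
  have sgn: "sgn (z (is ! b) \<bullet> x) = sgn \<rho> * \<sigma> b" if b: "b < length is" for b
  proof -
    have "z (is ! b) \<bullet> x = norm (z (is ! b)) * (\<rho> * sin (\<theta> b - \<theta> a))"
      unfolding inner[OF b] X1 X2 by (simp add: sin_diff algebra_simps)
    then have "sgn (z (is ! b) \<bullet> x) = sgn \<rho> * sgn (sin (\<theta> b - \<theta> a))"
      using v(1)[OF b] by (simp add: sgn_mult)
    moreover have "sgn (sin (\<theta> b - \<theta> a)) = \<sigma> b"
    proof -
      consider "a < b" | "b < a" | "a = b" by linarith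
      then show ?thesis
      proof cases
        case 1
        then have "0 < sin (\<theta> b - \<theta> a)"
          using cyclically_ordered_angle_less_pi[OF _ _ 1 cart mono turn e(1-3)] a b
          by (intro sin_gt_zero) auto
        then show ?thesis using 1 by (simp add: \<sigma>_def)
      next
        case 2
        then have "0 < sin (\<theta> a - \<theta> b)"
          using cyclically_ordered_angle_less_pi[OF _ _ 2 cart mono turn e(1-3)] a b
          by (intro sin_gt_zero) auto
        moreover have "sin (\<theta> b - \<theta> a) = - sin (\<theta> a - \<theta> b)" by (simp add: sin_diff)
        ultimately show ?thesis using 2 by (simp add: \<sigma>_def)
      qed (simp add: \<sigma>_def)
    qed
    ultimately show ?thesis by simp
  qed
  have skew: "skew_gram ?vs a b = \<sigma> b * (z (is ! b) \<bullet> z (is ! a))" if "b < length is" for b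
    using a that by (simp add: skew_gram_def \<sigma>_def inner_commute)
  have bij: "bij_betw ((!) is) {..<length is} {s. L \<subseteq> hyperplane (z s)}"
    using \<open>distinct is\<close> set by (intro bij_betw_nth) auto
  have "(\<Sum>j\<in>{s. L \<subseteq> hyperplane (z s)}. l j * (sgn (z j \<bullet> x) * (z j \<bullet> z (is ! a)))) =
      (\<Sum>b<length is. l (is ! b) * (sgn (z (is ! b) \<bullet> x) * (z (is ! b) \<bullet> z (is ! a))))"
    by (rule sum.reindex_bij_betw[OF bij, symmetric])
  also have "\<dots> = sgn \<rho> * (\<Sum>b<length is. skew_gram ?vs a b * l (is ! b))"
    unfolding sum_distrib_left by (rule sum.cong) (simp_all add: sgn skew)
  \<comment> \<open>The factor delivered is the sign of this coordinate; it depends on the side of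
    \<open>L\<close> on which \<open>x\<close> lies.\<close>
  finally show thesis using that[of "sgn \<rho>"] \<open>\<rho> \<noteq> 0\<close> by (simp add: sgn_zero_iff)
qed

text \<open>\<open>e1\<close> is the normalised projection of \<open>w\<close> to the plane, so that
  \<open>v \<bullet> e1\<close> has the sign of \<open>w \<bullet> v\<close> for all
  \<open>v\<close> in \<open>W\<close>. The vector \<open>v0\<close> witnesses that the projection
  is nonzero.\<close>

lemma orthonormal_basis_plane:
  fixes W :: "'a::euclidean_space set"
  assumes W: "subspace W" "dim W = 2" and w: "v0 \<in> W" "w \<bullet> v0 \<noteq> 0"
  obtains e1 e2 r where "norm e1 = 1" "norm e2 = 1" "e1 \<bullet> e2 = 0" "span {e1, e2} = W" "r > 0"
    "\<And>v. v \<in> W \<Longrightarrow> v = (v \<bullet> e1) *\<^sub>R e1 + (v \<bullet> e2) *\<^sub>R e2" "\<And>v. v \<in> W \<Longrightarrow> w \<bullet> v = r * (v \<bullet> e1)"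
proof -
  obtain B where B: "B \<subseteq> W" "pairwise orthogonal B" "\<And>x. x \<in> B \<Longrightarrow> norm x = 1"
    "independent B" "card B = dim W" "span B = W"
    using orthonormal_basis_subspace[OF W(1)] by metis
  obtain b1 b2 where b: "B = {b1, b2}" "b1 \<noteq> b2" using B(5) W(2) card_2_iff by metis
  have n: "b1 \<bullet> b1 = 1" "b2 \<bullet> b2 = 1" "b1 \<bullet> b2 = 0" "b2 \<bullet> b1 = 0"
    using B(2,3) b by (auto simp: norm_eq_1 pairwise_def orthogonal_def)
  have exp: "v = (v \<bullet> b1) *\<^sub>R b1 + (v \<bullet> b2) *\<^sub>R b2" if v: "v \<in> W" for v
  proof -
    obtain s where "v - s *\<^sub>R b1 \<in> span {b2}" using v B(6) b by (auto simp: span_insert)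
    then obtain t where "v - s *\<^sub>R b1 = t *\<^sub>R b2" by (auto simp: span_singleton)
    then have "v = s *\<^sub>R b1 + t *\<^sub>R b2" by (simp add: algebra_simps)
    then show ?thesis by (simp add: inner_add_left n)
  qed
  \<comment> \<open>Coordinates and length of the projection of \<open>w\<close>; the basis
    \<open>b1\<close>, \<open>b2\<close> is then rotated so that its first vector points along
    it.\<close>
  define p q r where pqr: "p = w \<bullet> b1" "q = w \<bullet> b2" "r = sqrt ((w \<bullet> b1)\<^sup>2 + (w \<bullet> b2)\<^sup>2)"
  have "p \<noteq> 0 \<or> q \<noteq> 0"
  proof (rule ccontr)
    assume "\<not> (p \<noteq> 0 \<or> q \<noteq> 0)"
    then have "w \<bullet> ((v0 \<bullet> b1) *\<^sub>R b1 + (v0 \<bullet> b2) *\<^sub>R b2) = 0" by (simp add: pqr inner_add_right)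
    then show False using exp[OF w(1)] w(2) by simp
  qed
  then have r: "r > 0" "r\<^sup>2 = p\<^sup>2 + q\<^sup>2" by (auto simp: pqr sum_power2_gt_zero_iff)
  define c s where cs: "c = p / r" "s = q / r"
  have c1: "c * c + s * s = 1"
  proof -
    have "c * c + s * s = (p\<^sup>2 + q\<^sup>2) / r\<^sup>2"
      by (simp add: cs power2_eq_square add_divide_distrib)
    then show ?thesis using r(1) unfolding r(2)[symmetric] by simp
  qed
  define e1 e2 where e12: "e1 = c *\<^sub>R b1 + s *\<^sub>R b2" "e2 = (- s) *\<^sub>R b1 + c *\<^sub>R b2"
  have e: "e1 \<bullet> e1 = 1" "e2 \<bullet> e2 = 1" "e1 \<bullet> e2 = 0"
    using c1 by (simp_all add: e12 inner_add_left inner_add_right n algebra_simps)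
  have b1: "b1 = c *\<^sub>R e1 - s *\<^sub>R e2"
  proof -
    have "c *\<^sub>R e1 - s *\<^sub>R e2 = (c * c + s * s) *\<^sub>R b1" by (simp add: e12 algebra_simps)
    then show ?thesis using c1 by simp
  qed
  have b2: "b2 = s *\<^sub>R e1 + c *\<^sub>R e2"
  proof -
    have "s *\<^sub>R e1 + c *\<^sub>R e2 = (c * c + s * s) *\<^sub>R b2" by (simp add: e12 algebra_simps)
    then show ?thesis using c1 by simp
  qed
  show thesis
  proof
    show "norm e1 = 1" "norm e2 = 1" "e1 \<bullet> e2 = 0" "r > 0" using e r by (auto simp: norm_eq_1)
    show "span {e1, e2} = W"
    proof
      have "e1 \<in> W" "e2 \<in> W"
        unfolding e12 using B(1) b W(1) by (auto intro!: subspace_add subspace_scale subspace_diff)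
      then show "span {e1, e2} \<subseteq> W" using W(1) by (intro span_minimal) auto
      have "b1 \<in> span {e1, e2}" "b2 \<in> span {e1, e2}"
        by (subst b1, intro span_diff span_scale span_base, simp_all)
           (subst b2, intro span_add span_scale span_base, simp_all)
      then have "span {b1, b2} \<subseteq> span {e1, e2}" by (intro span_minimal) auto
      then show "W \<subseteq> span {e1, e2}" using B(6) b by simp
    qed
    fix v assume v: "v \<in> W"
    have ve: "v \<bullet> e1 = c * (v \<bullet> b1) + s * (v \<bullet> b2)" "v \<bullet> e2 = c * (v \<bullet> b2) - s * (v \<bullet> b1)"
      by (simp_all add: e12 inner_add_right inner_diff_right)
    have "(v \<bullet> e1) *\<^sub>R e1 + (v \<bullet> e2) *\<^sub>R e2 =
        ((c * c + s * s) * (v \<bullet> b1)) *\<^sub>R b1 + ((c * c + s * s) * (v \<bullet> b2)) *\<^sub>R b2"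
      unfolding ve unfolding e12 by (simp add: algebra_simps)
    then show "v = (v \<bullet> e1) *\<^sub>R e1 + (v \<bullet> e2) *\<^sub>R e2" using c1 exp[OF v] by simp
    have "w \<bullet> v = w \<bullet> ((v \<bullet> b1) *\<^sub>R b1 + (v \<bullet> b2) *\<^sub>R b2)" using exp[OF v] by simp
    also have "\<dots> = r * (c * (v \<bullet> b1) + s * (v \<bullet> b2))"
      using r by (simp add: inner_add_right cs pqr algebra_simps)
    finally show "w \<bullet> v = r * (v \<bullet> e1)" by (simp add: ve)
  qed
qed

text \<open>Measured from the projection of \<open>w\<close>, the vectors at \<open>L\<close> have
  angles strictly between \<open>- pi / 2\<close> and \<open>pi / 2\<close>, pairwise different
  because the hyperplanes are distinct. Sorting by angle gives the order.\<close>

lemma exists_flat_ordering: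
  fixes z :: "'n::finite \<Rightarrow> 'a::euclidean_space"
  assumes dist: "inj (\<lambda>i. hyperplane (z i))" and w: "\<And>i. w \<bullet> z i > 0"
    and L: "subspace L" "dim L + 2 = DIM('a)" and i: "L \<subseteq> hyperplane (z i)"
  shows "\<exists>is. flat_ordering z L is"
proof -
  let ?W = "orthogonal_comp L" and ?S = "{s. L \<subseteq> hyperplane (z s)}"
  have zW: "z s \<in> ?W" if "s \<in> ?S" for s
    using that by (auto simp: orthogonal_comp_def orthogonal_def hyperplane_def inner_commute)
  have "dim ?W = 2" using dim_orthogonal_comp[OF L(1)] L(2) by simp
  then obtain e1 e2 r where e: "norm e1 = 1" "norm e2 = 1" "e1 \<bullet> e2 = 0" "span {e1, e2} = ?W" "r > 0"
    "\<And>v. v \<in> ?W \<Longrightarrow> v = (v \<bullet> e1) *\<^sub>R e1 + (v \<bullet> e2) *\<^sub>R e2" "\<And>v. v \<in> ?W \<Longrightarrow> w \<bullet> v = r * (v \<bullet> e1)"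
    using orthonormal_basis_plane[of ?W "z i" w] subspace_orthogonal_comp zW[of i] i w[of i]
    by (metis less_irrefl mem_Collect_eq)
  have pos: "z s \<bullet> e1 > 0" if "s \<in> ?S" for s
    using e(7)[OF zW[OF that]] w[of s] e(5) by (simp add: zero_less_mult_iff)
  define \<psi> where "\<psi> s = arctan ((z s \<bullet> e2) / (z s \<bullet> e1))" for s
  have \<psi>: "- (pi / 2) < \<psi> s" "\<psi> s < pi / 2" for s
    unfolding \<psi>_def by (rule arctan_lbound arctan_ubound)+
  have polar: "z s = norm (z s) *\<^sub>R (cos (\<psi> s) *\<^sub>R e1 + sin (\<psi> s) *\<^sub>R e2)" if s: "s \<in> ?S" for s
  proof -
    let ?A = "z s \<bullet> e1" and ?B = "z s \<bullet> e2"
    \<comment> \<open>\<open>N\<close> is the denominator in the formulas for \<open>cos\<close> and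
      \<open>sin\<close> of an arctangent.\<close>
    define N where "N = sqrt (1 + (?B / ?A)\<^sup>2)"
    have N: "N > 0" by (simp add: N_def add_pos_nonneg)
    have ee: "e1 \<bullet> e1 = 1" "e2 \<bullet> e2 = 1" "e2 \<bullet> e1 = 0" using e by (simp_all add: norm_eq_1 inner_commute)
    have "(norm (z s))\<^sup>2 = ?A\<^sup>2 + ?B\<^sup>2"
      unfolding power2_norm_eq_inner
      by (subst (1 2) e(6)[OF zW[OF s]])
         (simp add: inner_add_left inner_add_right ee e(3) power2_eq_square)
    also have "\<dots> = (?A * N)\<^sup>2"
      using pos[OF s] by (simp add: N_def power_mult_distrib real_sqrt_pow2 add_nonneg_nonneg power_divide field_simps)
    finally have "norm (z s) = ?A * N"
      using pos[OF s] N by (simp add: power2_eq_iff_nonneg)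
    then have "norm (z s) * cos (\<psi> s) = ?A" "norm (z s) * sin (\<psi> s) = ?B"
      using N pos[OF s] by (simp_all add: \<psi>_def cos_arctan sin_arctan flip: N_def)
    then show ?thesis using e(6)[OF zW[OF s]] by (simp add: scaleR_add_right)
  qed
  have inj: "s = t" if st: "s \<in> ?S" "t \<in> ?S" "\<psi> s = \<psi> t" for s t
  proof -
    let ?u = "cos (\<psi> s) *\<^sub>R e1 + sin (\<psi> s) *\<^sub>R e2"
    have "z s = norm (z s) *\<^sub>R ?u" "z t = norm (z t) *\<^sub>R ?u"
      using polar[OF st(1)] polar[OF st(2)] unfolding st(3) by this+
    moreover have "norm (z s) \<noteq> 0" "norm (z t) \<noteq> 0" using w[of s] w[of t] by auto
    ultimately have "hyperplane (z s) = hyperplane ?u" "hyperplane (z t) = hyperplane ?u"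
      using hyperplane_scale by metis+
    then show ?thesis using dist by (metis injD)
  qed
  obtain xs where xs: "set xs = ?S" "distinct xs" using finite_distinct_list[of ?S] by auto
  define is' where "is' = sort_key \<psi> xs"
  have is': "set is' = ?S" "distinct is'" "sorted (map \<psi> is')" using xs by (simp_all add: is'_def)
  let ?k = "length is'"
  have inS: "is' ! a \<in> ?S" if "a < ?k" for a using is'(1) that nth_mem by blast
  have strict: "\<psi> (is' ! a) < \<psi> (is' ! b)" if "a < b" "b < ?k" for a b
  proof -
    have "\<psi> (is' ! a) \<le> \<psi> (is' ! b)" using sorted_nth_mono[OF is'(3), of a b] that by simp
    moreover have "is' ! a \<noteq> is' ! b" using is'(2) that by (simp add: nth_eq_iff_index_eq)
    then have "\<psi> (is' ! a) \<noteq> \<psi> (is' ! b)" using inj inS that by (meson less_trans)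
    ultimately show ?thesis by simp
  qed
  \<comment> \<open>The negatives repeat the angles shifted by \<open>pi\<close>. All of them exceed
    \<open>pi / 2\<close>, so they follow the first block, and all are below
    \<open>3 * pi / 2\<close>, so the turn is not completed.\<close>
  define \<theta> where "\<theta> a = (if a < ?k then \<psi> (is' ! a) else \<psi> (is' ! (a - ?k)) + pi)" for a
  let ?ps = "map z is' @ map (\<lambda>s. - z s) is'"
  have "cyclically_ordered ?W ?ps"
    unfolding cyclically_ordered_def
  proof (rule exI[of _ e1], rule exI[of _ e2], rule exI[of _ \<theta>], intro conjI allI impI e(1-4))
    fix a assume a: "a < length ?ps"
    let ?s = "if a < ?k then is' ! a else is' ! (a - ?k)"
    have s: "?s \<in> ?S" using a inS by auto
    have "z ?s \<noteq> 0" using w[of ?s] by auto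
    then show "?ps ! a \<noteq> 0" using a by (auto simp: nth_append split: if_splits)
    show "?ps ! a = norm (?ps ! a) *\<^sub>R (cos (\<theta> a) *\<^sub>R e1 + sin (\<theta> a) *\<^sub>R e2)"
    proof (cases "a < ?k")
      case True
      then show ?thesis using polar[OF inS[OF True]] by (simp add: nth_append \<theta>_def)
    next
      case False
      then have "a - ?k < ?k" using a by auto
      define t where "t = is' ! (a - ?k)"
      have "?ps ! a = - z t" "\<theta> a = \<psi> t + pi"
        using False \<open>a - ?k < ?k\<close> by (simp_all add: nth_append \<theta>_def t_def)
      moreover have "- z t = norm (- z t) *\<^sub>R (cos (\<psi> t + pi) *\<^sub>R e1 + sin (\<psi> t + pi) *\<^sub>R e2)"
      proof -
        have "norm (- z t) *\<^sub>R (cos (\<psi> t + pi) *\<^sub>R e1 + sin (\<psi> t + pi) *\<^sub>R e2) =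
            - (norm (z t) *\<^sub>R (cos (\<psi> t) *\<^sub>R e1 + sin (\<psi> t) *\<^sub>R e2))"
          by (simp add: algebra_simps)
        then show ?thesis using polar[OF inS[OF \<open>a - ?k < ?k\<close>]] unfolding t_def by simp
      qed
      ultimately show ?thesis by metis
    qed
    show "\<theta> a < \<theta> 0 + 2 * pi"
    proof -
      have "?k > 0" using a by auto
      then have "\<theta> 0 = \<psi> (is' ! 0)" by (simp add: \<theta>_def)
      then show ?thesis using \<psi>[of "is' ! 0"] \<psi>[of "is' ! a"] \<psi>[of "is' ! (a - ?k)"] pi_gt_zero
        unfolding \<theta>_def[of a] by auto
    qed
  next
    fix a b assume ab: "a < b" "b < length ?ps"
    consider "b < ?k" | "a < ?k" "b \<ge> ?k" | "a \<ge> ?k" by linarith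
    then show "\<theta> a < \<theta> b"
    proof cases
      case 1 then show ?thesis using ab strict by (simp add: \<theta>_def)
    next
      case 2 then show ?thesis using \<psi>[of "is' ! a"] \<psi>[of "is' ! (b - ?k)"] by (simp add: \<theta>_def)
    next
      case 3
      then have "\<psi> (is' ! (a - ?k)) < \<psi> (is' ! (b - ?k))" using ab by (intro strict) auto
      then show ?thesis using 3 ab by (simp add: \<theta>_def)
    qed
  qed
  then show ?thesis unfolding flat_ordering_def using is' by blast
qed

lemma codim2_flatsD:
  assumes "L \<in> codim2_flats (arrangement z)"
  shows "subspace L" "dim (L :: 'a::euclidean_space set) + 2 = DIM('a)"
proof -
  obtain B where "L = \<Inter>B" "B \<subseteq> arrangement z" using assms by (auto simp: codim2_flats_def flats_def)
  then show "subspace L"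
    by (auto simp: arrangement_def intro!: subspace_Inter subspace_central_hyperplane)
qed (use assms in \<open>simp add: codim2_flats_def\<close>)

lemma balanced_iff_flat_equations:
  fixes z :: "'n::finite \<Rightarrow> 'a::euclidean_space"
  assumes dist: "inj (\<lambda>i. hyperplane (z i))" and w: "\<And>i. w \<bullet> z i > 0"
  shows "balanced z (($) l) \<longleftrightarrow> (\<forall>L\<in>codim2_flats (arrangement z). flat_equation z L l)"
proof
  have nz: "z i \<noteq> 0" for i using w[of i] by auto
  {
    assume flat: "\<forall>L\<in>codim2_flats (arrangement z). flat_equation z L l"
    show "balanced z (($) l)"
      unfolding balanced_def
    proof (intro allI impI)
      fix i x assume x: "z i \<bullet> x = 0" "\<forall>j. j \<noteq> i \<longrightarrow> z j \<bullet> x \<noteq> 0"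
      define g where "g j = l $ j * (sgn (z j \<bullet> x) * (z j \<bullet> z i))" for j
      \<comment> \<open>\<open>i\<close> belongs to every flat of the grouping; its term vanishes,
        so it may be added to each group without being counted repeatedly.\<close>
      have gi: "g i = 0" using x(1) by (simp add: g_def)
      \<comment> \<open>The terms are grouped by the flat \<open>hyperplane (z i) \<inter> hyperplane (z j)\<close>.\<close>
      have "sum g {j \<in> - {i}. hyperplane (z i) \<inter> hyperplane (z j) = L} = 0"
        if L: "L \<in> (\<lambda>j. hyperplane (z i) \<inter> hyperplane (z j)) ` (- {i})" for L
      proof -
        obtain j where j: "j \<noteq> i" "L = hyperplane (z i) \<inter> hyperplane (z j)" using L by auto
        have dim: "dim L + 2 = DIM('a)"
          unfolding j(2) using dist nz j(1) by (intro dim_hyperplane_Int) (auto dest: injD)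
        have sub: "subspace L" unfolding j(2) by (intro subspace_inter subspace_central_hyperplane)
        have "L = \<Inter>{hyperplane (z i), hyperplane (z j)}"
          "{hyperplane (z i), hyperplane (z j)} \<subseteq> arrangement z"
          using j by (auto simp: arrangement_def)
        then have "L \<in> codim2_flats (arrangement z)"
          unfolding codim2_flats_def flats_def using dim by blast
        then have fe: "flat_equation z L l" using flat by blast
        have iL: "L \<subseteq> hyperplane (z i)" using j by auto
        obtain is' where is': "flat_ordering z L is'"
          using exists_flat_ordering[OF dist w sub dim iL] by blast
        then have "i \<in> set is'" using iL by (simp add: flat_ordering_def)
        then obtain a where a: "a < length is'" "is' ! a = i" by (auto simp: in_set_conv_nth)
        have "x \<notin> L" using x j by (auto simp: hyperplane_def)
        then obtain \<rho> where "sum g {s. L \<subseteq> hyperplane (z s)} =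
            \<rho> * (\<Sum>b<length is'. skew_gram (map z is') a b * l $ (is' ! b))"
          using flat_row[OF is' a(1) sub, of x "($) l"] x(1) unfolding a(2) g_def by blast
        moreover have "(\<Sum>b<length is'. skew_gram (map z is') a b * l $ (is' ! b)) = 0"
          using fe is' a(1) unfolding flat_equation_def by blast
        ultimately have "sum g {s. L \<subseteq> hyperplane (z s)} = 0" by simp
        moreover have "{s. L \<subseteq> hyperplane (z s)} = insert i {j \<in> - {i}. hyperplane (z i) \<inter> hyperplane (z j) = L}"
        proof (intro equalityI subsetI)
          fix s assume "s \<in> {s. L \<subseteq> hyperplane (z s)}"
          then show "s \<in> insert i {j \<in> - {i}. hyperplane (z i) \<inter> hyperplane (z j) = L}"
            using subspace_Int_eq_of_codim2[OF nz dist _ sub dim iL, of s] by auto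
        qed (use iL in auto)
        ultimately show ?thesis using gi by simp
      qed
      then have "sum g (- {i}) = 0"
        by (subst sum.image_gen[where g = "\<lambda>j. hyperplane (z i) \<inter> hyperplane (z j)"]) auto
      then have "sum g UNIV = 0"
        using gi by (subst sum.remove[of _ i]) (auto simp: Compl_eq_Diff_UNIV)
      then show "z i \<bullet> signed_sum z UNIV (($) l) x = 0"
        by (simp add: inner_signed_sum g_def)
    qed
  next
    assume bal: "balanced z (($) l)"
    show "\<forall>L\<in>codim2_flats (arrangement z). flat_equation z L l"
      unfolding flat_equation_def
    proof (intro ballI allI impI)
      fix L is' a assume L: "L \<in> codim2_flats (arrangement z)" and is': "flat_ordering z L is'"
        and a: "a < length is'"
      note sub = codim2_flatsD(1)[OF L] and dim = codim2_flatsD(2)[OF L]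
      define i where "i = is' ! a"
      have iL: "L \<subseteq> hyperplane (z i)"
        using is' a nth_mem unfolding flat_ordering_def i_def by blast
      have "\<not> hyperplane (z i) \<subseteq> L"
      proof
        assume "hyperplane (z i) \<subseteq> L"
        then have "dim (hyperplane (z i)) \<le> dim L" by (rule dim_subset)
        moreover have "dim (hyperplane (z i)) + dim (span {z i}) = DIM('a)"
          using dim_orthogonal_comp[of "span {z i}"]
          by (simp only: orthogonal_comp_span hyperplane_eq_orthogonal_comp subspace_span)
        ultimately show False using dim nz[of i] by simp
      qed
      then obtain x where x: "z i \<bullet> x = 0" "x \<notin> L" by (auto simp: hyperplane_def)
      have zx: "z j \<bullet> x \<noteq> 0" if "L \<subseteq> hyperplane (z j)" "j \<noteq> i" for j
        using subspace_Int_eq_of_codim2[OF nz dist _ sub dim iL that(1)] that(2) x by (auto simp: hyperplane_def)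
      \<comment> \<open>With \<open>y\<close> in \<open>L\<close> off all hyperplanes not containing
        \<open>L\<close>, the points \<open>y + t *\<^sub>R x\<close> for small nonzero
        \<open>t\<close> lie on the wall of \<open>z i\<close> alone, and the signs at those other
        hyperplanes do not depend on the sign of \<open>t\<close>.\<close>
      have "\<exists>y\<in>L. \<forall>j\<in>{j. \<not> L \<subseteq> hyperplane (z j)}. z j \<bullet> y \<noteq> 0"
        by (rule exists_generic_in_subspace) (auto simp: sub hyperplane_def)
      then obtain y where y: "y \<in> L" "\<And>j. \<not> L \<subseteq> hyperplane (z j) \<Longrightarrow> z j \<bullet> y \<noteq> 0" by auto
      have zy: "z j \<bullet> y = 0" if "L \<subseteq> hyperplane (z j)" for j
        using that y(1) by (auto simp: hyperplane_def)
      obtain e where e: "e > 0" "\<And>k t. z k \<bullet> y \<noteq> 0 \<Longrightarrow> \<bar>t\<bar> \<le> e \<Longrightarrow>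
          sgn (z k \<bullet> (y + t *\<^sub>R x)) = sgn (z k \<bullet> y)"
        using sgn_inner_perturb_UNIV[where u=z and x=y and y=x] by metis
      have s1: "sgn (z j \<bullet> (y + t *\<^sub>R x)) = sgn t * sgn (z j \<bullet> x)" if "L \<subseteq> hyperplane (z j)" for j t
        using zy[OF that] by (simp add: inner_add_right sgn_mult)
      have zero: "z i \<bullet> signed_sum z UNIV (($) l) (y + t *\<^sub>R x) = 0" if t: "\<bar>t\<bar> \<le> e" "t \<noteq> 0" for t
      proof -
        have "z i \<bullet> (y + t *\<^sub>R x) = 0" using zy[OF iL] x(1) by (simp add: inner_add_right)
        moreover have "z j \<bullet> (y + t *\<^sub>R x) \<noteq> 0" if "j \<noteq> i" for j
        proof (cases "L \<subseteq> hyperplane (z j)")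
          case True
          then show ?thesis using zy[OF True] zx[OF True that] t by (simp add: inner_add_right)
        next
          case False
          then show ?thesis using e(2)[OF y(2)[OF False] t(1)] y(2)[OF False] by (metis sgn_zero_iff)
        qed
        ultimately show ?thesis using bal unfolding balanced_def by blast
      qed
      \<comment> \<open>Comparing the two sides of \<open>L\<close> inside \<open>hyperplane (z i)\<close> leaves only the indices of \<open>L\<close>.\<close>
      define g where "g t j = l $ j * (sgn (z j \<bullet> (y + t *\<^sub>R x)) * (z j \<bullet> z i))" for t j
      have "sum (g e) UNIV = 0" "sum (g (- e)) UNIV = 0"
        using zero[of e] zero[of "- e"] e(1) by (simp_all add: inner_signed_sum g_def)
      then have "(\<Sum>j\<in>UNIV. g e j - g (- e) j) = 0" by (simp add: sum_subtractf)
      also have "(\<Sum>j\<in>UNIV. g e j - g (- e) j) = (\<Sum>j\<in>{s. L \<subseteq> hyperplane (z s)}. g e j - g (- e) j)"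
      proof (rule sum.mono_neutral_right)
        show "\<forall>j\<in>UNIV - {s. L \<subseteq> hyperplane (z s)}. g e j - g (- e) j = 0"
          using e(2)[OF y(2), of _ e] e(2)[OF y(2), of _ "- e"] e(1) by (auto simp: g_def)
      qed auto
      also have "\<dots> = (\<Sum>j\<in>{s. L \<subseteq> hyperplane (z s)}. 2 * (l $ j * (sgn (z j \<bullet> x) * (z j \<bullet> z i))))"
      proof (rule sum.cong)
        fix j assume "j \<in> {s. L \<subseteq> hyperplane (z s)}"
        then show "g e j - g (- e) j = 2 * (l $ j * (sgn (z j \<bullet> x) * (z j \<bullet> z i)))"
          using s1[of j e] s1[of j "- e"] e(1) by (simp add: g_def)
      qed simp
      finally have "(\<Sum>j\<in>{s. L \<subseteq> hyperplane (z s)}. l $ j * (sgn (z j \<bullet> x) * (z j \<bullet> z i))) = 0"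
        by (simp flip: sum_distrib_left)
      moreover obtain \<rho> where "\<rho> \<noteq> 0"
        "(\<Sum>j\<in>{s. L \<subseteq> hyperplane (z s)}. l $ j * (sgn (z j \<bullet> x) * (z j \<bullet> z i))) =
          \<rho> * (\<Sum>b<length is'. skew_gram (map z is') a b * l $ (is' ! b))"
        using flat_row[OF is' a sub, of x "($) l"] x unfolding i_def by blast
      ultimately show "(\<Sum>b<length is'. skew_gram (map z is') a b * l $ (is' ! b)) = 0" by simp
    qed
  }
qed

section \<open>The two isomorphisms\<close>

lemma exists_wall_point:
  fixes z :: "'n::finite \<Rightarrow> 'a::euclidean_space"
  assumes nz: "\<And>i. z i \<noteq> 0" and dist: "inj (\<lambda>i. hyperplane (z i))"
  obtains x where "z i \<bullet> x = 0" "\<And>j. j \<noteq> i \<Longrightarrow> z j \<bullet> x \<noteq> 0"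
proof -
  have "\<exists>x\<in>hyperplane (z i). \<forall>j\<in>- {i}. z j \<bullet> x \<noteq> 0"
  proof (rule exists_generic_in_subspace)
    fix j assume j: "j \<in> - {i}"
    show "\<exists>y\<in>hyperplane (z i). z j \<bullet> y \<noteq> 0"
    proof (rule ccontr)
      assume "\<not> (\<exists>y\<in>hyperplane (z i). z j \<bullet> y \<noteq> 0)"
      then have "hyperplane (z i) \<subseteq> hyperplane (z j)" by (auto simp: hyperplane_def)
      then obtain c where c: "z j = c *\<^sub>R z i" by (rule hyperplane_eq_scaleR[OF nz])
      then have "c \<noteq> 0" using nz[of j] by auto
      then have "hyperplane (z j) = hyperplane (z i)" unfolding c by (rule hyperplane_scale)
      then show False using j dist by (auto dest: injD)
    qed
  qed (auto simp: subspace_central_hyperplane)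
  then show thesis using that by (auto simp: hyperplane_def)
qed

text \<open>Across the wall of \<open>z i\<close> the gradient jumps by \<open>2 * l $ i\<close>
  times \<open>z i\<close>, so each coefficient can be read off from the function.\<close>

lemma virtual_zonotope_eq_zeroD:
  fixes z :: "'n::finite \<Rightarrow> 'a::euclidean_space"
  assumes nz: "\<And>i. z i \<noteq> 0" and dist: "inj (\<lambda>i. hyperplane (z i))"
    and zero: "\<And>x. virtual_zonotope z l x = 0"
  shows "l = 0"
proof -
  have s0: "signed_sum z UNIV (($) l) p = 0" if p: "\<And>j. z j \<bullet> p \<noteq> 0" for p
  proof (rule sign_cone_inner_eqD[of z p, OF p])
    show "\<forall>x\<in>sign_cone z UNIV p. signed_sum z UNIV (($) l) p \<bullet> x = 0 \<bullet> x"
      using virtual_zonotope_sign_cone[of _ z p l] zero by simp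
  qed
  have "l $ i = 0" for i
  proof -
    obtain x where x: "z i \<bullet> x = 0" "\<And>j. j \<noteq> i \<Longrightarrow> z j \<bullet> x \<noteq> 0"
      using exists_wall_point[of z i] nz dist by blast
    obtain p q where pq: "\<And>j. z j \<bullet> p \<noteq> 0" "\<And>j. z j \<bullet> q \<noteq> 0"
      "\<And>j. j \<noteq> i \<Longrightarrow> sgn (z j \<bullet> p) = sgn (z j \<bullet> x)" "\<And>j. j \<noteq> i \<Longrightarrow> sgn (z j \<bullet> q) = sgn (z j \<bullet> x)"
      "sgn (z i \<bullet> p) = 1" "sgn (z i \<bullet> q) = -1"
      using exists_wall_neighbours[of z i x] nz x by blast
    have "(2 * (l $ i * sgn (z i \<bullet> p))) *\<^sub>R z i = 0"
      using signed_sums_across_wall(2)[of z i x p q "($) l"] s0[OF pq(1)] s0[OF pq(2)] x pq by simp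
    then show ?thesis using nz pq by simp
  qed
  then show ?thesis by (simp add: vec_eq_iff)
qed

lemma fun_class_eq_iff: "fun_class f = fun_class g \<longleftrightarrow> translation_equiv f g"
  by transfer simp

lemma fun_class_add: "fun_class (\<lambda>x. f x + g x) = fun_class f + fun_class g"
  by transfer (rule equivp_reflp[OF equivp_translation_equiv])

lemma fun_class_scaleR: "fun_class (\<lambda>x. c * f x) = c *\<^sub>R fun_class f"
  by transfer (rule equivp_reflp[OF equivp_translation_equiv])

lemma virtual_zonotope_add:
  "virtual_zonotope z (l + m) = (\<lambda>x. virtual_zonotope z l x + virtual_zonotope z m x)"
  by (rule ext) (simp add: virtual_zonotope_def distrib_right sum.distrib)

lemma virtual_zonotope_scaleR: "virtual_zonotope z (c *\<^sub>R l) = (\<lambda>x. c * virtual_zonotope z l x)"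
  by (rule ext) (simp add: virtual_zonotope_def sum_distrib_left mult.assoc)

lemma linear_fun_class_virtual_zonotope: "linear (\<lambda>l. fun_class (virtual_zonotope z l))"
  by (rule linearI) (simp_all add: virtual_zonotope_add virtual_zonotope_scaleR fun_class_add fun_class_scaleR)

lemma inj_fun_class_virtual_zonotope:
  fixes z :: "'n::finite \<Rightarrow> 'a::euclidean_space"
  assumes nz: "\<And>i. z i \<noteq> 0" and dist: "inj (\<lambda>i. hyperplane (z i))"
  shows "inj (\<lambda>l. fun_class (virtual_zonotope z l))"
proof (rule injI)
  fix l m assume "fun_class (virtual_zonotope z l) = fun_class (virtual_zonotope z m)"
  then obtain a where a: "\<And>x. virtual_zonotope z m x = virtual_zonotope z l x + a \<bullet> x"
    by (auto simp: fun_class_eq_iff translation_equiv_def)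
  have even: "virtual_zonotope z k (- x) = virtual_zonotope z k x" for k x
    by (simp add: virtual_zonotope_def)
  \<comment> \<open>Virtual zonotopes are even functions, so the linear difference is both even and
    odd.\<close>
  have "a \<bullet> x = 0" for x using a[of x] a[of "- x"] even by simp
  then have "virtual_zonotope z (m - l) x = 0" for x
    using a[of x] by (simp add: virtual_zonotope_def left_diff_distrib sum_subtractf)
  then have "m - l = 0" by (rule virtual_zonotope_eq_zeroD[OF nz dist])
  then show "l = m" by simp
qed

lemma fun_class_in_inscribed_space_iff:
  fixes z :: "'n::finite \<Rightarrow> 'a::euclidean_space"
  assumes nz: "\<And>i. z i \<noteq> 0" and dist: "inj (\<lambda>i. hyperplane (z i))"
  shows "fun_class (virtual_zonotope z l) \<in> inscribed_space (arrangement z) \<longleftrightarrow> balanced z (($) l)"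
proof
  assume "fun_class (virtual_zonotope z l) \<in> inscribed_space (arrangement z)"
  then obtain f a where "inscribed_virtual (arrangement z) f" "\<forall>x. f x = virtual_zonotope z l x + a \<bullet> x"
    by (auto simp: inscribed_space_def fun_class_eq_iff translation_equiv_def)
  moreover from this(2) have "f = (\<lambda>x. virtual_zonotope z l x + a \<bullet> x)" by auto
  ultimately show "balanced z (($) l)" using inscribed_virtual_iff_balanced[of z l a] nz dist by simp
next
  assume "balanced z (($) l)"
  then have "inscribed_virtual (arrangement z) (virtual_zonotope z l)"
    using inscribed_virtual_iff_balanced[of z l 0] nz dist by simp
  then show "fun_class (virtual_zonotope z l) \<in> inscribed_space (arrangement z)"
    by (simp add: inscribed_space_def)
qed

lemma flat_equation_add: "flat_equation z L l \<Longrightarrow> flat_equation z L m \<Longrightarrow> flat_equation z L (l + m)"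
  by (simp add: flat_equation_def distrib_left sum.distrib)

lemma flat_equation_scaleR: "flat_equation z L l \<Longrightarrow> flat_equation z L (c *\<^sub>R l)"
  by (simp add: flat_equation_def mult.left_commute[of _ c] flip: sum_distrib_left)

lemma flat_equation_zero: "flat_equation z L 0"
  by (simp add: flat_equation_def)

lemma virtual_zonotope_space_iso:
  fixes z :: "'n::finite \<Rightarrow> 'a::euclidean_space"
  assumes dist: "inj (\<lambda>i. hyperplane (z i))" and w: "\<And>i. w \<bullet> z i > 0"
  shows "vector_space_iso (\<lambda>l. fun_class (virtual_zonotope z l))
    {l :: real^'n. \<forall>L\<in>codim2_flats (arrangement z). flat_equation z L l} (virtual_zonotope_space z)"
    (is "vector_space_iso ?\<phi> ?K _")
proof -
  have nz: "z i \<noteq> 0" for i using w[of i] by auto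
  have img: "virtual_zonotope_space z = ?\<phi> ` ?K"
    using fun_class_in_inscribed_space_iff[of z] balanced_iff_flat_equations[OF dist w] nz dist
    by (auto simp: virtual_zonotope_space_def)
  have K: "subspace ?K"
    by (auto simp: subspace_def flat_equation_add flat_equation_scaleR flat_equation_zero)
  show ?thesis
    unfolding vector_space_iso_def
    using K linear_fun_class_virtual_zonotope[of z] inj_fun_class_virtual_zonotope[of z] nz dist
    by (auto simp: img bij_betw_def intro: linear_subspace_image inj_on_subset)
qed

lemma zonotope_eq_segment_sum: "zonotope z l = segment_sum z UNIV (($) l)"
  unfolding zonotope_def segment_sum_def
  by (simp add: closed_segment_linear_image[symmetric] linear_scaleR scaleR_minus_right[symmetric] del: scaleR_minus_right)

section \<open>Translation classes and their Minkowski sums\<close>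

lemma normal_fan_translation: "normal_fan ((+) t ` P) = normal_fan (P :: 'a::euclidean_space set)"
proof -
  have "normal_fan ((+) t ` P) \<subseteq> normal_fan P" for t and P :: "'a set"
  proof
    fix N assume "N \<in> normal_fan ((+) t ` P)"
    then obtain F where F: "N = normal_cone ((+) t ` P) F" "F face_of (+) t ` P" "F \<noteq> {}"
      by (auto simp: normal_fan_def)
    define G where "G = (+) (- t) ` F"
    have "F = (+) t ` G" by (simp add: G_def image_image)
    moreover from this have "G face_of P" "G \<noteq> {}" using F by (auto simp: face_of_translation_eq)
    moreover have "normal_cone ((+) t ` P) ((+) t ` G) = normal_cone P G"
      by (simp add: normal_cone_def inner_add_right)
    ultimately show "N \<in> normal_fan P" using F(1) by (auto simp: normal_fan_def)
  qed
  from this[of t P] this[of "- t" "(+) t ` P"] show ?thesis by (simp add: image_image)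
qed

lemma inscribed_polytope_translation:
  "inscribed_polytope ((+) t ` P) \<longleftrightarrow> inscribed_polytope (P :: 'a::euclidean_space set)"
proof -
  have imp: "inscribed_polytope ((+) t ` P)" if P: "inscribed_polytope P" for t and P :: "'a set"
  proof -
    obtain c r where cr: "{v. v extreme_point_of P} \<subseteq> sphere c r"
      using P by (auto simp: inscribed_polytope_def on_common_sphere_def)
    have "{v. v extreme_point_of (+) t ` P} \<subseteq> sphere (t + c) r"
    proof
      fix v assume v: "v \<in> {v. v extreme_point_of (+) t ` P}"
      then have "v - t extreme_point_of P"
        using extreme_point_of_translation_eq[of t "v - t" P] by simp
      then have "dist c (v - t) = r" using cr by auto
      then show "v \<in> sphere (t + c) r" by (simp add: dist_norm algebra_simps)
    qed
    then show ?thesis by (auto simp: inscribed_polytope_def on_common_sphere_def)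
  qed
  show ?thesis using imp[of P t] imp[of "(+) t ` P" "- t"] by (auto simp: image_image)
qed

lemma translation_class_translation: "translation_class ((+) t ` P) = translation_class P"
proof -
  have sub: "translation_class ((+) t ` P) \<subseteq> translation_class P" for t P
    by (auto simp: translation_class_def image_image add.assoc[symmetric])
  from this[of t P] this[of "- t" "(+) t ` P"] show ?thesis by (simp add: image_image)
qed

lemma translation_class_eqD:
  assumes "translation_class P = translation_class Q"
  obtains t where "P = (+) t ` Q"
proof -
  have "P \<in> translation_class P" unfolding translation_class_def by (rule range_eqI[of _ _ 0]) simp
  then have "P \<in> translation_class Q" by (simp only: assms)
  then show thesis using that unfolding translation_class_def by blast
qed

lemma translation_class_plus: "translation_class P + translation_class Q = translation_class (P + Q)"
proof -
  have plus: "(+) s ` P + (+) t ` Q = (+) (s + t) ` (P + Q)" for s t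
  proof (intro equalityI subsetI)
    fix x assume "x \<in> (+) s ` P + (+) t ` Q"
    then obtain p q where "p \<in> P" "q \<in> Q" "x = (s + p) + (t + q)" by (auto elim!: set_plus_elim)
    then have "x = (s + t) + (p + q)" "p + q \<in> P + Q" by (auto simp: algebra_simps)
    then show "x \<in> (+) (s + t) ` (P + Q)" by blast
  next
    fix x assume "x \<in> (+) (s + t) ` (P + Q)"
    then obtain p q where "p \<in> P" "q \<in> Q" "x = (s + t) + (p + q)" by (auto elim!: set_plus_elim)
    then have "x = (s + p) + (t + q)" "s + p \<in> (+) s ` P" "t + q \<in> (+) t ` Q" by (auto simp: algebra_simps)
    then show "x \<in> (+) s ` P + (+) t ` Q" by blast
  qed
  show ?thesis
  proof (intro equalityI subsetI)
    fix X assume "X \<in> translation_class P + translation_class Q"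
    then obtain s t where "X = (+) s ` P + (+) t ` Q"
      by (auto simp: translation_class_def elim!: set_plus_elim)
    then show "X \<in> translation_class (P + Q)" by (auto simp: plus translation_class_def)
  next
    fix X assume "X \<in> translation_class (P + Q)"
    then obtain t where "X = (+) t ` (P + Q)" by (auto simp: translation_class_def)
    then have "X = (+) t ` P + (+) 0 ` Q" by (simp only: plus add_0_right)
    then show "X \<in> translation_class P + translation_class Q"
      by (auto simp only: translation_class_def)
  qed
qed

lemma class_scale_translation_class:
  assumes "c \<noteq> 0"
  shows "class_scale c (translation_class P) = translation_class ((*\<^sub>R) c ` P)"
proof -
  have e: "(*\<^sub>R) c ` (+) t ` P = (+) (c *\<^sub>R t) ` (*\<^sub>R) c ` P" for t
    by (simp add: image_image scaleR_add_right)
  have "range (\<lambda>t. (+) (c *\<^sub>R t) ` (*\<^sub>R) c ` P) = range (\<lambda>t. (+) t ` (*\<^sub>R) c ` P)"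
  proof (intro equalityI subsetI)
    fix X assume "X \<in> range (\<lambda>t. (+) t ` (*\<^sub>R) c ` P)"
    then obtain t where "X = (+) t ` (*\<^sub>R) c ` P" by auto
    then have "X = (+) (c *\<^sub>R ((1 / c) *\<^sub>R t)) ` (*\<^sub>R) c ` P" using assms by simp
    then show "X \<in> range (\<lambda>t. (+) (c *\<^sub>R t) ` (*\<^sub>R) c ` P)" by blast
  qed auto
  then show ?thesis by (simp add: class_scale_def translation_class_def image_image[of "(`) ((*\<^sub>R) c)"] e)
qed

section \<open>Recovering generators from the normal fan\<close>

text \<open>Reduces to the addition of symmetric intervals on each line. The signs matter: with
  coefficients of opposite sign the half-lengths would add as absolute values.\<close>

lemma segment_sum_plus:
  fixes z :: "'i \<Rightarrow> 'a::euclidean_space"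
  assumes I: "finite I" and l: "\<And>i. i \<in> I \<Longrightarrow> l i \<ge> 0" and m: "\<And>i. i \<in> I \<Longrightarrow> m i \<ge> 0"
  shows "segment_sum z I (\<lambda>i. l i + m i) = segment_sum z I l + segment_sum z I m"
proof -
  have seg: "closed_segment (- ((c + d) *\<^sub>R v)) ((c + d) *\<^sub>R v) =
      closed_segment (- (c *\<^sub>R v)) (c *\<^sub>R v) + closed_segment (- (d *\<^sub>R v)) (d *\<^sub>R v)"
    if c: "c \<ge> 0" and d: "d \<ge> 0" for c d :: real and v :: 'a
  proof -
    have seg': "closed_segment (- (e *\<^sub>R v)) (e *\<^sub>R v) = {r *\<^sub>R v | r. \<bar>r\<bar> \<le> e}" if "e \<ge> 0" for e :: real
    proof -
      have "closed_segment (- (e *\<^sub>R v)) (e *\<^sub>R v) = (\<lambda>r. r *\<^sub>R v) ` closed_segment (- e) e"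
        using closed_segment_linear_image[of "\<lambda>r. r *\<^sub>R v" "- e" e] by (simp add: linear_scaleR_left)
      then show ?thesis using that by (auto simp: closed_segment_eq_real_ivl abs_le_iff image_iff)
    qed
    have cd: "0 \<le> c + d" using c d by simp
    show ?thesis
    proof (intro equalityI subsetI)
      fix x assume "x \<in> closed_segment (- ((c + d) *\<^sub>R v)) ((c + d) *\<^sub>R v)"
      then obtain r where r: "x = r *\<^sub>R v" "\<bar>r\<bar> \<le> c + d"
        unfolding seg'[OF cd] by blast
      \<comment> \<open>\<open>r\<close> is truncated to the interval from \<open>- c\<close> to
        \<open>c\<close>; the remainder is then at most \<open>d\<close> in absolute value.\<close>
      define s where "s = max (- c) (min c r)"
      have "\<bar>s\<bar> \<le> c" "\<bar>r - s\<bar> \<le> d" using r(2) c d unfolding s_def by linarith+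
      moreover have "x = s *\<^sub>R v + (r - s) *\<^sub>R v" by (simp add: r(1) flip: scaleR_add_left)
      ultimately show "x \<in> closed_segment (- (c *\<^sub>R v)) (c *\<^sub>R v) + closed_segment (- (d *\<^sub>R v)) (d *\<^sub>R v)"
        using seg'[OF c] seg'[OF d] by blast
    next
      fix x assume "x \<in> closed_segment (- (c *\<^sub>R v)) (c *\<^sub>R v) + closed_segment (- (d *\<^sub>R v)) (d *\<^sub>R v)"
      then obtain r s where "x = r *\<^sub>R v + s *\<^sub>R v" "\<bar>r\<bar> \<le> c" "\<bar>s\<bar> \<le> d"
        using seg'[OF c] seg'[OF d] by (auto elim!: set_plus_elim)
      then have "x = (r + s) *\<^sub>R v" "\<bar>r + s\<bar> \<le> c + d" by (auto simp: scaleR_add_left)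
      then show "x \<in> closed_segment (- ((c + d) *\<^sub>R v)) ((c + d) *\<^sub>R v)"
        unfolding seg'[OF cd] by blast
    qed
  qed
  show ?thesis
    unfolding segment_sum_def sum.distrib[symmetric] using l m by (intro sum.cong refl seg)
qed

lemma scaleR_image_segment_sum:
  fixes z :: "'b \<Rightarrow> 'a::euclidean_space"
  assumes "finite I"
  shows "(*\<^sub>R) c ` segment_sum z I l = segment_sum z I (\<lambda>i. c * l i)"
proof -
  have plus: "(*\<^sub>R) c ` (A + B) = (*\<^sub>R) c ` A + (*\<^sub>R) c ` B" for A B :: "'a set"
    by (auto simp: scaleR_add_right elim!: set_plus_elim intro!: imageI) (metis imageI scaleR_add_right set_plus_intro)
  have "(*\<^sub>R) c ` (\<Sum>i\<in>I. S i) = (\<Sum>i\<in>I. (*\<^sub>R) c ` S i)" for S :: "'b \<Rightarrow> 'a set"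
    using assms by (induction I) (simp_all add: plus)
  then show ?thesis
    unfolding segment_sum_def
    by (simp add: closed_segment_linear_image[symmetric] linear_scaleR)
qed

lemma is_zonotope_segment_sum:
  assumes "finite I"
  shows "is_zonotope (segment_sum z I l)"
proof -
  obtain h where h: "bij_betw h {0..<card I} I" using ex_bij_betw_nat_finite[OF assms] by blast
  have "segment_sum z I l =
      (\<Sum>j<card I. closed_segment (- (l (h j) *\<^sub>R z (h j))) (l (h j) *\<^sub>R z (h j)))"
    unfolding segment_sum_def using sum.reindex_bij_betw[OF h, symmetric] by (simp add: lessThan_atLeast0)
  then have "\<exists>a b. segment_sum z I l = (\<Sum>j<card I. closed_segment (a j) (b j))"
    by (rule exI[where x = "\<lambda>j. - (l (h j) *\<^sub>R z (h j))", OF exI[where x = "\<lambda>j. l (h j) *\<^sub>R z (h j)"]])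
  then show ?thesis unfolding is_zonotope_def by blast
qed

text \<open>Each segment is moved to be centred at 0. The lengths go into \<open>u\<close>, so all
  coefficients are 1 and the results for positive coefficients apply even when some segments are
  single points.\<close>

lemma is_zonotope_imp_segment_sum:
  fixes P :: "'a::euclidean_space set"
  assumes "is_zonotope P"
  obtains t u and m :: nat where "P = (+) t ` segment_sum u {..<m} (\<lambda>_. 1)"
proof -
  obtain m a b where P: "P = (\<Sum>j<(m::nat). closed_segment (a j) (b j))"
    using assms by (auto simp: is_zonotope_def)
  define c u where "c j = (1/2) *\<^sub>R (a j + b j)" "u j = (1/2) *\<^sub>R (b j - a j)" for j
  have tr: "{t} + S = (+) t ` S" for t and S :: "'a set"
    by (auto simp: set_plus_def)
  have seg: "closed_segment (a j) (b j) = {c j} + closed_segment (- u j) (u j)" for j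
  proof -
    have "c j + - u j = a j" "c j + u j = b j"
      by (simp_all add: c_u_def algebra_simps flip: scaleR_add_left)
    then show ?thesis unfolding tr closed_segment_translation[symmetric] by simp
  qed
  have "(\<Sum>j<k. {c j}) = {\<Sum>j<k. c j}" for k :: nat
    by (induction k) (simp_all add: tr)
  then have "P = (+) (\<Sum>j<m. c j) ` (\<Sum>j<m. closed_segment (- u j) (u j))"
    unfolding P seg sum.distrib by (simp add: tr)
  then show thesis using that[of "\<Sum>j<m. c j" u m] by (simp add: segment_sum_def)
qed

text \<open>\<open>sign_cone u I a\<close> is the smallest cone of its fan containing \<open>a\<close>, so the fan determines it.\<close>

lemma sign_cone_eq_of_range_eq:
  assumes "range (sign_cone u I) = range (sign_cone z J)"
  shows "sign_cone u I a = sign_cone z J a"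
proof -
  have sub: "sign_cone u I a \<subseteq> sign_cone z J a"
    if r: "range (sign_cone u I) = range (sign_cone z J)" for u :: "'i \<Rightarrow> 'a" and I and z :: "'j \<Rightarrow> 'a" and J
  proof -
    obtain b where b: "sign_cone z J a = sign_cone u I b" using r by (metis rangeE rangeI)
    then have "a \<in> sign_cone u I b" using self_in_sign_cone by blast
    then show ?thesis unfolding b by (rule sign_cone_mono)
  qed
  show ?thesis using sub[OF assms] sub[OF assms[symmetric]] by (rule subset_antisym)
qed

lemma generic_perturb_in_sign_cone:
  assumes "finite I" "generic u I x"
  obtains e where "e > 0" "x + e *\<^sub>R y \<in> sign_cone u I x"
proof -
  obtain e where e: "e > 0" "\<And>k t. k \<in> I \<Longrightarrow> u k \<bullet> x \<noteq> 0 \<Longrightarrow> \<bar>t\<bar> \<le> e \<Longrightarrow>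
      sgn (u k \<bullet> (x + t *\<^sub>R y)) = sgn (u k \<bullet> x)"
    using sgn_inner_perturb[OF assms(1), of u x y] by blast
  have "sgn (u k \<bullet> (x + e *\<^sub>R y)) = sgn (u k \<bullet> x)" if "k \<in> I" for k
    using e that assms(2) by (cases "u k = 0") (auto simp: generic_def)
  then have "sign_cone u I (x + e *\<^sub>R y) = sign_cone u I x" by (rule sign_cone_cong)
  then show thesis using that e(1) self_in_sign_cone by blast
qed

text \<open>Equal fans have equal cones at every point. This makes every nonzero generator parallel
  to some \<open>z i\<close> and every \<open>z i\<close> parallel to some generator; merging
  parallel generators yields the coefficients.\<close>

lemma zonotope_of_normal_fan:
  fixes z :: "'n::finite \<Rightarrow> 'a::euclidean_space"
  assumes nz: "\<And>i. z i \<noteq> 0" and dist: "inj (\<lambda>i. hyperplane (z i))"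
    and P: "is_zonotope P" "normal_fan P = range (sign_cone z UNIV)"
  obtains t and l :: "real^'n" where "P = (+) t ` zonotope z l" "\<And>i. l $ i > 0"
proof -
  obtain t u and m :: nat where Pu: "P = (+) t ` segment_sum u {..<m} (\<lambda>_. 1)"
    using is_zonotope_imp_segment_sum[OF P(1)] .
  have "range (sign_cone u {..<m}) = range (sign_cone z UNIV)"
    using P(2) normal_fan_segment_sum[of "{..<m}" "\<lambda>_. 1" u] by (simp add: Pu normal_fan_translation)
  then have same: "sign_cone u {..<m} a = sign_cone z UNIV a" for a by (rule sign_cone_eq_of_range_eq)
  define J where "J = {j \<in> {..<m}. u j \<noteq> 0}"
  have "\<exists>i c. c \<noteq> 0 \<and> u j = c *\<^sub>R z i" if j: "j \<in> J" for j
  proof -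
    have "\<exists>i. hyperplane (u j) \<subseteq> hyperplane (z i)"
    proof (rule ccontr)
      assume "\<nexists>i. hyperplane (u j) \<subseteq> hyperplane (z i)"
      \<comment> \<open>Such an \<open>x\<close> can be moved in any direction within its cone for
        \<open>z\<close>, whereas its cone for \<open>u\<close> lies in the hyperplane of
        \<open>u j\<close>; yet the two cones are equal.\<close>
      then have "\<exists>x\<in>hyperplane (u j). \<forall>i\<in>UNIV. z i \<bullet> x \<noteq> 0"
        by (intro exists_generic_in_subspace subspace_central_hyperplane) (auto simp: hyperplane_def)
      then obtain x where x: "u j \<bullet> x = 0" "generic z UNIV x" by (auto simp: hyperplane_def generic_def)
      obtain e where e: "e > 0" "x + e *\<^sub>R u j \<in> sign_cone z UNIV x"
        using generic_perturb_in_sign_cone[OF finite x(2)] .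
      then have "u j \<bullet> (x + e *\<^sub>R u j) = 0"
        using sign_coneD(1)[of "x + e *\<^sub>R u j" u "{..<m}" x j] j x(1) by (simp add: same J_def)
      then show False using x(1) e(1) j by (simp add: inner_add_right J_def)
    qed
    then obtain i where i: "hyperplane (u j) \<subseteq> hyperplane (z i)" by blast
    have "u j \<noteq> 0" using j by (simp add: J_def)
    then obtain c where c: "z i = c *\<^sub>R u j" using hyperplane_eq_scaleR[OF _ i] by blast
    then have "c \<noteq> 0" using nz[of i] by auto
    then have "u j = (1 / c) *\<^sub>R z i" "1 / c \<noteq> 0" using c by auto
    then show ?thesis by blast
  qed
  then obtain \<iota> c where \<iota>: "\<And>j. j \<in> J \<Longrightarrow> c j \<noteq> 0 \<and> u j = c j *\<^sub>R z (\<iota> j)" by metis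
  \<comment> \<open>Generators parallel to \<open>z i\<close> are merged. Absolute values occur
    because a segment centred at 0 does not change when its generator is negated.\<close>
  define l :: "real^'n" where "l = (\<chi> i. \<Sum>j\<in>{j\<in>J. \<iota> j = i}. \<bar>c j\<bar>)"
  have l0: "l $ i \<ge> 0" for i by (simp add: l_def sum_nonneg)
  have supp: "(\<Sum>j<m. 1 * \<bar>u j \<bullet> x\<bar>) = (\<Sum>i\<in>UNIV. l $ i * \<bar>z i \<bullet> x\<bar>)" for x
  proof -
    have "(\<Sum>j<m. 1 * \<bar>u j \<bullet> x\<bar>) = (\<Sum>j\<in>J. \<bar>u j \<bullet> x\<bar>)"
      unfolding J_def by (simp, intro sum.mono_neutral_right) auto
    also have "\<dots> = (\<Sum>i\<in>UNIV. \<Sum>j\<in>{j\<in>J. \<iota> j = i}. \<bar>u j \<bullet> x\<bar>)"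
      by (rule sum.group[symmetric]) (auto simp: J_def)
    also have "\<dots> = (\<Sum>i\<in>UNIV. l $ i * \<bar>z i \<bullet> x\<bar>)"
      unfolding l_def by (auto intro!: sum.cong simp: sum_distrib_right \<iota> abs_mult)
    finally show ?thesis .
  qed
  \<comment> \<open>Both sides are determined by their support functions, which \<open>supp\<close>
    identifies.\<close>
  have "segment_sum u {..<m} (\<lambda>_. 1) = zonotope z l"
    using supp by (auto simp: set_eq_iff zonotope_eq_segment_sum in_segment_sum_iff l0)
  moreover have "l $ i > 0" for i
  \<comment> \<open>Without a generator parallel to \<open>z i\<close>, a point on the wall of
    \<open>z i\<close> would be generic for \<open>u\<close>, and the previous conflict of cones
    recurs with the two families exchanged.\<close>
  proof (rule ccontr)
    assume "\<not> l $ i > 0"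
    then have "l $ i = 0" using l0[of i] by linarith
    then have "(\<Sum>j\<in>{j\<in>J. \<iota> j = i}. \<bar>c j\<bar>) = 0" by (simp add: l_def)
    moreover have "finite {j\<in>J. \<iota> j = i}" by (simp add: J_def)
    ultimately have no: "\<iota> j \<noteq> i" if "j \<in> J" for j using \<iota> that by (auto simp: sum_nonneg_eq_0_iff)
    obtain x where x: "z i \<bullet> x = 0" "\<And>j. j \<noteq> i \<Longrightarrow> z j \<bullet> x \<noteq> 0"
      using exists_wall_point[of z i] nz dist by blast
    have "generic u {..<m} x"
      unfolding generic_def
    proof (intro ballI impI)
      fix j assume "j \<in> {..<m}" "u j \<noteq> 0"
      then have "j \<in> J" by (simp add: J_def)
      then show "u j \<bullet> x \<noteq> 0" using \<iota> x(2)[OF no] by (metis inner_scaleR_left mult_eq_0_iff)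
    qed
    then obtain e where e: "e > 0" "x + e *\<^sub>R z i \<in> sign_cone u {..<m} x"
      using generic_perturb_in_sign_cone[OF finite_lessThan] by metis
    then have "z i \<bullet> (x + e *\<^sub>R z i) = 0"
      using sign_coneD(1)[of "x + e *\<^sub>R z i" z UNIV x i] x(1) by (simp add: same)
    then show False using x(1) e(1) nz by (simp add: inner_add_right)
  qed
  ultimately show thesis using that Pu by simp
qed

text \<open>For positive coefficients \<open>virtual_zonotope z l\<close> is the support function of
  \<open>zonotope z l\<close>, attained at \<open>signed_sum\<close>. This transfers injectivity
  from virtual zonotopes to translation classes of zonotopes.\<close>

lemma zonotope_translation_imp_virtual:
  fixes z :: "'n::finite \<Rightarrow> 'a::euclidean_space"
  assumes l: "\<And>i. l $ i > 0" and m: "\<And>i. m $ i > 0" and eq: "zonotope z l = (+) t ` zonotope z m"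
  shows "virtual_zonotope z l x = virtual_zonotope z m x + t \<bullet> x"
proof (rule antisym)
  have self: "x \<bullet> signed_sum z UNIV (($) k) x = virtual_zonotope z k x" for k
    by (simp add: inner_signed_sum_self virtual_zonotope_def)
  have le: "x \<bullet> y \<le> virtual_zonotope z k x" if "y \<in> zonotope z k" "\<And>i. k $ i > 0" for y and k :: "real^'n"
    using inner_le_segment_sum[of UNIV "($) k" y z x] that
    by (simp add: zonotope_eq_segment_sum virtual_zonotope_def less_imp_le)
  have mem: "signed_sum z UNIV (($) k) x \<in> zonotope z k" for k
    by (simp add: zonotope_eq_segment_sum signed_sum_in_segment_sum)
  obtain y where y: "y \<in> zonotope z m" "signed_sum z UNIV (($) l) x = t + y"
    using mem[of l] unfolding eq by blast
  show "virtual_zonotope z l x \<le> virtual_zonotope z m x + t \<bullet> x"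
    using le[OF y(1) m] self[of l] unfolding y(2) by (simp add: inner_add_right inner_commute)
  have "t + signed_sum z UNIV (($) m) x \<in> zonotope z l" unfolding eq using mem by blast
  from le[OF this l] show "virtual_zonotope z m x + t \<bullet> x \<le> virtual_zonotope z l x"
    by (simp add: self inner_add_right inner_commute)
qed

lemma inscribed_zonotope_iff_balanced:
  fixes z :: "'n::finite \<Rightarrow> 'a::euclidean_space"
  assumes nz: "\<And>i. z i \<noteq> 0" and dist: "inj (\<lambda>i. hyperplane (z i))" and l: "\<And>i. l $ i > 0"
  shows "inscribed_polytope (zonotope z l) \<longleftrightarrow> balanced z (($) l)"
proof -
  have g: "generic z UNIV p \<longleftrightarrow> (\<forall>j. z j \<bullet> p \<noteq> 0)" for p using nz by (simp add: generic_def)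
  have "inscribed_polytope (zonotope z l) \<longleftrightarrow> (\<forall>p q. generic z UNIV p \<longrightarrow> generic z UNIV q \<longrightarrow>
      norm (signed_sum z UNIV (($) l) p) = norm (signed_sum z UNIV (($) l) q))"
    unfolding zonotope_eq_segment_sum using l by (intro inscribed_segment_sum_iff) auto
  also have "\<dots> \<longleftrightarrow> balanced z (($) l)"
  proof
    assume eq: "\<forall>p q. generic z UNIV p \<longrightarrow> generic z UNIV q \<longrightarrow>
      norm (signed_sum z UNIV (($) l) p) = norm (signed_sum z UNIV (($) l) q)"
    have "l $ i \<noteq> 0" for i using l[of i] by simp
    then show "balanced z (($) l)"
      using nz eq by (intro norm_signed_sum_eq_imp_balanced) blast+
  next
    assume "balanced z (($) l)"
    then show "\<forall>p q. generic z UNIV p \<longrightarrow> generic z UNIV q \<longrightarrow>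
      norm (signed_sum z UNIV (($) l) p) = norm (signed_sum z UNIV (($) l) q)"
      using balanced_norm_signed_sum_eq[OF dist] g by blast
  qed
  finally show ?thesis .
qed

lemma inscribed_zonotope_cone_iso:
  fixes z :: "'n::finite \<Rightarrow> 'a::euclidean_space"
  assumes dist: "inj (\<lambda>i. hyperplane (z i))" and w: "\<And>i. w \<bullet> z i > 0"
  shows "cone_iso (\<lambda>l. translation_class (zonotope z l))
    {l :: real^'n. (\<forall>i. l $ i > 0) \<and> (\<forall>L\<in>codim2_flats (arrangement z). flat_equation z L l)}
    (inscribed_zonotope_cone (arrangement z))"
    (is "cone_iso ?\<phi> ?K ?M")
proof -
  have nz: "z i \<noteq> 0" for i using w[of i] by auto
  have K: "l \<in> ?K \<longleftrightarrow> (\<forall>i. l $ i > 0) \<and> balanced z (($) l)" for l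
    using balanced_iff_flat_equations[OF dist w] by simp
  have fan: "normal_fan (zonotope z l) = range (sign_cone z UNIV)" if "\<forall>i. l $ i > 0" for l
    unfolding zonotope_eq_segment_sum using that by (intro normal_fan_segment_sum) auto
  \<comment> \<open>With the target identified as an image, its closure under sums and dilations is
    inherited from the parameters.\<close>
  have M: "?M = ?\<phi> ` ?K"
  proof (intro equalityI subsetI)
    fix X assume "X \<in> ?M"
    then obtain P where X: "X = translation_class P" and P: "is_zonotope P"
      "normal_fan P = range (sign_cone z UNIV)" "inscribed_polytope P"
      by (auto simp: inscribed_zonotope_cone_def arrangement_fan_eq[OF nz])
    obtain t and l :: "real^'n" where l: "P = (+) t ` zonotope z l" "\<And>i. l $ i > 0"
      using zonotope_of_normal_fan[OF nz dist P(1,2)] by blast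
    then have "balanced z (($) l)"
      using P(3) inscribed_zonotope_iff_balanced[of z l] nz dist by (simp add: inscribed_polytope_translation)
    then have "l \<in> ?K" using l(2) K by blast
    moreover have "X = ?\<phi> l" unfolding X l(1) by (rule translation_class_translation)
    ultimately show "X \<in> ?\<phi> ` ?K" by blast
  next
    fix X assume "X \<in> ?\<phi> ` ?K"
    then obtain l where l: "X = ?\<phi> l" "\<forall>i. l $ i > 0" "balanced z (($) l)" using K by blast
    then have "inscribed_polytope (zonotope z l)"
      using inscribed_zonotope_iff_balanced[of z l] nz dist by simp
    moreover have "is_zonotope (zonotope z l)"
      unfolding zonotope_eq_segment_sum by (rule is_zonotope_segment_sum) simp
    ultimately show "X \<in> ?M"
      unfolding inscribed_zonotope_cone_def arrangement_fan_eq[OF nz] using l fan by blast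
  qed
  have inj: "inj_on ?\<phi> ?K"
  proof (rule inj_onI)
    fix l m assume lm: "l \<in> ?K" "m \<in> ?K" "?\<phi> l = ?\<phi> m"
    then obtain t where "zonotope z l = (+) t ` zonotope z m" by (metis translation_class_eqD)
    then have "virtual_zonotope z l x = virtual_zonotope z m x + t \<bullet> x" for x
      using zonotope_translation_imp_virtual[of l m z t x] lm(1,2) by blast
    then have "fun_class (virtual_zonotope z m) = fun_class (virtual_zonotope z l)"
      by (auto simp: fun_class_eq_iff translation_equiv_def)
    then show "l = m" using inj_fun_class_virtual_zonotope[of z] nz dist by (auto dest: injD)
  qed
  have Kadd: "l + m \<in> ?K" if "l \<in> ?K" "m \<in> ?K" for l m
    using that by (auto simp: flat_equation_add add_pos_pos)
  have Kscale: "c *\<^sub>R l \<in> ?K" if "c > 0" "l \<in> ?K" for c l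
    using that by (auto simp: flat_equation_scaleR)
  have add: "?\<phi> (l + m) = ?\<phi> l + ?\<phi> m" if "l \<in> ?K" "m \<in> ?K" for l m
  proof -
    have "zonotope z (l + m) = zonotope z l + zonotope z m"
      using segment_sum_plus[of UNIV "($) l" "($) m" z] that
      by (simp add: zonotope_eq_segment_sum plus_vec_def[symmetric] less_imp_le flip: vector_add_component)
    then show ?thesis by (simp add: translation_class_plus)
  qed
  have scale: "?\<phi> (c *\<^sub>R l) = class_scale c (?\<phi> l)" if "c > 0" for c l
  proof -
    have "zonotope z (c *\<^sub>R l) = (*\<^sub>R) c ` zonotope z l"
      unfolding zonotope_eq_segment_sum scaleR_image_segment_sum[OF finite]
      by (simp add: segment_sum_def)
    then show ?thesis using that by (simp add: class_scale_translation_class)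
  qed
  show ?thesis
    unfolding cone_iso_def
  proof (intro conjI ballI allI impI)
    show "bij_betw ?\<phi> ?K ?M" using inj M by (simp add: bij_betw_def)
  next
    fix X Y assume "X \<in> ?M" "Y \<in> ?M"
    then obtain l m where lm: "l \<in> ?K" "m \<in> ?K" "X = ?\<phi> l" "Y = ?\<phi> m" unfolding M by blast
    then have "X + Y = ?\<phi> (l + m)" using add by simp
    then show "X + Y \<in> ?M" unfolding M using Kadd[OF lm(1,2)] by blast
  next
    fix c :: real and X assume c: "c > 0" and "X \<in> ?M"
    then obtain l where l: "l \<in> ?K" "X = ?\<phi> l" unfolding M by blast
    then have "class_scale c X = ?\<phi> (c *\<^sub>R l)" using scale[OF c] by simp
    then show "class_scale c X \<in> ?M" unfolding M using Kscale[OF c l(1)] by blast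
  next
    show "l + m \<in> ?K" if "l \<in> ?K" "m \<in> ?K" for l m using that by (rule Kadd)
    show "c *\<^sub>R l \<in> ?K" if "0 < c" "l \<in> ?K" for c l using that by (rule Kscale)
    show "?\<phi> (l + m) = ?\<phi> l + ?\<phi> m" if "l \<in> ?K" "m \<in> ?K" for l m using that by (rule add)
    show "?\<phi> (c *\<^sub>R l) = class_scale c (?\<phi> l)" if "0 < c" for c l using that by (rule scale)
  qed
qed

theorem theorem4p12:
  fixes z :: "'n::finite \<Rightarrow> real^'d"
  assumes distinct: "inj (\<lambda>i. hyperplane (z i))"
    and halfspace: "\<exists>w. \<forall>i. w \<bullet> z i > 0"
  shows "(vector_space_iso (\<lambda>l. fun_class (virtual_zonotope z l))
           {l :: real^'n. \<forall>L\<in>codim2_flats (arrangement z). flat_equation z L l}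
           (virtual_zonotope_space z))
    \<and> (cone_iso (\<lambda>l. translation_class (zonotope z l))
           {l :: real^'n. (\<forall>i. l $ i > 0) \<and>
              (\<forall>L\<in>codim2_flats (arrangement z). flat_equation z L l)}
           (inscribed_zonotope_cone (arrangement z)))"
proof -
  obtain w where "\<And>i. w \<bullet> z i > 0" using halfspace by blast
  then show ?thesis
    using virtual_zonotope_space_iso[OF distinct] inscribed_zonotope_cone_iso[OF distinct] by blast
qed

end
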